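(* Let $\Omega$ be a domain in $\mathbb{R}^3$, let $f$ be a nonvanishing scalar function in $\Omega$, and let $q=\frac{\Delta f}{f}$. (1) Let $W_0$ be a scalar solution of $(-\Delta+q)W_0=0$ in $\Omega$. Then the vector function $\mathbf{W}$ such that $\mathbf{\Phi}=f\mathbf{W}$ is a solution of $$\operatorname{rot}\big(f^{-2}\operatorname{rot}\mathbf{\Phi}\big)=0\quad\text{and}\quad\operatorname{div}\mathbf{\Phi}=0$$ and $W=W_0+\mathbf{W}$ is a solution of $DW-\frac{Df}{f}\,\overline{W}=0$, is constructed according to the formula $$\mathbf{W}=-f^{-1}\left\{\operatorname{rot}\Big(\mathbf{B}\big[f^2\,\nabla(f^{-1}W_0)\big]\Big)+\nabla h\right\},$$ where $h$ is an arbitrary harmonic function in $\Omega$. (2) Given a solution $\mathbf{\Phi}$ of $\operatorname{rot}(f^{-2}\operatorname{rot}\mathbf{\Phi})=0$ and $\operatorname{div}\mathbf{\Phi}=0$, for $\mathbf{W}=\frac1f\mathbf{\Phi}$ the corresponding solution $W_0$ of $(-\Delta+q)W_0=0$ such that $W=W_0+\mathbf{W}$ is a solution of $DW-\frac{Df}{f}\,\overline{W}=0$, is constructed as $$W_0=-f\,\mathcal{A}\big[f^{-2}\operatorname{rot}(f\mathbf{W})\big].$$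
   Context: $\mathbb{H}(\mathbb{C})$ is the algebra of complex quaternions $Q=\sum_{\alpha=0}^3Q_\alpha\mathbf{e}_\alpha$, $Q_\alpha\in\mathbb{C}$, where $\mathbf{e}_0=1$ and $\mathbf{e}_1,\mathbf{e}_2,\mathbf{e}_3$ are the standard quaternionic imaginary units ($\mathbf{e}_k^2=-1$, $\mathbf{e}_1\mathbf{e}_2=\mathbf{e}_3=-\mathbf{e}_2\mathbf{e}_1$ and cyclically); the complex imaginary unit $i$ commutes with all $\mathbf{e}_\alpha$. Write $Q=Q_0+\mathbf{Q}$ with scalar part $Q_0$ and vector part $\mathbf{Q}=\sum_{k=1}^3Q_k\mathbf{e}_k$; purely vectorial quaternions ($Q_0=0$) are identified with vectors in $\mathbb{C}^3$. Scalar functions are complex-valued. The quaternionic conjugate is $\overline{Q}=Q_0-\mathbf{Q}$ (complex conjugation is not applied). $DQ=\sum_{k=1}^3\mathbf{e}_k\,\partial_kQ$; for scalar $f$, $Df=\nabla f$ viewed as a purely vectorial quaternion. $\operatorname{rot}$ is the curl and $\Delta=\sum_{k=1}^3\partial_k^2$. For a complex vector field $\mathbf{\Psi}=\sum_{k=1}^3\Psi_k\mathbf{e}_k$ with $\operatorname{rot}\mathbf{\Psi}\equiv0$, $\mathcal{A}[\mathbf{\Psi}]$ denotes its scalar potential, i.e. a complex-valued function $\varphi$ with $\nabla\varphi=\mathbf{\Psi}$, reconstructed up to an arbitrary complex constant $c$ by $$\mathcal{A}[\mathbf{\Psi}](x,y,z)=\int_{x_0}^{x}\Psi_1(\xi,y_0,z_0)\,d\xi+\int_{y_0}^{y}\Psi_2(x,\eta,z_0)\,d\eta+\int_{z_0}^{z}\Psi_3(x,y,\zeta)\,d\zeta+c,$$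 where $(x_0,y_0,z_0)$ is an arbitrary point in the domain of interest. For a vector function $\mathbf{Q}$ on $\Omega$, $\mathbf{B}[\mathbf{Q}](\mathbf{x})=\frac1{4\pi}\int_\Omega\frac{\mathbf{Q}(\mathbf{y})}{|\mathbf{x}-\mathbf{y}|}\,d\mathbf{y}$.
   Formalization: Part (1) also assumes that the integral B[f²∇(W₀/f)] converges absolutely and that this field, extended by zero, is weakly divergence free; in (2) a potential is shown to exist only for simply connected Ω, and the three-leg formula for A is given only where its legs stay in Ω. *)

theory Defs
  imports "HOL-Analysis.Analysis"
begin

section \<open>Complex quaternions\<close>

text \<open>An element is a scalar part in \<open>\<complex>\<close> together with a vector part in \<open>\<complex>\<^sup>3\<close>. The dot and
  cross products below are complex bilinear; no complex conjugation occurs anywhere.\<close>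

datatype cquat = CQuat (Sc: complex) (Vc: "complex^3")

definition cdot :: "complex^3 \<Rightarrow> complex^3 \<Rightarrow> complex" where
  "cdot u v = (\<Sum>k\<in>UNIV. u $ k * v $ k)"

definition ccross :: "complex^3 \<Rightarrow> complex^3 \<Rightarrow> complex^3" where
  "ccross u v = vector [u $ 2 * v $ 3 - u $ 3 * v $ 2,
                        u $ 3 * v $ 1 - u $ 1 * v $ 3,
                        u $ 1 * v $ 2 - u $ 2 * v $ 1]"

lemma cquat_eq_iff: "P = Q \<longleftrightarrow> Sc P = Sc Q \<and> Vc P = Vc Q"
  by (cases P; cases Q) simp

instantiation cquat :: ring_1
begin

definition "0 = CQuat 0 0"
definition "1 = CQuat 1 0"
definition "P + Q = CQuat (Sc P + Sc Q) (Vc P + Vc Q)"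
definition "P - Q = CQuat (Sc P - Sc Q) (Vc P - Vc Q)"
definition "- Q = CQuat (- Sc Q) (- Vc Q)"
definition "P * Q = CQuat (Sc P * Sc Q - cdot (Vc P) (Vc Q))
                          (Sc P *s Vc Q + Sc Q *s Vc P + ccross (Vc P) (Vc Q))"

instance
  by standard
    (simp_all add: zero_cquat_def one_cquat_def plus_cquat_def minus_cquat_def uminus_cquat_def
      times_cquat_def cdot_def ccross_def sum_3 cquat_eq_iff vec_eq_iff forall_3 algebra_simps)

end

definition cconj :: "cquat \<Rightarrow> cquat" where
  "cconj Q = CQuat (Sc Q) (- Vc Q)"

definition e_unit :: "3 \<Rightarrow> cquat" where
  "e_unit k = CQuat 0 (axis k 1)"

lemma e_unit_mult:
  "e_unit k * e_unit k = - 1"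
  "e_unit 1 * e_unit 2 = e_unit 3" "e_unit 2 * e_unit 1 = - e_unit 3"
  "e_unit 2 * e_unit 3 = e_unit 1" "e_unit 3 * e_unit 2 = - e_unit 1"
  "e_unit 3 * e_unit 1 = e_unit 2" "e_unit 1 * e_unit 3 = - e_unit 2"
  using exhaust_3[of k]
  by (auto simp: e_unit_def one_cquat_def uminus_cquat_def times_cquat_def cdot_def ccross_def
      sum_3 vec_eq_iff forall_3 axis_def)

lemma scalar_central: "CQuat c 0 * Q = Q * CQuat c 0"
  by (simp add: times_cquat_def cdot_def ccross_def sum_3 vec_eq_iff forall_3)

lemma cquat_expansion:
  "Q = CQuat (Sc Q) 0 + (\<Sum>k\<in>UNIV. CQuat (Vc Q $ k) 0 * e_unit k)"
  by (cases Q) (simp add: plus_cquat_def times_cquat_def cdot_def ccross_def e_unit_def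
      sum_3 vec_eq_iff forall_3 axis_def)


section \<open>Differential operators on \<open>\<real>\<^sup>3\<close>\<close>

definition pdiff :: "3 \<Rightarrow> (real^3 \<Rightarrow> 'a::real_normed_vector) \<Rightarrow> real^3 \<Rightarrow> 'a" where
  "pdiff k u x = vector_derivative (\<lambda>t. u (x + t *\<^sub>R axis k 1)) (at 0)"

definition C1_on :: "(real^3) set \<Rightarrow> (real^3 \<Rightarrow> 'a::real_normed_vector) \<Rightarrow> bool" where
  "C1_on S u \<longleftrightarrow> (\<forall>x\<in>S. u differentiable (at x)) \<and> (\<forall>k. continuous_on S (pdiff k u))"

definition C2_on :: "(real^3) set \<Rightarrow> (real^3 \<Rightarrow> 'a::real_normed_vector) \<Rightarrow> bool" where
  "C2_on S u \<longleftrightarrow> C1_on S u \<and> (\<forall>k. C1_on S (pdiff k u))"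

definition grad :: "(real^3 \<Rightarrow> complex) \<Rightarrow> real^3 \<Rightarrow> complex^3" where
  "grad u x = (\<chi> k. pdiff k u x)"

definition divg :: "(real^3 \<Rightarrow> complex^3) \<Rightarrow> real^3 \<Rightarrow> complex" where
  "divg V x = (\<Sum>k\<in>UNIV. pdiff k (\<lambda>y. V y $ k) x)"

definition rot :: "(real^3 \<Rightarrow> complex^3) \<Rightarrow> real^3 \<Rightarrow> complex^3" where
  "rot V x = vector [pdiff 2 (\<lambda>y. V y $ 3) x - pdiff 3 (\<lambda>y. V y $ 2) x,
                     pdiff 3 (\<lambda>y. V y $ 1) x - pdiff 1 (\<lambda>y. V y $ 3) x,
                     pdiff 1 (\<lambda>y. V y $ 2) x - pdiff 2 (\<lambda>y. V y $ 1) x]"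

definition laplacian :: "(real^3 \<Rightarrow> complex) \<Rightarrow> real^3 \<Rightarrow> complex" where
  "laplacian u x = (\<Sum>k\<in>UNIV. pdiff k (pdiff k u) x)"

definition dirac :: "(real^3 \<Rightarrow> cquat) \<Rightarrow> real^3 \<Rightarrow> cquat" where
  "dirac Q x = (\<Sum>k\<in>UNIV. e_unit k * CQuat (pdiff k (\<lambda>y. Sc (Q y)) x) (pdiff k (\<lambda>y. Vc (Q y)) x))"

lemma dirac_scalar: "dirac (\<lambda>y. CQuat (u y) 0) x = CQuat 0 (grad u x)"
proof -
  have "pdiff k (\<lambda>y. 0 :: complex^3) x = 0" for k
    by (simp add: pdiff_def vector_derivative_const_at)
  then show ?thesis
    by (simp add: dirac_def grad_def plus_cquat_def times_cquat_def cdot_def ccross_def e_unit_def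
      sum_3 vec_eq_iff forall_3 axis_def)
qed


section \<open>The equations\<close>

text \<open>All solutions are classical: every derivative that occurs in an equation exists and is
  continuous.\<close>

definition harmonic_on :: "(real^3) set \<Rightarrow> (real^3 \<Rightarrow> complex) \<Rightarrow> bool" where
  "harmonic_on \<Omega> h \<longleftrightarrow> C2_on \<Omega> h \<and> (\<forall>x\<in>\<Omega>. laplacian h x = 0)"

definition schroedinger_sol :: "(real^3) set \<Rightarrow> (real^3 \<Rightarrow> complex) \<Rightarrow> (real^3 \<Rightarrow> complex) \<Rightarrow> bool" where
  "schroedinger_sol \<Omega> q u \<longleftrightarrow> C2_on \<Omega> u \<and> (\<forall>x\<in>\<Omega>. - laplacian u x + q x * u x = 0)"

text \<open>\<open>rot (f\<^sup>-\<^sup>2 rot \<Phi>) = 0\<close> and \<open>div \<Phi> = 0\<close>; second derivatives of \<open>\<Phi>\<close> are only needed in the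
  combination \<open>f\<^sup>-\<^sup>2 rot \<Phi>\<close>.\<close>

definition double_rot_sol ::
    "(real^3) set \<Rightarrow> (real^3 \<Rightarrow> complex) \<Rightarrow> (real^3 \<Rightarrow> complex^3) \<Rightarrow> bool" where
  "double_rot_sol \<Omega> f \<Phi> \<longleftrightarrow>
     C1_on \<Omega> \<Phi> \<and> C1_on \<Omega> (\<lambda>y. (1 / (f y)\<^sup>2) *s rot \<Phi> y) \<and>
     (\<forall>x\<in>\<Omega>. rot (\<lambda>y. (1 / (f y)\<^sup>2) *s rot \<Phi> y) x = 0) \<and>
     (\<forall>x\<in>\<Omega>. divg \<Phi> x = 0)"

text \<open>\<open>D W - (D f / f) \<cdot> cconj W = 0\<close> for \<open>W = W0 + Wv\<close> with scalar part \<open>W0\<close> and vector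
  part \<open>Wv\<close>.\<close>

definition vekua_sol ::
    "(real^3) set \<Rightarrow> (real^3 \<Rightarrow> complex) \<Rightarrow> (real^3 \<Rightarrow> complex) \<Rightarrow> (real^3 \<Rightarrow> complex^3) \<Rightarrow> bool" where
  "vekua_sol \<Omega> f W0 Wv \<longleftrightarrow>
     C1_on \<Omega> W0 \<and> C1_on \<Omega> Wv \<and>
     (\<forall>x\<in>\<Omega>. dirac (\<lambda>y. CQuat (W0 y) (Wv y)) x
        - (CQuat (1 / f x) 0 * dirac (\<lambda>y. CQuat (f y) 0) x) * cconj (CQuat (W0 x) (Wv x)) = 0)"


section \<open>The volume potential \<open>B\<close>\<close>

definition vol_pot :: "(real^3) set \<Rightarrow> (real^3 \<Rightarrow> complex^3) \<Rightarrow> real^3 \<Rightarrow> complex^3" where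
  "vol_pot \<Omega> Q x = (1 / (4 * pi)) *\<^sub>R (LINT y:\<Omega>|lborel. (1 / norm (x - y)) *\<^sub>R Q y)"

definition vol_pot_converges :: "(real^3) set \<Rightarrow> (real^3 \<Rightarrow> complex^3) \<Rightarrow> bool" where
  "vol_pot_converges \<Omega> Q \<longleftrightarrow>
     (\<forall>x\<in>\<Omega>. set_integrable lborel \<Omega> (\<lambda>y. (1 / norm (x - y)) *\<^sub>R Q y))"

text \<open>The extension of \<open>Q\<close> by zero to all of \<open>\<real>\<^sup>3\<close> is weakly divergence free. For a bounded domain
  with smooth boundary and \<open>Q\<close> continuously differentiable up to the boundary this says \<open>div Q = 0\<close>
  in \<open>\<Omega>\<close> and \<open>Q \<cdot> n = 0\<close> on the boundary.
  On \<open>\<Omega>\<close>, \<open>rot (rot (vol_pot \<Omega> Q)) = Q + grad (divg (vol_pot \<Omega> Q))\<close>, and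
  \<open>divg (vol_pot \<Omega> Q)\<close> is the potential of the charge \<open>div Q\<close> of the extended field, which
  includes a single layer with density \<open>- Q \<cdot> n\<close>; vanishing of \<open>div Q\<close> in \<open>\<Omega>\<close> alone therefore does not
  make \<open>rot (vol_pot \<Omega> Q)\<close> a solution of \<open>rot Y = Q\<close>.\<close>

definition zero_ext_div_free :: "(real^3) set \<Rightarrow> (real^3 \<Rightarrow> complex^3) \<Rightarrow> bool" where
  "zero_ext_div_free \<Omega> Q \<longleftrightarrow>
     (\<forall>\<phi> :: real^3 \<Rightarrow> real. C1_on UNIV \<phi> \<and> (\<exists>R. \<forall>y. norm y > R \<longrightarrow> \<phi> y = 0) \<longrightarrow>
        (LINT y:\<Omega>|lborel. (\<Sum>k\<in>UNIV. pdiff k \<phi> y *\<^sub>R (Q y $ k))) = 0)"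


section \<open>The scalar potential \<open>A\<close>\<close>

definition scalar_potential ::
    "(real^3) set \<Rightarrow> (real^3 \<Rightarrow> complex^3) \<Rightarrow> (real^3 \<Rightarrow> complex) \<Rightarrow> bool" where
  "scalar_potential \<Omega> \<Psi> \<phi> \<longleftrightarrow> (\<forall>x\<in>\<Omega>. \<phi> differentiable (at x) \<and> grad \<phi> x = \<Psi> x)"

definition staircase_pot ::
    "real^3 \<Rightarrow> complex \<Rightarrow> (real^3 \<Rightarrow> complex^3) \<Rightarrow> real^3 \<Rightarrow> complex" where
  "staircase_pot p c \<Psi> x =
     interval_lebesgue_integral lborel (ereal (p $ 1)) (ereal (x $ 1))
       (\<lambda>\<xi>. \<Psi> (vector [\<xi>, p $ 2, p $ 3]) $ 1)
   + interval_lebesgue_integral lborel (ereal (p $ 2)) (ereal (x $ 2))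
       (\<lambda>\<eta>. \<Psi> (vector [x $ 1, \<eta>, p $ 3]) $ 2)
   + interval_lebesgue_integral lborel (ereal (p $ 3)) (ereal (x $ 3))
       (\<lambda>\<zeta>. \<Psi> (vector [x $ 1, x $ 2, \<zeta>]) $ 3)
   + c"

text \<open>The domains on which \<open>staircase_pot p\<close> evaluates its argument only inside \<open>\<Omega>\<close>, e.g. boxes,
  or balls centred at \<open>p\<close>.\<close>

definition staircase_domain :: "(real^3) set \<Rightarrow> real^3 \<Rightarrow> bool" where
  "staircase_domain \<Omega> p \<longleftrightarrow> p \<in> \<Omega> \<and>
     (\<forall>x\<in>\<Omega>. closed_segment p (vector [x $ 1, p $ 2, p $ 3]) \<subseteq> \<Omega> \<and>
            closed_segment (vector [x $ 1, p $ 2, p $ 3]) (vector [x $ 1, x $ 2, p $ 3]) \<subseteq> \<Omega> \<and>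
            closed_segment (vector [x $ 1, x $ 2, p $ 3]) x \<subseteq> \<Omega>)"

end

theory Submission
  imports Defs
begin

text \<open>
  Written out in components, the Vekua equation for \<open>W\<^sub>0 + W\<close> says \<open>div (f W) = 0\<close> and
  \<open>rot (f W) = - f\<^sup>2 grad (W\<^sub>0 / f)\<close>, so both parts are statements about this first order system.

  For the first part one needs \<open>rot (rot B) = V\<close> for the volume potential \<open>B\<close> of a continuously
  differentiable \<open>V\<close>. The kernel \<open>1 / |z|\<close> is replaced inside the ball of radius \<open>1 / a\<close> by a
  polynomial, which makes it twice continuously differentiable. Along \<open>a = 2\<^sup>m\<close> consecutive potentials differ
  by a convolution with a kernel of support radius \<open>2\<^sup>-\<^sup>m\<close>, so their first and second derivatives converge
  geometrically and \<open>B\<close> is twice continuously differentiable. The Laplacians of the kernels are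
  approximate identities, and the weak divergence condition, tested with differences of two kernels,
  makes the regularized potentials divergence free; hence \<open>rot (rot B) = grad (div B) - \<Delta>B = V\<close>.

  Two solutions differ by a curl free field. Potentials of curl free fields are built on convex sets by
  integration along rays, and on simply connected sets by sums of integrals over short chords of a path,
  which are invariant under homotopy. A staircase path is covered by three convex tubes.
\<close>

section \<open>Partial derivatives\<close>

text \<open>The Schroedinger equation is the compatibility condition of the first order system:
  \<open>f\<^sup>2 grad (W0 / f) = f grad W0 - W0 grad f\<close> has divergence
  \<open>f \<Delta>W0 - W0 \<Delta>f\<close>, and a curl is divergence free. The obstacle is that
  \<Omega> is an arbitrary domain, possibly unbounded, and \<open>V\<close> is C1 inside it with no
  control at the boundary, while the second derivatives of 1/|z| are of order 1/|z|^3 and not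
  locally integrable. Hence every integration by parts uses a compactly supported function: those
  with support inside \<Omega> give the interior regularity, and those reaching across the boundary
  are covered by \<open>zero_ext_div_free\<close>. Degree two is the lowest degree of contact that
  makes the modified kernel C2. Its Laplacian is then a multiple of a truncated paraboloid, whose
  mass is computable in closed form and equals -4 pi at every scale. Solutions \<Phi> are only C1,
  so div rot = 0 is proved weakly; the same test functions give the symmetry of second
  derivatives.\<close>

definition has_partials :: "(real^3 \<Rightarrow> 'a::real_normed_vector) \<Rightarrow> (3 \<Rightarrow> 'a) \<Rightarrow> real^3 \<Rightarrow> bool" where
  "has_partials u D x \<longleftrightarrow> (u has_derivative (\<lambda>h. \<Sum>k\<in>UNIV. h $ k *\<^sub>R D k)) (at x)"

lemma has_partials_differentiable: "has_partials u D x \<Longrightarrow> u differentiable (at x)"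
  unfolding has_partials_def differentiable_def by blast

lemma pdiff_has_derivative:
  assumes "(u has_derivative u') (at x)"
  shows "pdiff k u x = u' (axis k 1)"
proof -
  have "((\<lambda>t. x + t *\<^sub>R axis k 1) has_derivative (\<lambda>t. t *\<^sub>R axis k 1)) (at (0::real))"
    by (auto intro!: derivative_eq_intros)
  then have "((\<lambda>t. u (x + t *\<^sub>R axis k 1)) has_derivative (\<lambda>t. u' (t *\<^sub>R axis k 1))) (at 0)"
    using has_derivative_compose[of "\<lambda>t. x + t *\<^sub>R axis k 1" "\<lambda>t. t *\<^sub>R axis k 1" 0 UNIV u u'] assms
    by simp
  moreover have "u' (t *\<^sub>R axis k 1) = t *\<^sub>R u' (axis k 1)" for t
    using assms has_derivative_bounded_linear linear_simps(5) by blast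
  ultimately show ?thesis
    unfolding pdiff_def
    by (intro vector_derivative_at) (simp add: has_vector_derivative_def)
qed

text \<open>\<open>pdiff\<close> rests on \<open>vector_derivative\<close>, whose value is arbitrary
  where no derivative exists. The rules of calculus are therefore proved for
  \<open>has_partials\<close>, which asserts a Frechet derivative, and are transferred to
  \<open>pdiff\<close> through this lemma.\<close>

lemma has_partials_pdiff:
  assumes "has_partials u D x"
  shows "pdiff k u x = D k"
proof -
  have "pdiff k u x = (\<Sum>j\<in>UNIV. (axis k 1 :: real^3) $ j *\<^sub>R D j)"
    using assms pdiff_has_derivative unfolding has_partials_def by blast
  also have "\<dots> = (\<Sum>j\<in>UNIV. if j = k then D j else 0)"
    by (intro sum.cong) (auto simp: axis_def)
  finally show ?thesis by simp
qed

lemma vec3_axis_expansion: "h = (\<Sum>k\<in>UNIV. h $ k *\<^sub>R axis k (1::real))" for h :: "real^3"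
  by (simp add: vec_eq_iff sum_3 forall_3 axis_def)

lemma differentiable_has_partials:
  assumes "u differentiable (at x)"
  shows "has_partials u (\<lambda>k. pdiff k u x) x"
proof -
  obtain u' where u': "(u has_derivative u') (at x)"
    using assms differentiable_def by blast
  interpret bounded_linear u' using u' has_derivative_bounded_linear by blast
  have "u' h = (\<Sum>k\<in>UNIV. h $ k *\<^sub>R pdiff k u x)" for h
    by (subst vec3_axis_expansion[of h]) (simp add: sum scaleR pdiff_has_derivative[OF u'])
  then have "u' = (\<lambda>h. \<Sum>k\<in>UNIV. h $ k *\<^sub>R pdiff k u x)" by auto
  then show ?thesis using u' by (simp add: has_partials_def)
qed

lemma has_partials_bounded_linear:
  assumes "bounded_linear L" "has_partials u D x"
  shows "has_partials (\<lambda>y. L (u y)) (\<lambda>k. L (D k)) x"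
proof -
  interpret bounded_linear L by fact
  show ?thesis
    using bounded_linear.has_derivative[OF assms(1) assms(2)[unfolded has_partials_def]]
    by (simp add: has_partials_def sum scaleR)
qed

lemma has_partials_add:
  "has_partials u D x \<Longrightarrow> has_partials v E x \<Longrightarrow> has_partials (\<lambda>y. u y + v y) (\<lambda>k. D k + E k) x"
  unfolding has_partials_def
  by (drule (1) has_derivative_add) (simp add: scaleR_add_right sum.distrib)

lemma has_partials_minus:
  "has_partials u D x \<Longrightarrow> has_partials (\<lambda>y. - u y) (\<lambda>k. - D k) x"
  by (rule has_partials_bounded_linear[OF bounded_linear_minus[OF bounded_linear_ident]])

lemma has_partials_diff:
  "has_partials u D x \<Longrightarrow> has_partials v E x \<Longrightarrow> has_partials (\<lambda>y. u y - v y) (\<lambda>k. D k - E k) x"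
  using has_partials_add[of u D x "\<lambda>y. - v y" "\<lambda>k. - E k"] has_partials_minus[of v E x] by simp

lemma has_partials_bilinear:
  assumes "bounded_bilinear p" "has_partials u D x" "has_partials v E x"
  shows "has_partials (\<lambda>y. p (u y) (v y)) (\<lambda>k. p (u x) (E k) + p (D k) (v x)) x"
proof -
  interpret bounded_bilinear p by fact
  show ?thesis
    using FDERIV[OF assms(2,3)[unfolded has_partials_def]]
    by (simp add: has_partials_def sum_left sum_right scaleR_left scaleR_right
        scaleR_add_right sum.distrib)
qed

lemma has_partials_mult:
  fixes u v :: "real^3 \<Rightarrow> 'a::real_normed_algebra"
  assumes "has_partials u D x" "has_partials v E x"
  shows "has_partials (\<lambda>y. u y * v y) (\<lambda>k. u x * E k + D k * v x) x"
  using has_partials_bilinear[OF bounded_bilinear_mult assms] .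

lemma has_partials_scaleR:
  assumes "has_partials u D x" "has_partials v E x"
  shows "has_partials (\<lambda>y. u y *\<^sub>R v y) (\<lambda>k. u x *\<^sub>R E k + D k *\<^sub>R v x) x"
  using has_partials_bilinear[OF bounded_bilinear_scaleR assms] .

lemma has_partials_chain:
  fixes g :: "'a::real_normed_field \<Rightarrow> 'a"
  assumes "(g has_field_derivative g') (at (u x))" "has_partials u D x"
  shows "has_partials (\<lambda>y. g (u y)) (\<lambda>k. g' * D k) x"
proof -
  have "((\<lambda>y. g (u y)) has_derivative (\<lambda>h. g' * (\<Sum>k\<in>UNIV. h $ k *\<^sub>R D k))) (at x)"
    using has_derivative_compose[OF assms(2)[unfolded has_partials_def]
        assms(1)[unfolded has_field_derivative_def]] .
  then show ?thesis by (simp add: has_partials_def sum_distrib_left)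
qed

lemma has_partials_inverse:
  fixes u :: "real^3 \<Rightarrow> 'a::real_normed_field"
  assumes "has_partials u D x" "u x \<noteq> 0"
  shows "has_partials (\<lambda>y. 1 / u y) (\<lambda>k. - D k / (u x)\<^sup>2) x"
proof -
  have "((\<lambda>z. 1 / z) has_field_derivative - 1 / (u x)\<^sup>2) (at (u x))"
    using assms(2) by (auto intro!: derivative_eq_intros simp: power2_eq_square)
  from has_partials_chain[OF this assms(1)] show ?thesis by simp
qed

lemma has_partials_vec:
  fixes u :: "real^3 \<Rightarrow> 'a::euclidean_space^3"
  assumes "\<And>i. has_partials (\<lambda>y. u y $ i) (\<lambda>k. D k $ i) x"
  shows "has_partials u D x"
proof -
  have "((\<lambda>y. \<chi> i. u y $ i) has_derivative (\<lambda>h. \<chi> i. \<Sum>k\<in>UNIV. h $ k *\<^sub>R D k $ i)) (at x)"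
  proof (subst has_derivative_componentwise_within, intro ballI)
    fix b :: "'a^3" assume "b \<in> Basis"
    then obtain i c where b: "b = axis i c" "c \<in> Basis" by (auto simp: Basis_vec_def)
    show "((\<lambda>y. (\<chi> i. u y $ i) \<bullet> b) has_derivative
        (\<lambda>h. (\<chi> i. \<Sum>k\<in>UNIV. h $ k *\<^sub>R D k $ i) \<bullet> b)) (at x)"
      using has_derivative_inner_left[OF assms[of i, unfolded has_partials_def], of c]
      by (simp add: b inner_axis)
  qed
  moreover have "(\<lambda>h. \<chi> i. \<Sum>k\<in>UNIV. h $ k *\<^sub>R D k $ i) = (\<lambda>h. \<Sum>k\<in>UNIV. h $ k *\<^sub>R D k)"
    by (auto simp: vec_eq_iff)
  ultimately show ?thesis by (simp add: has_partials_def)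
qed

lemma has_partials_nth:
  "has_partials u D x \<Longrightarrow> has_partials (\<lambda>y. u y $ i) (\<lambda>k. D k $ i) x"
  by (rule has_partials_bounded_linear[OF bounded_linear_vec_nth])

lemma has_partials_cong:
  assumes "has_partials u D x" "open S" "x \<in> S" "\<And>y. y \<in> S \<Longrightarrow> u y = v y"
  shows "has_partials v D x"
  using has_derivative_transform_within_open[OF assms(1)[unfolded has_partials_def] assms(2-4)]
  by (simp add: has_partials_def)

lemma pdiff_cong:
  assumes "open S" "x \<in> S" "\<And>y. y \<in> S \<Longrightarrow> u y = v y"
  shows "pdiff k u x = pdiff k v x"
proof -
  have "((\<lambda>t. x + t *\<^sub>R axis k 1) \<longlongrightarrow> x + 0 *\<^sub>R axis k 1) (at (0::real))"
    by (intro tendsto_intros)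
  then have "\<forall>\<^sub>F t in at (0::real). x + t *\<^sub>R axis k 1 \<in> S"
    using assms(1,2) by (auto intro: topological_tendstoD)
  then have "\<forall>\<^sub>F t in nhds (0::real). x + t *\<^sub>R axis k 1 \<in> S"
    using assms(2) by (simp add: eventually_nhds_conv_at)
  then have "\<forall>\<^sub>F t in nhds (0::real). u (x + t *\<^sub>R axis k 1) = v (x + t *\<^sub>R axis k 1)"
    by (rule eventually_mono) (use assms(3) in blast)
  then show ?thesis
    unfolding pdiff_def by (intro vector_derivative_cong_eq) auto
qed

section \<open>Closure properties of C1 and C2 functions\<close>

lemma C1_onI:
  assumes "\<And>x. x \<in> S \<Longrightarrow> has_partials u (\<lambda>k. D k x) x" "\<And>k. continuous_on S (D k)"
  shows "C1_on S u"
  unfolding C1_on_def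
proof (intro conjI ballI allI)
  show "u differentiable at x" if "x \<in> S" for x
    using assms(1)[OF that] by (rule has_partials_differentiable)
  show "continuous_on S (pdiff k u)" for k
    using assms(2)[of k] by (rule continuous_on_eq) (metis assms(1) has_partials_pdiff)
qed

lemma C1_on_has_partials: "C1_on S u \<Longrightarrow> x \<in> S \<Longrightarrow> has_partials u (\<lambda>k. pdiff k u x) x"
  unfolding C1_on_def using differentiable_has_partials by blast

lemma C1_on_continuous_pdiff: "C1_on S u \<Longrightarrow> continuous_on S (pdiff k u)"
  unfolding C1_on_def by blast

lemma C1_on_continuous_on: "C1_on S u \<Longrightarrow> continuous_on S u"
  unfolding C1_on_def
  by (meson continuous_at_imp_continuous_on differentiable_imp_continuous_within)

lemma C1_on_subset: "C1_on S u \<Longrightarrow> T \<subseteq> S \<Longrightarrow> C1_on T u"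
  unfolding C1_on_def by (meson continuous_on_subset subsetD)

lemma C1_on_cong:
  assumes "C1_on S u" "open S" "\<And>y. y \<in> S \<Longrightarrow> u y = v y"
  shows "C1_on S v"
  by (rule C1_onI[where D = "\<lambda>k. pdiff k u"])
    (use assms in \<open>auto intro: has_partials_cong C1_on_has_partials C1_on_continuous_pdiff\<close>)

lemma C2_on_cong:
  assumes "C2_on S u" "open S" "\<And>y. y \<in> S \<Longrightarrow> u y = v y"
  shows "C2_on S v"
  unfolding C2_on_def
proof (intro conjI allI)
  show "C1_on S v" using assms C1_on_cong unfolding C2_on_def by blast
  have "C1_on S (pdiff k u)" for k using assms(1) unfolding C2_on_def by blast
  then show "C1_on S (pdiff k v)" for k
    by (rule C1_on_cong[OF _ assms(2)]) (rule pdiff_cong[OF assms(2) _ assms(3)])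
qed

lemma C2_onI:
  assumes "open S" "\<And>x. x \<in> S \<Longrightarrow> has_partials u (\<lambda>k. D k x) x" "\<And>k. C1_on S (D k)"
  shows "C2_on S u"
  unfolding C2_on_def
proof (intro conjI allI)
  show "C1_on S u" using assms(2) C1_on_continuous_on[OF assms(3)] by (rule C1_onI)
  show "C1_on S (pdiff k u)" for k
    by (rule C1_on_cong[OF assms(3)[of k] assms(1)]) (metis assms(2) has_partials_pdiff)
qed

lemma C1_on_bounded_linear:
  assumes "bounded_linear L" "C1_on S u"
  shows "C1_on S (\<lambda>y. L (u y))"
  by (rule C1_onI[where D = "\<lambda>k x. L (pdiff k u x)"])
    (use assms in \<open>auto intro: has_partials_bounded_linear C1_on_has_partials
       bounded_linear.continuous_on C1_on_continuous_pdiff\<close>)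

lemma C1_on_add: "C1_on S u \<Longrightarrow> C1_on S v \<Longrightarrow> C1_on S (\<lambda>y. u y + v y)"
  by (rule C1_onI[where D = "\<lambda>k x. pdiff k u x + pdiff k v x"])
    (auto intro: has_partials_add C1_on_has_partials continuous_on_add C1_on_continuous_pdiff)

lemma C1_on_minus: "C1_on S u \<Longrightarrow> C1_on S (\<lambda>y. - u y)"
  by (rule C1_on_bounded_linear[OF bounded_linear_minus[OF bounded_linear_ident]])

lemma C1_on_diff: "C1_on S u \<Longrightarrow> C1_on S v \<Longrightarrow> C1_on S (\<lambda>y. u y - v y)"
  using C1_on_add[of S u "\<lambda>y. - v y"] C1_on_minus[of S v] by simp

lemma C1_on_mult:
  fixes u v :: "real^3 \<Rightarrow> 'a::real_normed_algebra"
  shows "C1_on S u \<Longrightarrow> C1_on S v \<Longrightarrow> C1_on S (\<lambda>y. u y * v y)"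
  by (rule C1_onI[where D = "\<lambda>k x. u x * pdiff k v x + pdiff k u x * v x"])
    (auto simp: C1_on_continuous_pdiff C1_on_continuous_on
      intro!: has_partials_mult C1_on_has_partials continuous_on_add continuous_on_mult)

lemma C1_on_inverse:
  fixes u :: "real^3 \<Rightarrow> 'a::real_normed_field"
  shows "C1_on S u \<Longrightarrow> (\<And>x. x \<in> S \<Longrightarrow> u x \<noteq> 0) \<Longrightarrow> C1_on S (\<lambda>y. 1 / u y)"
  by (rule C1_onI[where D = "\<lambda>k x. - pdiff k u x / (u x)\<^sup>2"])
    (rule has_partials_inverse[OF C1_on_has_partials],
      auto simp: C1_on_continuous_pdiff C1_on_continuous_on intro!: continuous_on_minus
        continuous_on_divide continuous_on_power)

lemma C1_on_vec:
  fixes u :: "real^3 \<Rightarrow> 'a::euclidean_space^3"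
  assumes "\<And>i. C1_on S (\<lambda>y. u y $ i)"
  shows "C1_on S u"
proof (rule C1_onI[where D = "\<lambda>k x. \<chi> i. pdiff k (\<lambda>y. u y $ i) x"])
  show "has_partials u (\<lambda>k. \<chi> i. pdiff k (\<lambda>y. u y $ i) x) x" if "x \<in> S" for x
    by (rule has_partials_vec) (simp add: C1_on_has_partials[OF assms that])
  show "continuous_on S (\<lambda>x. \<chi> i. pdiff k (\<lambda>y. u y $ i) x)" for k
    by (intro continuous_on_vec_lambda C1_on_continuous_pdiff assms)
qed

lemma C1_on_nth: "C1_on S u \<Longrightarrow> C1_on S (\<lambda>y. u y $ i)"
  by (rule C1_on_bounded_linear[OF bounded_linear_vec_nth])

lemma pdiff_nth: "u differentiable (at x) \<Longrightarrow> pdiff k (\<lambda>y. u y $ i) x = pdiff k u x $ i"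
  using has_partials_pdiff has_partials_nth differentiable_has_partials by metis

lemma pdiff_add:
  "u differentiable (at x) \<Longrightarrow> v differentiable (at x) \<Longrightarrow>
    pdiff k (\<lambda>y. u y + v y) x = pdiff k u x + pdiff k v x"
  by (drule differentiable_has_partials)+ (drule (1) has_partials_add, erule has_partials_pdiff)

lemma pdiff_diff:
  "u differentiable (at x) \<Longrightarrow> v differentiable (at x) \<Longrightarrow>
    pdiff k (\<lambda>y. u y - v y) x = pdiff k u x - pdiff k v x"
  by (drule differentiable_has_partials)+ (drule (1) has_partials_diff, erule has_partials_pdiff)

lemma pdiff_minus:
  "u differentiable (at x) \<Longrightarrow> pdiff k (\<lambda>y. - u y) x = - pdiff k u x"
  by (drule differentiable_has_partials) (drule has_partials_minus, erule has_partials_pdiff)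

lemma pdiff_mult:
  fixes u v :: "real^3 \<Rightarrow> 'a::real_normed_algebra"
  shows "u differentiable (at x) \<Longrightarrow> v differentiable (at x) \<Longrightarrow>
    pdiff k (\<lambda>y. u y * v y) x = u x * pdiff k v x + pdiff k u x * v x"
  by (drule differentiable_has_partials)+ (drule (1) has_partials_mult, erule has_partials_pdiff)

lemma rot_cong:
  assumes "open S" "x \<in> S" "\<And>y. y \<in> S \<Longrightarrow> U y = V y"
  shows "rot U x = rot V x"
proof -
  have "pdiff k (\<lambda>y. U y $ i) x = pdiff k (\<lambda>y. V y $ i) x" for k i
    by (rule pdiff_cong[OF assms(1,2)]) (simp add: assms(3))
  then show ?thesis by (simp add: rot_def)
qed

lemma divg_cong:
  assumes "open S" "x \<in> S" "\<And>y. y \<in> S \<Longrightarrow> U y = V y"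
  shows "divg U x = divg V x"
  unfolding divg_def by (intro sum.cong refl pdiff_cong[OF assms(1,2)]) (simp add: assms(3))

section \<open>Differentiation under the integral and test functions\<close>

text \<open>Dominated convergence for the difference quotients along a sequence: on the convex
  \<open>U\<close> the mean value inequality bounds them by \<open>2 * w y\<close>. The parameter
  space is arbitrary because the lemma serves translations (a real parameter) as well as
  convolutions and ray integrals (a point of space).\<close>

lemma has_derivative_integral:
  fixes f :: "'x::real_normed_vector \<Rightarrow> 'y \<Rightarrow> 'b::{banach,second_countable_topology}"
  assumes U: "open U" "convex U" "x0 \<in> U"
    and int: "\<And>x. x \<in> U \<Longrightarrow> integrable M (f x)"
    and der: "\<And>x y. x \<in> U \<Longrightarrow> y \<in> space M \<Longrightarrow> ((\<lambda>x. f x y) has_derivative f' x y) (at x)"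
    and bound: "\<And>x y h. x \<in> U \<Longrightarrow> y \<in> space M \<Longrightarrow> norm (f' x y h) \<le> w y * norm h"
    and w: "integrable M w"
    and meas: "\<And>h. (\<lambda>y. f' x0 y h) \<in> borel_measurable M"
  shows "((\<lambda>x. \<integral>y. f x y \<partial>M) has_derivative (\<lambda>h. \<integral>y. f' x0 y h \<partial>M)) (at x0)"
proof -
  have lin: "bounded_linear (f' x0 y)" if "y \<in> space M" for y
    using der[OF U(3) that] has_derivative_bounded_linear by blast
  \<comment> \<open>The factor \<open>norm h\<close> stays because in a trivial parameter space the
    bound says nothing about the sign of \<open>w y\<close>.\<close>
  have w0: "w y * norm h \<ge> 0" if "y \<in> space M" for y and h :: 'x
    using bound[OF U(3) that, of h] norm_ge_zero order_trans by blast
  have int': "integrable M (\<lambda>y. f' x0 y h)" for h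
  proof (rule Bochner_Integration.integrable_bound[of M "\<lambda>y. w y * norm h"])
    show "integrable M (\<lambda>y. w y * norm h)" using w by auto
    show "AE y in M. norm (f' x0 y h) \<le> norm (w y * norm h)"
      by (rule AE_I2) (use bound[OF U(3)] w0 in \<open>smt (verit) real_norm_def\<close>)
  qed (rule meas)
  have bl: "bounded_linear (\<lambda>h. \<integral>y. f' x0 y h \<partial>M)"
  proof (rule bounded_linear_intro[where K = "\<integral>y. w y \<partial>M"])
    fix h k :: 'x and r :: real
    have "(\<integral>y. f' x0 y (h + k) \<partial>M) = (\<integral>y. f' x0 y h + f' x0 y k \<partial>M)"
      by (rule Bochner_Integration.integral_cong) (auto simp: linear_simps(1)[OF lin])
    then show "(\<integral>y. f' x0 y (h + k) \<partial>M) = (\<integral>y. f' x0 y h \<partial>M) + (\<integral>y. f' x0 y k \<partial>M)"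
      using int' by simp
    have "(\<integral>y. f' x0 y (r *\<^sub>R h) \<partial>M) = (\<integral>y. r *\<^sub>R f' x0 y h \<partial>M)"
      by (rule Bochner_Integration.integral_cong) (auto simp: linear_simps(5)[OF lin])
    then show "(\<integral>y. f' x0 y (r *\<^sub>R h) \<partial>M) = r *\<^sub>R (\<integral>y. f' x0 y h \<partial>M)"
      by simp
    have "norm (\<integral>y. f' x0 y h \<partial>M) \<le> (\<integral>y. norm (f' x0 y h) \<partial>M)"
      by (rule integral_norm_bound)
    also have "\<dots> \<le> (\<integral>y. w y * norm h \<partial>M)"
      by (rule integral_mono) (use w int' bound[OF U(3)] in auto)
    finally have "norm (\<integral>y. f' x0 y h \<partial>M) \<le> (\<integral>y. w y * norm h \<partial>M)" .
    then show "norm (\<integral>y. f' x0 y h \<partial>M) \<le> norm h * (\<integral>y. w y \<partial>M)"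
      by (simp add: mult.commute)
  qed
  let ?q = "\<lambda>x. norm (((\<integral>y. f x y \<partial>M) - (\<integral>y. f x0 y \<partial>M)) - (\<integral>y. f' x0 y (x - x0) \<partial>M)) / norm (x - x0)"
  have "(?q \<longlongrightarrow> 0) (at x0)"
    unfolding tendsto_at_iff_sequentially
  proof (intro allI impI)
    fix X assume X: "\<forall>i. X i \<in> UNIV - {x0}" "X \<longlonglongrightarrow> x0"
    \<comment> \<open>The value 0 for \<open>X i\<close> outside \<open>U\<close> makes every
      \<open>g i\<close> integrable and dominated; it affects only finitely many
      \<open>i\<close>.\<close>
    define g where "g i y = (if X i \<in> U then (f (X i) y - f x0 y - f' x0 y (X i - x0)) /\<^sub>R norm (X i - x0) else 0)"
      for i y
    have gi: "integrable M (g i)" for i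
      unfolding g_def using int int' U(3) by (cases "X i \<in> U") auto
    have evU: "\<forall>\<^sub>F i in sequentially. X i \<in> U"
      using X(2) U(1,3) by (rule topological_tendstoD)
    have "(\<lambda>i. integral\<^sup>L M (g i)) \<longlonglongrightarrow> integral\<^sup>L M (\<lambda>_. 0)"
    proof (rule integral_dominated_convergence[where w = "\<lambda>y. 2 * w y"])
      show "integrable M (\<lambda>y. 2 * w y)" using w by simp
      show "AE y in M. (\<lambda>i. g i y) \<longlonglongrightarrow> 0"
      proof (rule AE_I2)
        fix y assume y: "y \<in> space M"
        have "((\<lambda>x. ((f x y - f x0 y) - f' x0 y (x - x0)) /\<^sub>R norm (x - x0)) \<longlongrightarrow> 0) (at x0)"
          using der[OF U(3) y, THEN iffD1[OF has_derivative_at_within], THEN conjunct2] .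
        then have "(\<lambda>i. ((f (X i) y - f x0 y) - f' x0 y (X i - x0)) /\<^sub>R norm (X i - x0)) \<longlonglongrightarrow> 0"
          using X unfolding tendsto_at_iff_sequentially comp_def by blast
        then show "(\<lambda>i. g i y) \<longlonglongrightarrow> 0"
          by (rule Lim_transform_eventually)
            (use evU in \<open>auto simp: g_def elim: eventually_mono\<close>)
      qed
      show "AE y in M. norm (g i y) \<le> 2 * w y" for i
      proof (rule AE_I2)
        fix y assume y: "y \<in> space M"
        show "norm (g i y) \<le> 2 * w y"
        proof (cases "X i \<in> U")
          case True
          have pos: "norm (X i - x0) > 0" using X(1) by auto
          have onb: "onorm (f' x y) \<le> w y" if "x \<in> U" for x
            using w0[OF y, of "X i - x0"] pos bound[OF that y]
            by (intro onorm_bound) (auto simp: zero_le_mult_iff)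
          have "norm (f (X i) y - f x0 y) \<le> w y * norm (X i - x0)"
            by (rule differentiable_bound[OF U(2) _ onb True U(3)])
              (use der[OF _ y] has_derivative_at_withinI in blast)
          moreover have "norm (f' x0 y (X i - x0)) \<le> w y * norm (X i - x0)"
            by (rule bound[OF U(3) y])
          ultimately have "norm (f (X i) y - f x0 y - f' x0 y (X i - x0)) \<le> 2 * w y * norm (X i - x0)"
            using norm_triangle_ineq4[of "f (X i) y - f x0 y" "f' x0 y (X i - x0)"] by linarith
          moreover have "norm (g i y) = norm (f (X i) y - f x0 y - f' x0 y (X i - x0)) / norm (X i - x0)"
            using True by (simp add: g_def divide_inverse_commute)
          ultimately show ?thesis using pos by (simp add: pos_divide_le_eq)
        next
          case False
          have "w y * norm (X i - x0) \<ge> 0" by (rule w0[OF y])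
          moreover have "norm (X i - x0) > 0" using X(1) by auto
          ultimately show ?thesis using False by (simp add: g_def zero_le_mult_iff)
        qed
      qed
    qed (use gi in auto)
    then have "(\<lambda>i. norm (integral\<^sup>L M (g i))) \<longlonglongrightarrow> 0"
      by (simp add: tendsto_norm_zero)
    then have "(\<lambda>i. ?q (X i)) \<longlonglongrightarrow> 0"
    proof (rule Lim_transform_eventually)
      show "\<forall>\<^sub>F i in sequentially. norm (integral\<^sup>L M (g i)) = ?q (X i)"
        using evU
      proof eventually_elim
        case (elim i)
        have "integral\<^sup>L M (g i) = (((\<integral>y. f (X i) y \<partial>M) - (\<integral>y. f x0 y \<partial>M)) - (\<integral>y. f' x0 y (X i - x0) \<partial>M)) /\<^sub>R norm (X i - x0)"
          using elim int[OF elim] int[OF U(3)] int' by (simp add: g_def[abs_def])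
        then show ?case by (simp add: divide_inverse_commute)
      qed
    qed
    then show "(?q \<circ> X) \<longlonglongrightarrow> 0"
      by (simp add: comp_def)
  qed
  then show ?thesis
    unfolding has_derivative_iff_norm using bl by blast
qed

section \<open>Functions of compact support and integration by parts\<close>

lemma integrable_lborel_compact_support:
  fixes u :: "'a::euclidean_space \<Rightarrow> 'b::{banach,second_countable_topology}"
  assumes "continuous_on UNIV u" "\<And>y. r < norm (y - a) \<Longrightarrow> u y = 0"
  shows "integrable lborel u"
proof -
  have "integrable lborel (\<lambda>x. indicator (cball a r) x *\<^sub>R u x)"
    by (rule borel_integrable_compact) (use assms(1) continuous_on_subset in auto)
  moreover have "(\<lambda>x. indicator (cball a r) x *\<^sub>R u x) = u"
    using assms(2) by (auto simp: fun_eq_iff indicator_def dist_norm norm_minus_commute not_le)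
  ultimately show ?thesis by simp
qed

lemma has_partials_zero_outside:
  assumes "has_partials u D x" "r < norm (x - a)" "\<And>y. r < norm (y - a) \<Longrightarrow> u y = 0"
  shows "D k = 0"
proof -
  have "open {y. r < norm (y - a)}"
    by (intro open_Collect_less continuous_intros)
  then have "pdiff k u x = pdiff k (\<lambda>_. 0) x"
    by (rule pdiff_cong) (use assms in auto)
  also have "\<dots> = 0"
    using has_partials_pdiff[of "\<lambda>_. 0" "\<lambda>_. 0"] by (simp add: has_partials_def)
  finally show ?thesis using has_partials_pdiff[OF assms(1)] by metis
qed

text \<open>By translation invariance the integral of \<open>u (y + t *\<^sub>R axis k 1)\<close>
  does not depend on \<open>t\<close>. Its derivative at \<open>t = 0\<close>, taken under the
  integral, is the integral in question.\<close>

lemma integral_partial_compact_support: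
  fixes u :: "real^3 \<Rightarrow> 'b::{banach,second_countable_topology}"
  assumes D: "\<And>x. has_partials u (\<lambda>k. D k x) x"
    and cont: "continuous_on UNIV (D k)"
    and supp: "\<And>y. r < norm (y - a) \<Longrightarrow> u y = 0"
  shows "(LBINT y. D k y) = 0"
proof -
  let ?e = "axis k 1 :: real^3"
  have contu: "continuous_on UNIV u"
    by (intro continuous_at_imp_continuous_on ballI differentiable_imp_continuous_within
        has_partials_differentiable[OF D])
  have D0: "D k y = 0" if "r < norm (y - a)" for y
    by (rule has_partials_zero_outside[OF D that supp])
  have "compact (cball a r)" by simp
  then have "bounded (D k ` cball a r)"
    by (intro compact_imp_bounded compact_continuous_image continuous_on_subset[OF cont]) auto
  then obtain B where B: "\<And>y. y \<in> cball a r \<Longrightarrow> norm (D k y) \<le> B"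
    by (metis bounded_iff imageI)
  \<comment> \<open>For negative \<open>r\<close> the ball is empty and \<open>B\<close> may be
    negative, hence the maximum.\<close>
  have B': "norm (D k y) \<le> max B 0" for y
    using B[of y] D0[of y] by (cases "y \<in> cball a r") (auto simp: dist_norm norm_minus_commute)
  \<comment> \<open>Shifts with |t| < 1 move the support by less than 1, so a constant on the ball
    of radius \<open>r + 1\<close> dominates all of them.\<close>
  have "((\<lambda>t. LBINT y. u (y + t *\<^sub>R ?e)) has_derivative (\<lambda>h. LBINT y. h *\<^sub>R D k (y + 0 *\<^sub>R ?e))) (at (0::real))"
  proof (rule has_derivative_integral[where U = "ball 0 1" and w = "\<lambda>y. max B 0 * indicator (cball a (r + 1)) y"
        and f' = "\<lambda>t y h. h *\<^sub>R D k (y + t *\<^sub>R ?e)"])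
    show "integrable lborel (\<lambda>y. u (y + t *\<^sub>R ?e))" for t
    proof (rule integrable_lborel_compact_support)
      show "continuous_on UNIV (\<lambda>y. u (y + t *\<^sub>R ?e))"
        by (rule continuous_on_compose2[OF contu]) (auto intro: continuous_intros)
      show "u (y + t *\<^sub>R ?e) = 0" if "r < norm (y - (a - t *\<^sub>R ?e))" for y
        using that by (intro supp) (simp add: algebra_simps)
    qed
    show "((\<lambda>t. u (y + t *\<^sub>R ?e)) has_derivative (\<lambda>h. h *\<^sub>R D k (y + t *\<^sub>R ?e))) (at t)" for t y
    proof -
      have "((\<lambda>t. y + t *\<^sub>R ?e) has_derivative (\<lambda>t. t *\<^sub>R ?e)) (at t)"
        by (auto intro!: derivative_eq_intros)
      from has_derivative_compose[OF this D[unfolded has_partials_def]]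
      have "((\<lambda>t. u (y + t *\<^sub>R ?e)) has_derivative
          (\<lambda>h. \<Sum>j\<in>UNIV. (h *\<^sub>R ?e) $ j *\<^sub>R D j (y + t *\<^sub>R ?e))) (at t)" .
      moreover have "(\<lambda>h. \<Sum>j\<in>UNIV. (h *\<^sub>R ?e) $ j *\<^sub>R D j (y + t *\<^sub>R ?e)) = (\<lambda>h. h *\<^sub>R D k (y + t *\<^sub>R ?e))"
      proof
        fix h
        have "(\<Sum>j\<in>UNIV. (h *\<^sub>R ?e) $ j *\<^sub>R D j (y + t *\<^sub>R ?e)) = (\<Sum>j\<in>UNIV. if j = k then h *\<^sub>R D j (y + t *\<^sub>R ?e) else 0)"
          by (intro sum.cong) (auto simp: axis_def)
        then show "(\<Sum>j\<in>UNIV. (h *\<^sub>R ?e) $ j *\<^sub>R D j (y + t *\<^sub>R ?e)) = h *\<^sub>R D k (y + t *\<^sub>R ?e)"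
          by simp
      qed
      ultimately show ?thesis by simp
    qed
    show "norm (h *\<^sub>R D k (y + t *\<^sub>R ?e)) \<le> max B 0 * indicator (cball a (r + 1)) y * norm h"
      if "t \<in> ball 0 1" for t y h
    proof (cases "y \<in> cball a (r + 1)")
      case True
      then show ?thesis using mult_right_mono[OF B'[of "y + t *\<^sub>R ?e"], of "norm h"] by (simp add: mult.commute)
    next
      case False
      then have "norm (y - a) > r + 1" by (simp add: dist_norm norm_minus_commute)
      moreover have "norm (y - a) \<le> norm (y + t *\<^sub>R ?e - a) + norm (t *\<^sub>R ?e)"
        using norm_triangle_ineq4[of "y + t *\<^sub>R ?e - a" "t *\<^sub>R ?e"] by (simp add: algebra_simps)
      moreover have "norm (t *\<^sub>R ?e) < 1" using that by simp
      ultimately have "r < norm (y + t *\<^sub>R ?e - a)" by linarith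
      then show ?thesis using D0 by simp
    qed
    show "integrable lborel (\<lambda>y. max B 0 * indicator (cball a (r + 1)) y)"
      using emeasure_lborel_cball_finite[of a "r + 1"]
      by (intro integrable_mult_right integrable_real_indicator) auto
    show "(\<lambda>y. h *\<^sub>R D k (y + 0 *\<^sub>R ?e)) \<in> borel_measurable lborel" for h
      using borel_measurable_continuous_onI[OF cont] by simp
  qed auto
  moreover have "(LBINT y. u (y + t *\<^sub>R ?e)) = (LBINT y. u y)" for t :: real
  proof -
    have "(\<integral>y. u y \<partial>lborel) = (\<integral>y. u y \<partial>distr lborel borel ((+) (t *\<^sub>R ?e)))"
      by (simp add: lborel_distr_plus)
    also have "\<dots> = (LBINT y. u (t *\<^sub>R ?e + y))"
      using borel_measurable_continuous_onI[OF contu] by (intro integral_distr) auto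
    finally show ?thesis by (simp add: add.commute)
  qed
  ultimately have "((\<lambda>t::real. LBINT y. u y) has_derivative (\<lambda>h. LBINT y. h *\<^sub>R D k y)) (at 0)"
    by simp
  then have "(\<lambda>h. LBINT y. h *\<^sub>R D k y) = (\<lambda>h::real. 0)"
    using has_derivative_unique has_derivative_const by blast
  then show ?thesis by (metis (no_types, lifting) scaleR_one Bochner_Integration.integral_cong)
qed

text \<open>The partials are arguments so that functions given by formulas bring their derivatives
  along. Only C1 is demanded, which admits differences of the regularized kernels and of their first
  partials.\<close>

definition test_fun :: "(real^3 \<Rightarrow> real) \<Rightarrow> (3 \<Rightarrow> real^3 \<Rightarrow> real) \<Rightarrow> real^3 \<Rightarrow> real \<Rightarrow> bool" where
  "test_fun \<eta> \<eta>' a r \<longleftrightarrow> (\<forall>y. has_partials \<eta> (\<lambda>k. \<eta>' k y) y) \<and> (\<forall>k. continuous_on UNIV (\<eta>' k)) \<and>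
     (\<forall>y. r < norm (y - a) \<longrightarrow> \<eta> y = 0)"

lemma test_fun_zero: "test_fun \<eta> \<eta>' a r \<Longrightarrow> r < norm (y - a) \<Longrightarrow> \<eta> y = 0"
  by (simp add: test_fun_def)

lemma test_fun_partial_zero: "test_fun \<eta> \<eta>' a r \<Longrightarrow> r < norm (y - a) \<Longrightarrow> \<eta>' k y = 0"
  using has_partials_zero_outside[of \<eta> "\<lambda>k. \<eta>' k y" y r a k] by (simp add: test_fun_def)

lemma test_fun_continuous: "test_fun \<eta> \<eta>' a r \<Longrightarrow> continuous_on UNIV \<eta>"
  unfolding test_fun_def
  by (intro continuous_at_imp_continuous_on ballI differentiable_imp_continuous_within)
    (use has_partials_differentiable in blast)

text \<open>Outside \<open>S\<close> nothing is known about \<open>w\<close>, but there \<eta>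
  vanishes: \<open>S\<close> and the complement of the ball are two open sets that cover the space,
  and the product is continuous on each.\<close>

lemma continuous_on_mult_support:
  fixes w :: "real^3 \<Rightarrow> 'b::real_normed_vector"
  assumes "open S" "cball a r \<subseteq> S" "continuous_on UNIV \<eta>" "\<And>y. r < norm (y - a) \<Longrightarrow> \<eta> y = (0::real)"
    "continuous_on S w"
  shows "continuous_on UNIV (\<lambda>y. \<eta> y *\<^sub>R w y)"
proof -
  have o: "open {y. r < norm (y - a)}"
    by (intro open_Collect_less continuous_intros)
  have "continuous_on S (\<lambda>y. \<eta> y *\<^sub>R w y)"
    by (intro continuous_on_scaleR continuous_on_subset[OF assms(3)] assms(5)) auto
  moreover have "continuous_on {y. r < norm (y - a)} (\<lambda>y. \<eta> y *\<^sub>R w y)"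
    by (rule continuous_on_eq[where f = "\<lambda>_. 0"]) (auto simp: assms(4))
  ultimately have "continuous_on (S \<union> {y. r < norm (y - a)}) (\<lambda>y. \<eta> y *\<^sub>R w y)"
    using assms(1) o by (intro continuous_on_open_Un)
  moreover have "S \<union> {y. r < norm (y - a)} = UNIV"
    using assms(2) by (force simp: dist_norm norm_minus_commute[of a])
  ultimately show ?thesis by simp
qed

text \<open>The product of \<eta> and \<open>w\<close> is differentiable on the whole space with
  compact support, so the integral of each of its partials vanishes.\<close>

lemma integral_by_parts_test_fun:
  fixes w :: "real^3 \<Rightarrow> 'b::{banach,second_countable_topology}"
  assumes S: "open S" "cball a r \<subseteq> S" and \<eta>: "test_fun \<eta> \<eta>' a r" and w: "C1_on S w"
  shows "integrable lborel (\<lambda>y. \<eta> y *\<^sub>R pdiff k w y)" "integrable lborel (\<lambda>y. \<eta>' k y *\<^sub>R w y)"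
    "(LBINT y. \<eta> y *\<^sub>R pdiff k w y) = - (LBINT y. \<eta>' k y *\<^sub>R w y)"
proof -
  note z = test_fun_zero[OF \<eta>] test_fun_partial_zero[OF \<eta>]
  have c1: "continuous_on UNIV (\<lambda>y. \<eta> y *\<^sub>R pdiff k w y)" for k
    by (rule continuous_on_mult_support[OF S test_fun_continuous[OF \<eta>] z(1) C1_on_continuous_pdiff[OF w]])
  have c2: "continuous_on UNIV (\<lambda>y. \<eta>' k y *\<^sub>R w y)" for k
    by (rule continuous_on_mult_support[OF S _ z(2) C1_on_continuous_on[OF w]])
      (use \<eta> in \<open>auto simp: test_fun_def\<close>)
  show i1: "integrable lborel (\<lambda>y. \<eta> y *\<^sub>R pdiff k w y)"
    by (rule integrable_lborel_compact_support[OF c1, of r a]) (simp add: z)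
  show i2: "integrable lborel (\<lambda>y. \<eta>' k y *\<^sub>R w y)"
    by (rule integrable_lborel_compact_support[OF c2, of r a]) (simp add: z)
  have "(LBINT y. \<eta> y *\<^sub>R pdiff k w y + \<eta>' k y *\<^sub>R w y) = 0"
  proof (rule integral_partial_compact_support[where u = "\<lambda>y. \<eta> y *\<^sub>R w y" and r = r and a = a
        and D = "\<lambda>k y. \<eta> y *\<^sub>R pdiff k w y + \<eta>' k y *\<^sub>R w y"])
    show "has_partials (\<lambda>y. \<eta> y *\<^sub>R w y) (\<lambda>k. \<eta> x *\<^sub>R pdiff k w x + \<eta>' k x *\<^sub>R w x) x" for x
    proof (cases "x \<in> S")
      case True
      have "has_partials \<eta> (\<lambda>k. \<eta>' k x) x" using \<eta> by (simp add: test_fun_def)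
      from has_partials_scaleR[OF this C1_on_has_partials[OF w True]] show ?thesis .
    next
      case False
      then have x: "x \<in> {y. r < norm (y - a)}"
        using S(2) by (force simp: dist_norm norm_minus_commute[of a])
      have "has_partials (\<lambda>_. 0::'b) (\<lambda>_. 0) x" by (simp add: has_partials_def)
      then have "has_partials (\<lambda>y. \<eta> y *\<^sub>R w y) (\<lambda>_. 0) x"
        by (rule has_partials_cong[OF _ _ x]) (auto simp: z intro!: open_Collect_less continuous_intros)
      then show ?thesis using x z by simp
    qed
    show "continuous_on UNIV (\<lambda>y. \<eta> y *\<^sub>R pdiff k w y + \<eta>' k y *\<^sub>R w y)"
      by (intro continuous_on_add c1 c2)
    show "\<eta> y *\<^sub>R w y = 0" if "r < norm (y - a)" for y
      using z that by simp
  qed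
  then show "(LBINT y. \<eta> y *\<^sub>R pdiff k w y) = - (LBINT y. \<eta>' k y *\<^sub>R w y)"
    using i1 i2 by (simp add: add_eq_0_iff2)
qed

section \<open>Radial bump functions and the fundamental lemma of the calculus of variations\<close>

lemma has_real_derivative_If_le:
  fixes f g :: "real \<Rightarrow> real"
  assumes "\<And>s. s \<le> a \<Longrightarrow> (f has_real_derivative f' s) (at s)"
    and "\<And>s. a \<le> s \<Longrightarrow> (g has_real_derivative g' s) (at s)"
    and "f a = g a" "f' a = g' a"
  shows "((\<lambda>s. if s \<le> a then f s else g s) has_real_derivative (if s \<le> a then f' s else g' s)) (at s)"
proof -
  have "((\<lambda>s. if s \<in> {..a} then f s else g s) has_vector_derivative
      (if s \<in> {..a} then f' s else g' s)) (at s within UNIV)"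
  proof (rule has_vector_derivative_If_within_closures[where T = "{a<..}"])
    show "(f has_vector_derivative f' s) (at s within {..a} \<union> closure {..a} \<inter> closure {a<..})"
      if "s \<in> {..a} \<union> closure {..a} \<inter> closure {a<..}"
      using that assms(1)[of s]
      by (auto simp: has_real_derivative_iff_has_vector_derivative intro: has_vector_derivative_at_within)
    show "(g has_vector_derivative g' s) (at s within {a<..} \<union> closure {..a} \<inter> closure {a<..})"
      if "s \<in> {a<..} \<union> closure {..a} \<inter> closure {a<..}"
      using that assms(2)[of s]
      by (auto simp: has_real_derivative_iff_has_vector_derivative intro: has_vector_derivative_at_within)
    show "f s = g s" "f' s = g' s" if "s \<in> closure {..a}" "s \<in> closure {a<..}"
      using that assms(3,4) by (auto dest: order_antisym)
  qed auto
  then show ?thesis by (simp add: has_real_derivative_iff_has_vector_derivative)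
qed

text \<open>Radial functions are written in terms of the squared distance, which is smooth at the
  centre, unlike the norm.\<close>

lemma has_partials_radial:
  assumes "(p has_real_derivative p') (at (c * ((y - a) \<bullet> (y - a))))"
  shows "has_partials (\<lambda>y. p (c * ((y - a) \<bullet> (y - a)))) (\<lambda>k. p' * (2 * c * (y - a) $ k)) y"
proof -
  have "has_partials (\<lambda>y. c * ((y - a) \<bullet> (y - a))) (\<lambda>k. 2 * c * (y - a) $ k) y"
    unfolding has_partials_def
    by (rule has_derivative_eq_rhs, (rule derivative_intros)+)
      (simp add: fun_eq_iff inner_vec_def sum_3 algebra_simps)
  from has_partials_chain[OF assms this] show ?thesis .
qed

lemma has_partials_coord: "has_partials (\<lambda>y. (y - a) $ j) (\<lambda>k. if k = j then 1 else (0::real)) y"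
  unfolding has_partials_def vector_minus_component
  by (rule has_derivative_eq_rhs[OF has_derivative_diff[OF
        bounded_linear_imp_has_derivative[OF bounded_linear_vec_nth] has_derivative_const]])
    (simp add: fun_eq_iff if_distrib cong: if_cong)

lemma has_partials_radial_second:
  assumes "(p' has_real_derivative p'') (at (c * ((y - a) \<bullet> (y - a))))"
  shows "has_partials (\<lambda>y. p' (c * ((y - a) \<bullet> (y - a))) * (2 * c * (y - a) $ j))
     (\<lambda>k. 4 * c\<^sup>2 * p'' * (y - a) $ k * (y - a) $ j
        + (if k = j then 2 * c * p' (c * ((y - a) \<bullet> (y - a))) else 0)) y"
proof -
  have "has_partials (\<lambda>y. 2 * c * (y - a) $ j) (\<lambda>k. if k = j then 2 * c else 0) y"
    using has_partials_bounded_linear[OF bounded_linear_mult_right has_partials_coord, of "2 * c" a j y]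
    by (simp add: if_distrib cong: if_cong)
  from has_partials_mult[OF has_partials_radial[OF assms] this] show ?thesis
    by (rule back_subst[where P = "\<lambda>D. has_partials _ D _"]) (auto simp: fun_eq_iff power2_eq_square)
qed

text \<open>Symmetry of the second partials is demanded outright; explicit bumps have it by their
  formula, so deriving Schwarz's theorem from such functions is not circular.\<close>

definition test_fun2 ::
    "(real^3 \<Rightarrow> real) \<Rightarrow> (3 \<Rightarrow> real^3 \<Rightarrow> real) \<Rightarrow> (3 \<Rightarrow> 3 \<Rightarrow> real^3 \<Rightarrow> real) \<Rightarrow> real^3 \<Rightarrow> real \<Rightarrow> bool" where
  "test_fun2 \<eta> \<eta>' \<eta>'' a r \<longleftrightarrow> test_fun \<eta> \<eta>' a r \<and> (\<forall>j. test_fun (\<eta>' j) (\<lambda>k. \<eta>'' k j) a r) \<and>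
     (\<forall>j k. \<eta>'' k j = \<eta>'' j k)"

text \<open>The profile \<open>(1 - s)^3\<close> vanishes to third order at \<open>s = 1\<close>, so
  cutting it off there keeps it C2; \<open>s\<close> is the squared distance divided by the square
  of \<delta>.\<close>

lemma bump_exists:
  assumes "\<delta> > 0"
  obtains \<eta> \<eta>' \<eta>'' where "test_fun2 \<eta> \<eta>' \<eta>'' a \<delta>" "\<And>y. \<eta> y \<ge> 0" "\<eta> a > 0"
proof -
  define b :: "real \<Rightarrow> real" where "b s = (if s \<le> 1 then (1 - s)^3 else 0)" for s
  define b' :: "real \<Rightarrow> real" where "b' s = (if s \<le> 1 then - 3 * (1 - s)^2 else 0)" for s
  define b'' :: "real \<Rightarrow> real" where "b'' s = (if s \<le> 1 then 6 * (1 - s) else 0)" for s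
  \<comment> \<open>This is no third derivative but \<open>b''\<close> written with
    \<open>max\<close>, which makes its continuity visible.\<close>
  define b''' :: "real \<Rightarrow> real" where "b''' s = max 0 (6 * (1 - s))" for s
  have bd: "(b has_real_derivative b' s) (at s)" for s
    unfolding b_def b'_def
    by (rule has_real_derivative_If_le) (auto intro!: derivative_eq_intros)
  have bd': "(b' has_real_derivative b'' s) (at s)" for s
    unfolding b''_def b'_def
    by (rule has_real_derivative_If_le) (auto intro!: derivative_eq_intros)
  have b'': "b'' = b'''" by (auto simp: b''_def b'''_def fun_eq_iff max_def)
  define c where "c = 1 / \<delta>\<^sup>2"
  have c: "c > 0" using assms by (simp add: c_def)
  define \<sigma> where "\<sigma> y = c * ((y - a) \<bullet> (y - a))" for y :: "real^3"
  define \<eta> where "\<eta> y = b (\<sigma> y)" for y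
  define \<eta>' where "\<eta>' k y = b' (\<sigma> y) * (2 * c * (y - a) $ k)" for k y
  define \<eta>'' where "\<eta>'' k j y = 4 * c\<^sup>2 * b'' (\<sigma> y) * (y - a) $ k * (y - a) $ j
        + (if k = j then 2 * c * b' (\<sigma> y) else 0)" for k j y
  have s1: "\<sigma> y > 1" if "\<delta> < norm (y - a)" for y
  proof -
    have "\<delta>\<^sup>2 < (norm (y - a))\<^sup>2" using that assms by (intro power_strict_mono) auto
    then show ?thesis using assms by (simp add: \<sigma>_def c_def power2_norm_eq_inner)
  qed
  have cb': "continuous_on UNIV b'"
    using bd' by (meson DERIV_isCont continuous_at_imp_continuous_on)
  have cs: "continuous_on UNIV \<sigma>" unfolding \<sigma>_def by (intro continuous_intros)
  have cb's: "continuous_on UNIV (\<lambda>y. b' (\<sigma> y))"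
    by (rule continuous_on_compose2[OF cb' cs]) auto
  have cb''s: "continuous_on UNIV (\<lambda>y. b'' (\<sigma> y))"
    unfolding b'' b'''_def by (intro continuous_intros cs)
  have t0: "test_fun \<eta> \<eta>' a \<delta>"
    unfolding test_fun_def
  proof (intro conjI allI impI)
    show "has_partials \<eta> (\<lambda>k. \<eta>' k y) y" for y
      unfolding \<eta>_def \<eta>'_def \<sigma>_def by (rule has_partials_radial[OF bd])
    show "continuous_on UNIV (\<eta>' k)" for k
      unfolding \<eta>'_def by (intro continuous_intros cb's)
    show "\<eta> y = 0" if "\<delta> < norm (y - a)" for y
      using s1[OF that] by (simp add: \<eta>_def b_def)
  qed
  have t1: "test_fun (\<eta>' j) (\<lambda>k. \<eta>'' k j) a \<delta>" for j
    unfolding test_fun_def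
  proof (intro conjI allI impI)
    show "has_partials (\<eta>' j) (\<lambda>k. \<eta>'' k j y) y" for y
      unfolding \<eta>'_def \<eta>''_def \<sigma>_def by (rule has_partials_radial_second[OF bd'])
    show "continuous_on UNIV (\<eta>'' k j)" for k
      unfolding \<eta>''_def by (cases "k = j") (auto intro!: continuous_intros cb's cb''s)
    show "\<eta>' j y = 0" if "\<delta> < norm (y - a)" for y
      using s1[OF that] by (simp add: \<eta>'_def b'_def)
  qed
  have "test_fun2 \<eta> \<eta>' \<eta>'' a \<delta>"
    unfolding test_fun2_def using t0 t1 by (auto simp: \<eta>''_def fun_eq_iff)
  moreover have "\<eta> y \<ge> 0" for y by (simp add: \<eta>_def b_def)
  moreover have "\<eta> a > 0" by (simp add: \<eta>_def b_def \<sigma>_def)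
  ultimately show ?thesis using that by blast
qed

text \<open>If \<open>g x\<close> were nonzero, its inner product with \<open>g y\<close> would be
  positive for \<open>y\<close> near \<open>x\<close>, and a nonnegative bump around
  \<open>x\<close> would produce a positive integral.\<close>

lemma eq_0_if_orthogonal_test_fun2:
  fixes g :: "real^3 \<Rightarrow> 'b::euclidean_space"
  assumes "open S" "continuous_on S g" "x \<in> S"
    and orth: "\<And>\<eta> \<eta>' \<eta>'' r. cball x r \<subseteq> S \<Longrightarrow> test_fun2 \<eta> \<eta>' \<eta>'' x r \<Longrightarrow> (LBINT y. \<eta> y *\<^sub>R g y) = 0"
  shows "g x = 0"
proof (rule ccontr)
  assume "g x \<noteq> 0"
  have "continuous_on S (\<lambda>y. g y \<bullet> g x)" using assms(2) by (intro continuous_intros)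
  then have "isCont (\<lambda>y. g y \<bullet> g x) x" using assms(1,3) by (simp add: continuous_on_eq_continuous_at)
  moreover have "g x \<bullet> g x > 0" using \<open>g x \<noteq> 0\<close> by simp
  ultimately have "\<forall>\<^sub>F y in nhds x. g y \<bullet> g x > 0"
    unfolding eventually_nhds_conv_at isCont_def by (auto intro: order_tendstoD)
  moreover have "\<forall>\<^sub>F y in nhds x. y \<in> S" using assms(1,3) by (rule eventually_nhds_in_open)
  ultimately have "\<forall>\<^sub>F y in nhds x. g y \<bullet> g x > 0 \<and> y \<in> S" by eventually_elim auto
  then obtain d where d: "d > 0" "\<And>y. dist y x \<le> d \<Longrightarrow> g y \<bullet> g x > 0 \<and> y \<in> S"
    unfolding eventually_nhds_metric_le by blast
  then have sub: "cball x d \<subseteq> S" by (auto simp: dist_commute)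
  obtain \<eta> \<eta>' \<eta>'' where t: "test_fun2 \<eta> \<eta>' \<eta>'' x d" and pos: "\<And>y. \<eta> y \<ge> 0" "\<eta> x > 0"
    using bump_exists[OF d(1)] by metis
  have t0: "test_fun \<eta> \<eta>' x d" using t by (simp add: test_fun2_def)
  have cont: "continuous_on UNIV (\<lambda>y. \<eta> y *\<^sub>R g y)"
    by (rule continuous_on_mult_support[OF assms(1) sub test_fun_continuous[OF t0] test_fun_zero[OF t0] assms(2)])
  have int: "integrable lborel (\<lambda>y. \<eta> y *\<^sub>R g y)"
    by (rule integrable_lborel_compact_support[OF cont, of d x]) (simp add: test_fun_zero[OF t0])
  define G where "G y = (\<eta> y *\<^sub>R g y) \<bullet> g x" for y
  have G0: "G y \<ge> 0" for y
    using pos(1)[of y] d(2)[of y] test_fun_zero[OF t0, of y]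
    by (cases "dist y x \<le> d") (auto simp: G_def dist_norm)
  have "integrable lborel G" unfolding G_def by (rule integrable_inner_left) (rule int)
  moreover have "integral\<^sup>L lborel G = 0"
    unfolding G_def by (subst integral_inner_left) (use int orth[OF sub t] in auto)
  ultimately have "AE y in lborel. G y = 0"
    using G0 by (subst (asm) integral_nonneg_eq_0_iff_AE) auto
  \<comment> \<open>\<open>G\<close> vanishes almost everywhere, and a negligible open set is
    empty.\<close>
  moreover have "open {y. G y \<noteq> 0}"
    unfolding G_def by (intro open_Collect_neq continuous_intros cont)
  ultimately have "{y. G y \<noteq> 0} = {}"
    by (metis (mono_tags, lifting) AE_iff_null_sets[of "{y. G y \<noteq> 0}" lborel] borel_open eventually_mono
        mem_Collect_eq open_not_negligible negligible_iff_null_sets null_sets_completionI sets_lborel)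
  moreover have "G x \<noteq> 0" using pos(2) \<open>g x \<noteq> 0\<close> by (simp add: G_def)
  ultimately show False by auto
qed

text \<open>\<open>\<Phi>\<close> is only assumed to be once differentiable, so the second derivatives are moved to a test
  function.\<close>

lemma divg_rot:
  assumes S: "open S" and \<Phi>: "C1_on S \<Phi>" and R: "C1_on S (rot \<Phi>)" and x: "x \<in> S"
  shows "divg (rot \<Phi>) x = 0"
proof (rule eq_0_if_orthogonal_test_fun2[OF S _ x])
  show "continuous_on S (divg (rot \<Phi>))"
    unfolding divg_def by (intro continuous_intros C1_on_continuous_pdiff C1_on_nth R)
  fix \<eta> \<eta>' \<eta>'' r assume sub: "cball x r \<subseteq> S" and t: "test_fun2 \<eta> \<eta>' \<eta>'' x r"
  have t0: "test_fun \<eta> \<eta>' x r" and t1: "\<And>j. test_fun (\<eta>' j) (\<lambda>k. \<eta>'' k j) x r"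
    and sym: "\<And>j k. \<eta>'' k j = \<eta>'' j k"
    using t by (auto simp: test_fun2_def)
  note p0 = integral_by_parts_test_fun[OF S sub t0 C1_on_nth[OF R]]
  note p1 = integral_by_parts_test_fun[OF S sub t1 C1_on_nth[OF \<Phi>]]
  \<comment> \<open>Two integrations by parts turn every term into one of these integrals; the six
    of them cancel in pairs because the second partials of \<eta> are symmetric.\<close>
  define I where "I j k i = (LBINT y. \<eta>'' j k y *\<^sub>R (\<Phi> y $ i))" for j k i
  have I: "I j k i = I k j i" for j k i unfolding I_def using sym by metis
  have J: "(LBINT y. \<eta>' k y *\<^sub>R (pdiff j (\<lambda>y. \<Phi> y $ i) y - pdiff j' (\<lambda>y. \<Phi> y $ i') y))
      = I j' k i' - I j k i" for j k i j' i'
    unfolding scaleR_diff_right I_def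
    by (subst Bochner_Integration.integral_diff) (auto intro: p1(1) simp: p1(3))
  have "(LBINT y. \<eta> y *\<^sub>R divg (rot \<Phi>) y) = (\<Sum>k\<in>UNIV. - (LBINT y. \<eta>' k y *\<^sub>R (rot \<Phi> y $ k)))"
    unfolding divg_def scaleR_sum_right using p0 by (subst Bochner_Integration.integral_sum) auto
  also have "\<dots> = 0"
    unfolding sum_3 by (simp add: rot_def J I[of 2 1] I[of 3 1] I[of 3 2])
  finally show "(LBINT y. \<eta> y *\<^sub>R divg (rot \<Phi>) y) = 0" .
qed

text \<open>Against a test function both mixed partials give the same integral, since both
  derivatives can be moved onto it.\<close>

lemma pdiff_commute:
  fixes u :: "real^3 \<Rightarrow> 'b::euclidean_space"
  assumes S: "open S" and u: "C2_on S u" and x: "x \<in> S"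
  shows "pdiff j (pdiff k u) x = pdiff k (pdiff j u) x"
proof -
  have u0: "C1_on S u" and u1: "\<And>k. C1_on S (pdiff k u)" using u by (auto simp: C2_on_def)
  have "pdiff j (pdiff k u) x - pdiff k (pdiff j u) x = 0"
  proof (rule eq_0_if_orthogonal_test_fun2[OF S _ x])
    show "continuous_on S (\<lambda>x. pdiff j (pdiff k u) x - pdiff k (pdiff j u) x)"
      by (intro continuous_intros C1_on_continuous_pdiff u1)
    fix \<eta> \<eta>' \<eta>'' r assume sub: "cball x r \<subseteq> S" and t: "test_fun2 \<eta> \<eta>' \<eta>'' x r"
    have t0: "test_fun \<eta> \<eta>' x r" and t1: "\<And>j. test_fun (\<eta>' j) (\<lambda>k. \<eta>'' k j) x r"
      and sym: "\<And>j k. \<eta>'' k j = \<eta>'' j k"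
      using t by (auto simp: test_fun2_def)
    note p0 = integral_by_parts_test_fun[OF S sub t0 u1]
    note p1 = integral_by_parts_test_fun[OF S sub t1 u0]
    show "(LBINT y. \<eta> y *\<^sub>R (pdiff j (pdiff k u) y - pdiff k (pdiff j u) y)) = 0"
      unfolding scaleR_diff_right
      by (subst Bochner_Integration.integral_diff) (auto intro: p0(1) simp: p0(3) p1(3) sym[of j k])
  qed
  then show ?thesis by simp
qed

section \<open>The regularized kernel\<close>

text \<open>\<open>1 / sqrt s\<close> for \<open>s > 1\<close>, continued by its second Taylor polynomial at \<open>1\<close>.\<close>

definition psi :: "real \<Rightarrow> real" where
  "psi s = (if s \<le> 1 then 15/8 - 5/4 * s + 3/8 * s\<^sup>2 else 1 / sqrt s)"

definition psi1 :: "real \<Rightarrow> real" where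
  "psi1 s = (if s \<le> 1 then - 5/4 + 3/4 * s else - 1 / (2 * s * sqrt s))"

definition psi2 :: "real \<Rightarrow> real" where
  "psi2 s = (if s \<le> 1 then 3/4 else 3 / (4 * s\<^sup>2 * sqrt s))"

lemma DERIV_psi: "(psi has_real_derivative psi1 s) (at s)"
  unfolding psi_def psi1_def
  by (rule has_real_derivative_If_le)
    (auto intro!: derivative_eq_intros simp: field_simps power2_eq_square)

lemma DERIV_psi1: "(psi1 has_real_derivative psi2 s) (at s)"
  unfolding psi2_def psi1_def
  by (rule has_real_derivative_If_le)
    (auto intro!: derivative_eq_intros simp: field_simps power2_eq_square)

lemma continuous_psi: "continuous_on UNIV psi" "continuous_on UNIV psi1" "continuous_on UNIV psi2"
proof -
  show "continuous_on UNIV psi"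
    by (intro continuous_at_imp_continuous_on ballI DERIV_isCont[OF DERIV_psi])
  show "continuous_on UNIV psi1"
    by (intro continuous_at_imp_continuous_on ballI DERIV_isCont[OF DERIV_psi1])
  \<comment> \<open>At \<open>s = 1\<close> both branches equal 3/4, so the case distinction can be
    absorbed into \<open>max 1 s\<close>.\<close>
  have "psi2 = (\<lambda>s. 3 / (4 * (max 1 s)\<^sup>2 * sqrt (max 1 s)))"
    by (auto simp: psi2_def fun_eq_iff max_def)
  moreover have "continuous_on UNIV (\<lambda>s::real. 3 / (4 * (max 1 s)\<^sup>2 * sqrt (max 1 s)))"
    by (intro continuous_intros) (auto simp: max_def)
  ultimately show "continuous_on UNIV psi2" by (simp only:)
qed

text \<open>The factor \<open>a\<close> matches the homogeneity of degree -1 of 1/|z|, so that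
  beyond radius \<open>1 / a\<close> the kernel no longer depends on \<open>a\<close>.\<close>

definition nker :: "real \<Rightarrow> real^3 \<Rightarrow> real" where
  "nker a z = a * psi (a\<^sup>2 * (z \<bullet> z))"

definition nker1 :: "real \<Rightarrow> 3 \<Rightarrow> real^3 \<Rightarrow> real" where
  "nker1 a k z = a * (psi1 (a\<^sup>2 * (z \<bullet> z)) * (2 * a\<^sup>2 * z $ k))"

definition nker2 :: "real \<Rightarrow> 3 \<Rightarrow> 3 \<Rightarrow> real^3 \<Rightarrow> real" where
  "nker2 a k j z = a * (4 * (a\<^sup>2)\<^sup>2 * psi2 (a\<^sup>2 * (z \<bullet> z)) * z $ k * z $ j
     + (if k = j then 2 * a\<^sup>2 * psi1 (a\<^sup>2 * (z \<bullet> z)) else 0))"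

lemma has_partials_nker: "has_partials (nker a) (\<lambda>k. nker1 a k z) z"
  using has_partials_bounded_linear[OF bounded_linear_mult_right
      has_partials_radial[of psi _ "a\<^sup>2" z 0, OF DERIV_psi], of a]
  by (simp add: nker_def[abs_def] nker1_def)

lemma has_partials_nker1: "has_partials (nker1 a j) (\<lambda>k. nker2 a k j z) z"
  using has_partials_bounded_linear[OF bounded_linear_mult_right
      has_partials_radial_second[of psi1 _ "a\<^sup>2" z 0 j, OF DERIV_psi1], of a]
  by (simp add: nker2_def nker1_def[abs_def] cong: if_cong)

lemma nker2_commute: "nker2 a k j = nker2 a j k"
  by (auto simp: nker2_def fun_eq_iff)

lemma continuous_nker:
  "continuous_on UNIV (nker a)" "continuous_on UNIV (nker1 a k)" "continuous_on UNIV (nker2 a k j)"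
proof -
  have "continuous_on UNIV (\<lambda>z::real^3. g (a\<^sup>2 * (z \<bullet> z)))" if "continuous_on UNIV g" for g :: "real \<Rightarrow> real"
    by (rule continuous_on_compose2[OF that]) (auto intro!: continuous_intros)
  note c = continuous_psi[THEN this]
  show "continuous_on UNIV (nker a)"
    unfolding nker_def by (intro continuous_intros c)
  show "continuous_on UNIV (nker1 a k)"
    unfolding nker1_def by (intro continuous_intros c)
  show "continuous_on UNIV (nker2 a k j)"
    unfolding nker2_def by (cases "k = j") (auto intro!: continuous_intros c)
qed

lemma nker_far:
  assumes "a > 0" "1 / a < norm z"
  shows "nker a z = 1 / norm z"
proof -
  have n: "1 < a * norm z" using assms by (simp add: divide_less_eq mult.commute)
  then have n2: "1 < (a * norm z)\<^sup>2" by (simp add: one_less_power)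
  have s: "a\<^sup>2 * (z \<bullet> z) = (a * norm z)\<^sup>2"
    by (simp add: power_mult_distrib power2_norm_eq_inner)
  have "psi ((a * norm z)\<^sup>2) = 1 / (a * norm z)"
    by (subst psi_def, subst if_not_P, use n2 in linarith, use n in simp)
  then show ?thesis
    using assms n s by (simp add: nker_def)
qed

text \<open>This is the Laplacian of \<open>nker a\<close>. It vanishes beyond radius
  \<open>1 / a\<close> because 1/|z| is harmonic; inside, \<open>4 s psi2 + 6 psi1\<close> is
  \<open>3 s + 6 (3 s / 4 - 5/4) = - 15/2 (1 - s)\<close>.\<close>

lemma sum_nker2:
  "(\<Sum>k\<in>UNIV. nker2 a k k z) = - (15/2 * a^3 * max 0 (1 - a\<^sup>2 * (z \<bullet> z)))"
proof -
  let ?s = "a\<^sup>2 * (z \<bullet> z)"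
  have "(\<Sum>k\<in>UNIV. nker2 a k k z) = a^3 * (4 * ?s * psi2 ?s + 6 * psi1 ?s)"
    unfolding sum_3 nker2_def inner_vec_def
    by (simp add: algebra_simps power2_eq_square power3_eq_cube)
  also have "4 * ?s * psi2 ?s + 6 * psi1 ?s = - (15/2) * max 0 (1 - ?s)"
  proof (cases "?s \<le> 1")
    case True
    then show ?thesis by (simp add: psi1_def psi2_def max_def algebra_simps)
  next
    case False
    then show ?thesis by (simp add: psi1_def psi2_def max_def field_simps power2_eq_square)
  qed
  finally show ?thesis by (simp add: algebra_simps)
qed

text \<open>With \<open>t = a |z|\<close> the four quantities decay at least like 1/t for large
  \<open>t\<close>. All are weakened to the common form \<open>c / (1 + t)\<close>, the decay that
  matches the weight in \<open>admissible\<close>; on [0, 1] constants are converted by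
  \<open>1 \<le> 2 / (1 + t)\<close>.\<close>

lemma psi_bounds:
  assumes "t \<ge> 0"
  shows "\<bar>psi (t\<^sup>2)\<bar> \<le> 4 / (1 + t) \<and> \<bar>psi1 (t\<^sup>2)\<bar> * t \<le> 5/2 / (1 + t) \<and>
    \<bar>psi1 (t\<^sup>2)\<bar> \<le> 5/2 / (1 + t) \<and> \<bar>psi2 (t\<^sup>2)\<bar> * t\<^sup>2 \<le> 3/2 / (1 + t)"
proof (cases "t \<le> 1")
  case True
  then have t2: "t\<^sup>2 \<le> 1" "t\<^sup>2 \<ge> 0" using assms by (auto simp: power_le_one)
  have m: "c \<le> 2 * c / (1 + t)" if "c \<ge> 0" for c
  proof -
    have "c * (1 + t) \<le> c * 2" using that True assms by (intro mult_left_mono) auto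
    then show ?thesis using assms by (simp add: pos_le_divide_eq mult.commute)
  qed
  have "(t\<^sup>2)\<^sup>2 \<le> t\<^sup>2" using mult_left_mono[OF t2] by (simp add: power2_eq_square)
  moreover have "(t\<^sup>2)\<^sup>2 \<ge> 0" by simp
  moreover define x where "x = t\<^sup>2"
  ultimately have "\<bar>psi x\<bar> \<le> 2"
    using t2 unfolding psi_def x_def[symmetric] by (auto simp: abs_le_iff)
  then have 1: "\<bar>psi (t\<^sup>2)\<bar> \<le> 2" by (simp add: x_def)
  have 2: "\<bar>psi1 (t\<^sup>2)\<bar> \<le> 5/4"
    using t2 by (simp add: psi1_def abs_le_iff)
  have 3: "\<bar>psi1 (t\<^sup>2)\<bar> * t \<le> 5/4"
    using mult_mono[OF 2 True] assms by simp
  have 4: "\<bar>psi2 (t\<^sup>2)\<bar> * t\<^sup>2 \<le> 3/4"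
    using t2 by (simp add: psi2_def)
  from 1 2 3 4 m[of 2] m[of "5/4"] m[of "3/4"] show ?thesis by auto
next
  case False
  then have t: "t > 1" by simp
  then have t2: "t\<^sup>2 > 1" by (simp add: one_less_power)
  have s: "sqrt (t\<^sup>2) = t" using assms by simp
  have p: "psi (t\<^sup>2) = 1 / t" "psi1 (t\<^sup>2) = - 1 / (2 * t^3)" "psi2 (t\<^sup>2) = 3 / (4 * t^5)"
    using t2 s by (simp_all add: psi_def psi1_def psi2_def power2_eq_square power3_eq_cube
        numeral_eq_Suc)
  have tn: "1 / t^n \<le> 1 / t" if "n \<ge> 1" for n
    using t that power_increasing[of 1 n t] by (intro divide_left_mono) auto
  have tt: "1 / t \<le> 2 / (1 + t)" using t by (simp add: field_simps)
  have "\<bar>psi1 (t\<^sup>2)\<bar> = 1/2 * (1 / t^3)" using t by (simp add: p)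
  moreover have "\<bar>psi1 (t\<^sup>2)\<bar> * t = 1/2 * (1 / t^2)"
    unfolding p using t by (simp add: power2_eq_square power3_eq_cube)
  moreover have "\<bar>psi2 (t\<^sup>2)\<bar> * t\<^sup>2 = 3/4 * (1 / t^3)"
    unfolding p using t by (simp add: power2_eq_square numeral_eq_Suc)
  moreover have "\<bar>psi (t\<^sup>2)\<bar> = 1 / t" using t by (simp add: p)
  moreover have "5/2 / (1 + t) = 5/4 * (2 / (1 + t))" "4 / (1 + t) = 2 * (2 / (1 + t))"
    "3/2 / (1 + t) = 3/4 * (2 / (1 + t))" "2 / (1 + t) > 0"
    using t by auto
  ultimately show ?thesis using tn[of 3] tn[of 2] tt by (intro conjI; linarith)
qed

text \<open>The powers of \<open>a\<close> come from the scaling. The constants are 2 * 5/2 = 5 for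
  the first partials and 4 * 3/2 + 2 * 5/2 = 11 for the second, the last summand being the diagonal
  term.\<close>

lemma nker_bounds:
  assumes "a > 0"
  shows "\<bar>nker a z\<bar> \<le> 4 * a / (1 + a * norm z)"
    "\<bar>nker1 a k z\<bar> \<le> 5 * a\<^sup>2 / (1 + a * norm z)"
    "\<bar>nker2 a k j z\<bar> \<le> 11 * a^3 / (1 + a * norm z)"
proof -
  let ?t = "a * norm z"
  have s: "a\<^sup>2 * (z \<bullet> z) = ?t\<^sup>2" by (simp add: power_mult_distrib power2_norm_eq_inner)
  have t: "?t \<ge> 0" using assms by simp
  note b = conjunct1[OF psi_bounds[OF t]] conjunct2[OF psi_bounds[OF t]]
  note b = b(1) b(2)[THEN conjunct1] b(2)[THEN conjunct2, THEN conjunct1] b(2)[THEN conjunct2, THEN conjunct2]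
  have zk: "\<bar>z $ k\<bar> \<le> norm z" for k by (rule component_le_norm_cart)
  have "\<bar>nker a z\<bar> = a * \<bar>psi (?t\<^sup>2)\<bar>" using assms by (simp add: nker_def s abs_mult)
  also have "\<dots> \<le> a * (4 / (1 + ?t))" using assms b(1) by (intro mult_left_mono) auto
  finally show "\<bar>nker a z\<bar> \<le> 4 * a / (1 + a * norm z)" by (simp add: mult.commute)
  have "\<bar>nker1 a k z\<bar> = 2 * a^3 * \<bar>psi1 (?t\<^sup>2)\<bar> * \<bar>z $ k\<bar>"
    unfolding nker1_def s using assms by (simp add: abs_mult power2_eq_square power3_eq_cube)
  also have "\<dots> \<le> 2 * a^3 * \<bar>psi1 (?t\<^sup>2)\<bar> * norm z"
    using assms zk by (intro mult_left_mono) auto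
  also have "\<dots> = 2 * a\<^sup>2 * (\<bar>psi1 (?t\<^sup>2)\<bar> * ?t)"
    by (simp add: power2_eq_square power3_eq_cube)
  also have "\<dots> \<le> 2 * a\<^sup>2 * (5/2 / (1 + ?t))"
    using b(2) by (intro mult_left_mono) auto
  also have "\<dots> = 5 * a\<^sup>2 / (1 + ?t)" by (simp only: times_divide_eq_right)
  finally show "\<bar>nker1 a k z\<bar> \<le> 5 * a\<^sup>2 / (1 + a * norm z)" .
  have "nker2 a k j z = 4 * a^5 * psi2 (?t\<^sup>2) * (z $ k * z $ j) + (if k = j then 2 * a^3 * psi1 (?t\<^sup>2) else 0)"
    unfolding nker2_def s by (simp add: distrib_left numeral_eq_Suc mult_ac)
  then have "\<bar>nker2 a k j z\<bar> \<le> \<bar>4 * a^5 * psi2 (?t\<^sup>2) * (z $ k * z $ j)\<bar> + \<bar>2 * a^3 * psi1 (?t\<^sup>2)\<bar>"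
    by auto
  also have "\<bar>4 * a^5 * psi2 (?t\<^sup>2) * (z $ k * z $ j)\<bar> = 4 * a^5 * \<bar>psi2 (?t\<^sup>2)\<bar> * (\<bar>z $ k\<bar> * \<bar>z $ j\<bar>)"
    using assms by (simp add: abs_mult)
  also have "\<dots> \<le> 4 * a^5 * \<bar>psi2 (?t\<^sup>2)\<bar> * (norm z * norm z)"
    using assms zk by (intro mult_left_mono mult_mono) auto
  also have "\<dots> = 4 * a^3 * (\<bar>psi2 (?t\<^sup>2)\<bar> * ?t\<^sup>2)"
    by (simp add: power2_eq_square numeral_eq_Suc mult_ac)
  also have "\<dots> \<le> 4 * a^3 * (3/2 / (1 + ?t))"
    using b(4) assms by (intro mult_left_mono) auto
  also have "\<bar>2 * a^3 * psi1 (?t\<^sup>2)\<bar> = 2 * a^3 * \<bar>psi1 (?t\<^sup>2)\<bar>"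
    using assms by (simp add: abs_mult)
  also have "\<dots> \<le> 2 * a^3 * (5/2 / (1 + ?t))"
    using b(3) assms by (intro mult_left_mono) auto
  finally have "\<bar>nker2 a k j z\<bar> \<le> 4 * a^3 * (3/2 / (1 + ?t)) + 2 * a^3 * (5/2 / (1 + ?t))"
    by simp
  also have "\<dots> = 11 * a^3 / (1 + ?t)"
  proof -
    have "4 * X * (3/2 / B) + 2 * X * (5/2 / B) = 11 * X / B" for X B :: real
      by (cases "B = 0") (auto simp: field_simps)
    then show ?thesis .
  qed
  finally show "\<bar>nker2 a k j z\<bar> \<le> 11 * a^3 / (1 + a * norm z)" .
qed

text \<open>The loss \<open>1 / a\<close> for small \<open>a\<close> is affordable: against the
  factor \<open>b\<^sup>2\<close> of the first partials it leaves one power of \<open>b\<close>, and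
  this makes them vanish in the limit in \<open>convo_divergence_free\<close>.\<close>

lemma decay_rescale:
  fixes z :: "'a::real_normed_vector"
  assumes "a > 0" "c \<ge> 0"
  shows "c / (1 + a * norm z) \<le> (c * max 1 (1 / a)) / (1 + norm z)"
proof -
  have "1 + norm z \<le> max 1 (1 / a) * (1 + a * norm z)"
  proof (cases "a \<ge> 1")
    case True
    then have "1 * norm z \<le> a * norm z" by (intro mult_right_mono) auto
    then show ?thesis using True assms by (simp add: max_def field_simps)
  next
    case False
    then show ?thesis using assms by (simp add: max_def field_simps)
  qed
  then have "c * (1 + norm z) \<le> c * (max 1 (1 / a) * (1 + a * norm z))"
    using assms by (intro mult_left_mono) auto
  moreover have "1 + norm z > 0" "1 + a * norm z > 0"
    using assms by (auto intro: add_pos_nonneg)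
  ultimately show ?thesis by (simp add: field_simps)
qed

section \<open>Convolution with decaying kernels\<close>

definition decaying :: "(real^3 \<Rightarrow> real) \<Rightarrow> bool" where
  "decaying \<kappa> \<longleftrightarrow> continuous_on UNIV \<kappa> \<and> (\<exists>C\<ge>0. \<forall>z. \<bar>\<kappa> z\<bar> \<le> C / (1 + norm z))"

lemma decaying_nker:
  assumes "a > 0"
  shows "decaying (nker a)" "decaying (nker1 a k)" "decaying (nker2 a k j)"
proof -
  have *: "decaying \<kappa>"
    if "continuous_on UNIV \<kappa>" "\<And>z. \<bar>\<kappa> z\<bar> \<le> c / (1 + a * norm z)" "c \<ge> 0" for \<kappa> c
    unfolding decaying_def
  proof (intro conjI exI allI)
    show "\<bar>\<kappa> z\<bar> \<le> c * max 1 (1 / a) / (1 + norm z)" for z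
      using that(2)[of z] decay_rescale[OF assms that(3), of z] by linarith
  qed (use that assms in auto)
  show "decaying (nker a)"
    by (rule *[OF continuous_nker(1) nker_bounds(1)[OF assms]]) (use assms in auto)
  show "decaying (nker1 a k)"
    by (rule *[OF continuous_nker(2) nker_bounds(2)[OF assms]]) (use assms in auto)
  show "decaying (nker2 a k j)"
    by (rule *[OF continuous_nker(3) nker_bounds(3)[OF assms]]) (use assms in auto)
qed

text \<open>This weighted integrability follows from convergence of the Newtonian potential at a
  single point, so neither bounded domains nor bounded fields are presupposed.\<close>

definition admissible :: "(real^3 \<Rightarrow> 'b::{banach,second_countable_topology}) \<Rightarrow> bool" where
  "admissible v \<longleftrightarrow> v \<in> borel_measurable borel \<and> integrable lborel (\<lambda>y. norm (v y) / (1 + norm y))"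

definition convo :: "(real^3 \<Rightarrow> real) \<Rightarrow> (real^3 \<Rightarrow> 'b::{banach,second_countable_topology}) \<Rightarrow> real^3 \<Rightarrow> 'b" where
  "convo \<kappa> v x = (LBINT y. \<kappa> (x - y) *\<^sub>R v y)"

text \<open>Equivalent to \<open>1 + |y| \<le> (1 + |x|) (1 + |x - y|)\<close>: the decay of a
  kernel in \<open>x - y\<close> becomes the weight in \<open>y\<close>, with a factor that is
  bounded for bounded \<open>x\<close>.\<close>

lemma weight_shift:
  fixes x y :: "'a::real_normed_vector"
  shows "1 / (1 + norm (x - y)) \<le> (1 + norm x) / (1 + norm y)"
proof -
  have "norm y \<le> norm x + norm (x - y)"
    using norm_triangle_ineq4[of x "x - y"] by simp
  moreover have "norm x * norm (x - y) \<ge> 0" by simp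
  ultimately have "1 + norm y \<le> (1 + norm x) * (1 + norm (x - y))"
    unfolding distrib_left distrib_right by linarith
  moreover have "1 + norm (x - y) > 0" "1 + norm y > 0" by (auto intro: add_pos_nonneg)
  ultimately show ?thesis by (simp add: field_simps)
qed

lemma decaying_shift:
  assumes "\<forall>z. \<bar>\<kappa> z\<bar> \<le> C / (1 + norm z)" "C \<ge> 0" "norm x \<le> R"
  shows "norm (\<kappa> (x - y) *\<^sub>R v y) \<le> C * (1 + R) * (norm (v y) / (1 + norm y))"
proof -
  have "\<bar>\<kappa> (x - y)\<bar> \<le> C * (1 / (1 + norm (x - y)))" using assms(1) by simp
  also have "\<dots> \<le> C * ((1 + norm x) / (1 + norm y))"
    by (intro mult_left_mono weight_shift assms)
  also have "\<dots> \<le> C * ((1 + R) / (1 + norm y))"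
    using assms by (intro mult_left_mono divide_right_mono) auto
  finally have "\<bar>\<kappa> (x - y)\<bar> * norm (v y) \<le> C * ((1 + R) / (1 + norm y)) * norm (v y)"
    by (intro mult_right_mono) auto
  then show ?thesis by simp
qed

lemma measurable_convo_integrand:
  assumes "continuous_on UNIV \<kappa>" "admissible v"
  shows "(\<lambda>y. \<kappa> (x - y) *\<^sub>R v y) \<in> borel_measurable lborel"
proof -
  have "continuous_on UNIV (\<lambda>y. \<kappa> (x - y))"
    by (rule continuous_on_compose2[OF assms(1)]) (auto intro!: continuous_intros)
  then have "(\<lambda>y. \<kappa> (x - y)) \<in> borel_measurable borel" by (rule borel_measurable_continuous_onI)
  then show ?thesis using assms(2) by (auto simp: admissible_def)
qed

lemma integrable_convo:
  assumes "decaying \<kappa>" "admissible v"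
  shows "integrable lborel (\<lambda>y. \<kappa> (x - y) *\<^sub>R v y)"
proof -
  obtain C where C: "C \<ge> 0" "\<forall>z. \<bar>\<kappa> z\<bar> \<le> C / (1 + norm z)" "continuous_on UNIV \<kappa>"
    using assms(1) by (auto simp: decaying_def)
  show ?thesis
  proof (rule Bochner_Integration.integrable_bound)
    show "integrable lborel (\<lambda>y. C * (1 + norm x) * (norm (v y) / (1 + norm y)))"
      using assms(2) by (intro integrable_mult_right) (auto simp: admissible_def)
    show "AE y in lborel. norm (\<kappa> (x - y) *\<^sub>R v y) \<le> norm (C * (1 + norm x) * (norm (v y) / (1 + norm y)))"
      by (intro AE_I2 order_trans[OF decaying_shift[OF C(2,1) order_refl]]) (simp only: real_norm_def abs_ge_self)
  qed (rule measurable_convo_integrand[OF C(3) assms(2)])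
qed

lemma isCont_convo:
  assumes "decaying \<kappa>" "admissible v"
  shows "isCont (convo \<kappa> v) x"
proof -
  obtain C where C: "C \<ge> 0" "\<forall>z. \<bar>\<kappa> z\<bar> \<le> C / (1 + norm z)" "continuous_on UNIV \<kappa>"
    using assms(1) by (auto simp: decaying_def)
  show ?thesis
    unfolding continuous_at_sequentially comp_def
  proof (intro allI impI)
    fix X :: "nat \<Rightarrow> real^3" assume X: "X \<longlonglongrightarrow> x"
    \<comment> \<open>A convergent sequence stays in one ball of radius \<open>R\<close>, so
      \<open>decaying_shift\<close> yields a single dominating function.\<close>
    then have "Bseq X" using convergent_imp_Bseq convergentI by blast
    then obtain R where R: "\<And>i. norm (X i) \<le> R" by (auto simp: Bseq_def)
    show "(\<lambda>i. convo \<kappa> v (X i)) \<longlonglongrightarrow> convo \<kappa> v x"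
      unfolding convo_def
    proof (rule integral_dominated_convergence)
      show "integrable lborel (\<lambda>y. C * (1 + R) * (norm (v y) / (1 + norm y)))"
        using assms(2) by (intro integrable_mult_right) (auto simp: admissible_def)
      show "AE y in lborel. norm (\<kappa> (X i - y) *\<^sub>R v y) \<le> C * (1 + R) * (norm (v y) / (1 + norm y))" for i
        by (intro AE_I2 decaying_shift C R)
      show "AE y in lborel. (\<lambda>i. \<kappa> (X i - y) *\<^sub>R v y) \<longlonglongrightarrow> \<kappa> (x - y) *\<^sub>R v y"
      proof (intro AE_I2 tendsto_scaleR tendsto_const)
        fix y
        have "isCont \<kappa> (x - y)" using C(3) by (simp add: continuous_on_eq_continuous_at)
        moreover have "(\<lambda>i. X i - y) \<longlonglongrightarrow> x - y" using X by (intro tendsto_intros)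
        ultimately show "(\<lambda>i. \<kappa> (X i - y)) \<longlonglongrightarrow> \<kappa> (x - y)"
          by (rule isCont_tendsto_compose)
      qed
    qed (rule measurable_convo_integrand[OF C(3) assms(2)])+
  qed
qed

lemma has_partials_shift: "has_partials \<kappa> D (x - y) \<Longrightarrow> has_partials (\<lambda>x. \<kappa> (x - y)) D x"
  unfolding has_partials_def
  by (rule has_derivative_compose[of "\<lambda>x. x - y" "\<lambda>h. h", simplified])
    (auto intro!: derivative_eq_intros)

lemma has_partials_reflect:
  fixes \<kappa> :: "real^3 \<Rightarrow> 'b::real_normed_vector"
  assumes "has_partials \<kappa> D (x - y)"
  shows "has_partials (\<lambda>y. \<kappa> (x - y)) (\<lambda>k. - D k) y"
proof -
  have "((\<lambda>y. x - y) has_derivative (\<lambda>h. - h)) (at y)"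
    by (auto intro!: derivative_eq_intros)
  from has_derivative_compose[OF this assms[unfolded has_partials_def]]
  show ?thesis by (simp add: has_partials_def)
qed

lemma has_partials_convo:
  fixes v :: "real^3 \<Rightarrow> 'b::{banach,second_countable_topology}"
  assumes D: "\<And>z. has_partials \<kappa> (\<lambda>k. \<kappa>' k z) z" and dec: "decaying \<kappa>" "\<And>k. decaying (\<kappa>' k)"
    and v: "admissible v"
  shows "has_partials (convo \<kappa> v) (\<lambda>k. convo (\<kappa>' k) v x) x"
proof -
  have "\<exists>C\<ge>0. \<forall>z. \<bar>\<kappa>' k z\<bar> \<le> C / (1 + norm z)" for k
    using dec(2)[of k] by (auto simp: decaying_def)
  then obtain C where C: "\<And>k. C k \<ge> 0" "\<And>k. \<forall>z. \<bar>\<kappa>' k z\<bar> \<le> C k / (1 + norm z)" by metis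
  \<comment> \<open>The parameter varies in the unit ball around \<open>x\<close>.\<close>
  define R where "R = norm x + 1"
  define w where "w y = (\<Sum>k\<in>UNIV. C k * (1 + R) * (norm (v y) / (1 + norm y)))" for y
  have "((\<lambda>x. LBINT y. \<kappa> (x - y) *\<^sub>R v y) has_derivative
     (\<lambda>h. LBINT y. (\<Sum>k\<in>UNIV. h $ k *\<^sub>R (\<kappa>' k (x - y) *\<^sub>R v y)))) (at x)"
  proof (rule has_derivative_integral[where U = "ball x 1" and w = w
        and f' = "\<lambda>x y h. \<Sum>k\<in>UNIV. h $ k *\<^sub>R (\<kappa>' k (x - y) *\<^sub>R v y)"])
    show "integrable lborel (\<lambda>y. \<kappa> (x' - y) *\<^sub>R v y)" for x'
      by (rule integrable_convo[OF dec(1) v])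
    show "((\<lambda>x. \<kappa> (x - y) *\<^sub>R v y) has_derivative (\<lambda>h. \<Sum>k\<in>UNIV. h $ k *\<^sub>R (\<kappa>' k (x' - y) *\<^sub>R v y))) (at x')"
      for x' y
      using has_partials_bounded_linear[OF bounded_linear_scaleR_left[of "v y"] has_partials_shift[OF D]]
      by (simp add: has_partials_def)
    show "norm (\<Sum>k\<in>UNIV. h $ k *\<^sub>R (\<kappa>' k (x' - y) *\<^sub>R v y)) \<le> w y * norm h"
      if "x' \<in> ball x 1" for x' y h
    proof -
      have "norm x' \<le> R"
        using that norm_triangle_ineq3[of x' x] by (simp add: R_def dist_norm norm_minus_commute)
      then have "norm (h $ k *\<^sub>R (\<kappa>' k (x' - y) *\<^sub>R v y)) \<le> norm h * (C k * (1 + R) * (norm (v y) / (1 + norm y)))" for k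
        unfolding norm_scaleR[of "h $ k"]
        using decaying_shift[OF C(2)[of k] C(1)[of k], of x' R y v]
        by (intro mult_mono component_le_norm_cart) auto
      then have "norm (\<Sum>k\<in>UNIV. h $ k *\<^sub>R (\<kappa>' k (x' - y) *\<^sub>R v y)) \<le> (\<Sum>k\<in>UNIV. norm h * (C k * (1 + R) * (norm (v y) / (1 + norm y))))"
        by (intro order_trans[OF norm_sum] sum_mono)
      then show ?thesis by (simp add: w_def sum_distrib_left mult.commute)
    qed
    show "integrable lborel w"
      unfolding w_def using v by (intro Bochner_Integration.integrable_sum integrable_mult_right) (auto simp: admissible_def)
    show "(\<lambda>y. \<Sum>k\<in>UNIV. h $ k *\<^sub>R (\<kappa>' k (x - y) *\<^sub>R v y)) \<in> borel_measurable lborel" for h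
      using measurable_convo_integrand[OF _ v] dec(2)
      by (intro borel_measurable_sum borel_measurable_scaleR[OF borel_measurable_const])
        (auto simp: decaying_def)
  qed auto
  moreover have "(LBINT y. (\<Sum>k\<in>UNIV. h $ k *\<^sub>R (\<kappa>' k (x - y) *\<^sub>R v y))) = (\<Sum>k\<in>UNIV. h $ k *\<^sub>R convo (\<kappa>' k) v x)" for h :: "real^3"
    unfolding convo_def
    by (subst Bochner_Integration.integral_sum)
      (auto intro!: integrable_convo[OF dec(2) v] simp del: scaleR_scaleR)
  ultimately show ?thesis by (simp add: has_partials_def convo_def[abs_def])
qed

section \<open>Limits of sequences of differentiable functions\<close>

lemma has_partials_uniform_limit:
  fixes f :: "nat \<Rightarrow> real^3 \<Rightarrow> 'b::banach"
  assumes S: "open S" "convex S"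
    and f: "\<And>m x. x \<in> S \<Longrightarrow> has_partials (f m) (\<lambda>k. f' m k x) x"
    and unif: "\<And>k. uniform_limit S (\<lambda>m. f' m k) (g' k) sequentially"
    and lim: "\<And>x. x \<in> S \<Longrightarrow> (\<lambda>m. f m x) \<longlonglongrightarrow> g x" and x: "x \<in> S"
  shows "has_partials g (\<lambda>k. g' k x) x"
proof -
  have "\<exists>G. \<forall>x\<in>S. (\<lambda>m. f m x) \<longlonglongrightarrow> G x \<and>
      (G has_derivative (\<lambda>h. \<Sum>k\<in>UNIV. h $ k *\<^sub>R g' k x)) (at x within S)"
  proof (rule has_derivative_sequence[where f = f and f' = "\<lambda>m x h. \<Sum>k\<in>UNIV. h $ k *\<^sub>R f' m k x"])
    show "convex S" "x \<in> S" "(\<lambda>m. f m x) \<longlonglongrightarrow> g x" by (fact S x lim[OF x])+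
    show "(f m has_derivative (\<lambda>h. \<Sum>k\<in>UNIV. h $ k *\<^sub>R f' m k x)) (at x within S)" if "x \<in> S" for m x
      using f[OF that] unfolding has_partials_def by (rule has_derivative_at_withinI)
    fix e :: real assume e: "e > 0"
    \<comment> \<open>An error \<open>e / 3\<close> in each of the three partials gives an error of
      at most \<open>e\<close> in the operator norm.\<close>
    have "\<forall>\<^sub>F m in sequentially. \<forall>x\<in>S. dist (f' m k x) (g' k x) < e / 3" for k
      using e by (intro uniform_limitD[OF unif]) simp
    then have "\<forall>\<^sub>F m in sequentially. \<forall>k. \<forall>x\<in>S. dist (f' m k x) (g' k x) < e / 3"
      by (rule eventually_all_finite)
    then show "\<forall>\<^sub>F m in sequentially. \<forall>x\<in>S. \<forall>h. norm ((\<Sum>k\<in>UNIV. h $ k *\<^sub>R f' m k x) -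
        (\<Sum>k\<in>UNIV. h $ k *\<^sub>R g' k x)) \<le> e * norm h"
    proof (eventually_elim, intro ballI allI)
      fix m x and h :: "real^3" assume *: "\<forall>k. \<forall>x\<in>S. dist (f' m k x) (g' k x) < e / 3" "x \<in> S"
      have "norm ((\<Sum>k\<in>UNIV. h $ k *\<^sub>R f' m k x) - (\<Sum>k\<in>UNIV. h $ k *\<^sub>R g' k x))
          = norm (\<Sum>k\<in>UNIV. h $ k *\<^sub>R (f' m k x - g' k x))"
        by (simp add: sum_subtractf scaleR_diff_right)
      also have "\<dots> \<le> (\<Sum>k\<in>(UNIV :: 3 set). norm h * (e / 3))"
      proof (intro order_trans[OF norm_sum] sum_mono)
        fix k
        have "norm (f' m k x - g' k x) \<le> e / 3" using * by (simp add: dist_norm less_imp_le)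
        then show "norm (h $ k *\<^sub>R (f' m k x - g' k x)) \<le> norm h * (e / 3)"
          unfolding norm_scaleR by (intro mult_mono) (auto simp: component_le_norm_cart)
      qed
      finally show "norm ((\<Sum>k\<in>UNIV. h $ k *\<^sub>R f' m k x) - (\<Sum>k\<in>UNIV. h $ k *\<^sub>R g' k x)) \<le> e * norm h"
        by (simp add: mult.commute)
    qed
  qed
  then obtain G where G: "\<And>x. x \<in> S \<Longrightarrow> (\<lambda>m. f m x) \<longlonglongrightarrow> G x"
     "\<And>x. x \<in> S \<Longrightarrow> (G has_derivative (\<lambda>h. \<Sum>k\<in>UNIV. h $ k *\<^sub>R g' k x)) (at x within S)" by blast
  have "has_partials G (\<lambda>k. g' k x) x"
    using G(2)[OF x] at_within_open[OF x S(1)] by (simp add: has_partials_def)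
  then show ?thesis
    by (rule has_partials_cong[OF _ S(1) x]) (use G(1) lim LIMSEQ_unique in blast)
qed

text \<open>The limit is the pointwise \<open>lim\<close>, so uniform limits obtained on different
  balls are restrictions of one globally defined function and need no gluing.\<close>

lemma uniform_limit_geometric:
  fixes f :: "nat \<Rightarrow> 'a \<Rightarrow> 'b::banach"
  assumes "\<And>m x. x \<in> A \<Longrightarrow> N \<le> m \<Longrightarrow> norm (f (Suc m) x - f m x) \<le> C * (1/2)^m"
  shows "uniform_limit A f (\<lambda>x. lim (\<lambda>m. f m x)) sequentially"
proof -
  have "uniform_limit A (\<lambda>n x. \<Sum>i<n. f (Suc i) x - f i x) (\<lambda>x. \<Sum>i. f (Suc i) x - f i x) sequentially"
  proof (rule Weierstrass_m_test_ev)
    show "\<forall>\<^sub>F m in sequentially. \<forall>x\<in>A. norm (f (Suc m) x - f m x) \<le> C * (1/2)^m"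
      using assms by (auto simp: eventually_sequentially)
    show "summable (\<lambda>m. C * (1/2)^m)" by (intro summable_mult summable_geometric) auto
  qed
  then have u: "uniform_limit A (\<lambda>n x. f 0 x + (\<Sum>i<n. f (Suc i) x - f i x))
      (\<lambda>x. f 0 x + (\<Sum>i. f (Suc i) x - f i x)) sequentially"
    by (intro uniform_limit_intros)
  moreover have "f 0 x + (\<Sum>i<n. f (Suc i) x - f i x) = f n x" for n x
    by (subst sum_lessThan_telescope) simp
  ultimately have u: "uniform_limit A f (\<lambda>x. f 0 x + (\<Sum>i. f (Suc i) x - f i x)) sequentially"
    by simp
  have "lim (\<lambda>m. f m x) = f 0 x + (\<Sum>i. f (Suc i) x - f i x)" if "x \<in> A" for x
    using tendsto_uniform_limitI[OF u that] by (rule limI)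
  then show ?thesis
    using u by (subst uniform_limit_cong') auto
qed

section \<open>The approximate identity that arises from the Laplacians of the kernels\<close>

lemma nn_integral_paraboloid:
  fixes x :: "real^3"
  assumes a: "a > 0"
  shows "(\<integral>\<^sup>+y. ennreal (max 0 (1 - (a * norm (x - y))\<^sup>2)) \<partial>lborel) = ennreal (8 * pi / 15 / a^3)"
proof -
  \<comment> \<open>Layer cake: \<open>1 - r\<^sup>2\<close> is the integral of \<open>2 u\<close>
    over r < u < 1. After exchanging the integrals only the volume \<open>4/3 pi (u / a)^3\<close>
    of a ball is needed, and the integral of \<open>8 pi / 3 / a^3 * u^4\<close> over [0, 1]
    remains.\<close>
  let ?f = "\<lambda>(y::real^3, u::real). ennreal (2 * u) * indicator {(y, u). a * norm (x - y) < u \<and> u < 1} (y, u)"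
  have inner: "(\<integral>\<^sup>+u. ?f (y, u) \<partial>lborel) = ennreal (max 0 (1 - (a * norm (x - y))\<^sup>2))" for y
  proof -
    let ?r = "a * norm (x - y)"
    have r: "?r \<ge> 0" using a by simp
    show ?thesis
    proof (cases "?r < 1")
      case True
      have "(\<integral>\<^sup>+u. ?f (y, u) \<partial>lborel) = (\<integral>\<^sup>+u. ennreal (2 * u) * indicator {?r<..<1} u \<partial>lborel)"
        by (intro nn_integral_cong) (auto simp: indicator_def)
      also have "\<dots> = (\<integral>\<^sup>+u. ennreal (2 * u) * indicator {?r..1} u \<partial>lborel)"
      proof (rule nn_integral_cong_AE)
        have "AE u in lborel. u \<noteq> ?r" "AE u in lborel. u \<noteq> (1::real)"
          by (rule AE_lborel_singleton)+
        then show "AE u in lborel. ennreal (2 * u) * indicator {?r<..<1} u = ennreal (2 * u) * indicator {?r..1} u"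
          by eventually_elim (auto simp: indicator_def)
      qed
      also have "\<dots> = ennreal (1\<^sup>2 - ?r\<^sup>2)"
        by (rule nn_integral_FTC_Icc[where F = "\<lambda>u. u\<^sup>2"])
          (use True r in \<open>auto intro!: derivative_eq_intros\<close>)
      finally show ?thesis using True r by (simp add: power_le_one max_def)
    next
      case False
      then have "?f (y, u) = 0" for u by (auto simp: indicator_def)
      then have "(\<integral>\<^sup>+u. ?f (y, u) \<partial>lborel) = (\<integral>\<^sup>+u. 0 \<partial>(lborel :: real measure))"
        by (intro nn_integral_cong)
      moreover have "1 - ?r\<^sup>2 \<le> 0" using False by (simp add: one_le_power)
      ultimately show ?thesis by (simp add: max_def)
    qed
  qed
  \<comment> \<open>At \<open>u = 1\<close> the left side is 0 because of the strict inequality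
    \<open>u < 1\<close>, but the right side is not; a single point is negligible.\<close>
  have outer: "(\<integral>\<^sup>+y. ?f (y, u) \<partial>lborel) = ennreal (8 * pi / 3 / a^3 * u^4) * indicator {0..1} u"
    if "u \<noteq> 1" for u
  proof (cases "0 < u \<and> u < 1")
    case True
    have "(\<integral>\<^sup>+y. ?f (y, u) \<partial>lborel) = (\<integral>\<^sup>+y. ennreal (2 * u) * indicator (ball x (u / a)) y \<partial>lborel)"
      using True a by (intro nn_integral_cong)
        (auto simp: indicator_def dist_norm field_simps)
    also have "\<dots> = ennreal (2 * u) * emeasure lborel (ball x (u / a))"
      by (rule nn_integral_cmult_indicator) auto
    also have "emeasure lborel (ball x (u / a)) = ennreal (4 / 3 * pi * (u / a)^3)"
      using True a by (subst emeasure_ball) (auto simp: unit_ball_vol_3)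
    also have "ennreal (2 * u) * \<dots> = ennreal (8 * pi / 3 / a^3 * u^4)"
    proof -
      have "ennreal (2 * u) * ennreal (4 / 3 * pi * (u / a)^3) = ennreal (2 * u * (4 / 3 * pi * (u / a)^3))"
        using True a by (intro ennreal_mult[symmetric]) auto
      also have "2 * u * (4 / 3 * pi * (u / a)^3) = 8 * pi / 3 / a^3 * u^4"
        by (simp add: power_divide numeral_eq_Suc mult_ac)
      finally show ?thesis .
    qed
    finally show ?thesis using True by simp
  next
    case False
    then have "?f (y, u) = 0" for y
    proof -
      have "\<not> (a * norm (x - y) < u \<and> u < 1)"
        using False a zero_le_mult_iff[of a "norm (x - y)"] by (smt (verit) norm_ge_zero)
      then show ?thesis by simp
    qed
    moreover have "ennreal (8 * pi / 3 / a^3 * u^4) * indicator {0..1} u = 0"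
      using False that by (cases "u = 0") (auto simp: indicator_def)
    moreover have "(\<integral>\<^sup>+y. ?f (y, u) \<partial>lborel) = (\<integral>\<^sup>+y. 0 \<partial>(lborel :: (real^3) measure))"
      by (intro nn_integral_cong) (rule calculation(1))
    ultimately show ?thesis by simp
  qed
  have meas: "?f \<in> borel_measurable (lborel \<Otimes>\<^sub>M lborel)"
  proof -
    have "open {p::(real^3) \<times> real. a * norm (x - fst p) < snd p \<and> snd p < 1}"
      by (intro open_Collect_conj open_Collect_less continuous_intros)
    then have "{p::(real^3) \<times> real. a * norm (x - fst p) < snd p \<and> snd p < 1} \<in> sets borel" by simp
    then have "{(y, u). a * norm (x - y) < u \<and> u < (1::real)} \<in> sets (lborel \<Otimes>\<^sub>M lborel)"
      by (subst lborel_prod) (simp add: case_prod_beta')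
    then show ?thesis by measurable
  qed
  have "(\<integral>\<^sup>+y. ennreal (max 0 (1 - (a * norm (x - y))\<^sup>2)) \<partial>lborel) = (\<integral>\<^sup>+y. \<integral>\<^sup>+u. ?f (y, u) \<partial>lborel \<partial>lborel)"
    by (simp only: inner)
  also have "\<dots> = (\<integral>\<^sup>+u. \<integral>\<^sup>+y. ?f (y, u) \<partial>lborel \<partial>lborel)"
    using lborel_pair.Fubini'[of "\<lambda>y u. ?f (y, u)"] meas by (simp add: split_beta')
  also have "\<dots> = (\<integral>\<^sup>+u. ennreal (8 * pi / 3 / a^3 * u^4) * indicator {0..1} u \<partial>lborel)"
  proof (rule nn_integral_cong_AE)
    have "AE u in lborel. u \<noteq> (1::real)" by (rule AE_lborel_singleton)
    then show "AE u in lborel. (\<integral>\<^sup>+y. ?f (y, u) \<partial>lborel) = ennreal (8 * pi / 3 / a^3 * u^4) * indicator {0..1} u"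
      by eventually_elim (rule outer)
  qed
  also have "\<dots> = ennreal (8 * pi / 15 / a^3 * 1^5 - 8 * pi / 15 / a^3 * 0^5)"
  proof -
    define q where "q = 8 * pi / 15 / a^3"
    have "8 * pi / 3 / a^3 = 5 * q" "q \<ge> 0" using a by (simp_all add: q_def)
    then show ?thesis
      unfolding q_def[symmetric]
      by (simp only:) (rule nn_integral_FTC_Icc[where F = "\<lambda>u. q * u^5"],
          auto intro!: derivative_eq_intros)
  qed
  finally show ?thesis by simp
qed

text \<open>By \<open>mollifier_eq\<close> this is minus the Laplacian of \<open>nker a\<close>. Its
  mass is 15/2 * 8 pi / 15 = 4 pi rather than 1, in accordance with the fact that the distributional
  Laplacian of 1/|z| is -4 pi times the Dirac measure at 0.\<close>

definition mollifier :: "real \<Rightarrow> real^3 \<Rightarrow> real" where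
  "mollifier a z = 15/2 * a^3 * max 0 (1 - (a * norm z)\<^sup>2)"

lemma mollifier_eq: "mollifier a z = - (\<Sum>k\<in>UNIV. nker2 a k k z)"
  by (simp add: sum_nker2 mollifier_def power_mult_distrib power2_norm_eq_inner)

lemma mollifier_nonneg: "a > 0 \<Longrightarrow> mollifier a z \<ge> 0"
  by (simp add: mollifier_def)

lemma mollifier_zero:
  assumes "a > 0" "1 / a < norm z" shows "mollifier a z = 0"
proof -
  have "1 < a * norm z" using assms by (simp add: divide_less_eq mult.commute)
  then have "1 \<le> (a * norm z)\<^sup>2" by (intro one_le_power) simp
  then show ?thesis by (simp add: mollifier_def max_def)
qed

lemma mollifier_integral:
  assumes "a > 0"
  shows "integrable lborel (\<lambda>y. mollifier a (x - y))" "(LBINT y. mollifier a (x - y)) = 4 * pi"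
proof -
  let ?g = "\<lambda>y. max 0 (1 - (a * norm (x - y))\<^sup>2)"
  have "has_bochner_integral lborel ?g (8 * pi / 15 / a^3)"
    by (rule has_bochner_integral_nn_integral[OF _ _ _ nn_integral_paraboloid[OF assms]])
      (use assms in auto)
  then have "has_bochner_integral lborel (\<lambda>y. 15/2 * a^3 * ?g y) (15/2 * a^3 * (8 * pi / 15 / a^3))"
    by (rule has_bochner_integral_mult_right)
  then have h: "has_bochner_integral lborel (\<lambda>y. mollifier a (x - y)) (4 * pi)"
    using assms by (simp add: mollifier_def)
  show "integrable lborel (\<lambda>y. mollifier a (x - y))" "(LBINT y. mollifier a (x - y)) = 4 * pi"
    using h by (auto simp: has_bochner_integral_iff)
qed

lemma norm_integral_le_ball:
  fixes g :: "real^3 \<Rightarrow> 'b::{banach,second_countable_topology}"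
  assumes "integrable lborel g" "\<And>y. norm (y - x) \<le> \<rho> \<Longrightarrow> norm (g y) \<le> B"
    "\<And>y. \<rho> < norm (y - x) \<Longrightarrow> g y = 0" "\<rho> > 0"
  shows "norm (LBINT y. g y) \<le> B * (\<rho>^3 * measure lborel (ball (0::real^3) 1))"
proof -
  have "norm (LBINT y. g y) \<le> (LBINT y. norm (g y))" by (rule integral_norm_bound)
  also have "\<dots> \<le> (LBINT y. B * indicator (cball x \<rho>) y)"
  proof (rule integral_mono)
    show "integrable lborel (\<lambda>y. B * indicator (cball x \<rho>) y)"
      using emeasure_lborel_cball_finite[of x \<rho>] by (intro integrable_mult_right integrable_real_indicator) auto
    show "norm (g y) \<le> B * indicator (cball x \<rho>) y" for y
      using assms(2,3)[of y] by (cases "norm (y - x) \<le> \<rho>") (auto simp: dist_norm norm_minus_commute[of x])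
  qed (use assms(1) in auto)
  also have "\<dots> = B * measure lborel (cball x \<rho>)" by simp
  also have "measure lborel (cball x \<rho>) = \<rho>^3 * measure lborel (ball (0::real^3) 1)"
    using assms(4) content_ball_conv_unit_ball[of \<rho> x] by (simp add: content_cball_conv_ball)
  finally show ?thesis .
qed

text \<open>The kernels are nonnegative, have constant mass and shrinking support, so only values of
  \<open>v\<close> near \<open>x\<close> matter.\<close>

lemma convo_mollifier_tendsto:
  fixes v :: "real^3 \<Rightarrow> 'b::{banach,second_countable_topology}"
  assumes v: "admissible v" and "isCont v x"
  shows "(\<lambda>m. convo (mollifier (2^m)) v x) \<longlonglongrightarrow> (4 * pi) *\<^sub>R v x"
proof (rule LIMSEQ_I)
  fix e :: real assume e: "e > 0"
  \<comment> \<open>Multiplied by the mass 4 pi this is \<open>e / 2\<close>, which makes the final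
    inequality strict.\<close>
  define e' where "e' = e / (8 * pi)"
  have e': "e' > 0" using e by (simp add: e'_def)
  obtain d where d: "d > 0" "\<And>y. norm (y - x) < d \<Longrightarrow> norm (v y - v x) < e'"
    using assms(2) e' unfolding continuous_at_eps_delta dist_norm by blast
  obtain N :: nat where N: "(1/2)^N < d" using d(1) real_arch_pow_inv[of d "1/2"] by auto
  show "\<exists>no. \<forall>n\<ge>no. norm (convo (mollifier (2 ^ n)) v x - (4 * pi) *\<^sub>R v x) < e"
  proof (intro exI allI impI)
    fix n assume n: "N \<le> n"
    define a :: real where "a = 2^n"
    have a: "a > 0" by (simp add: a_def)
    have "1 / a \<le> (1/2)^N"
      using n by (simp add: a_def power_one_over[symmetric] power_decreasing)
    then have ad: "1 / a < d" using N by simp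
    have dec: "decaying (mollifier a)"
    proof -
      have "mollifier a = (\<lambda>z. - (\<Sum>k\<in>UNIV. nker2 a k k z))" by (auto simp: mollifier_eq fun_eq_iff)
      moreover have "\<exists>c\<ge>0. \<forall>z. \<bar>nker2 a k k z\<bar> \<le> c / (1 + norm z)" for k
        using decaying_nker(3)[OF a, of k k] unfolding decaying_def by simp
      then obtain C where C: "\<And>k. C k \<ge> 0" "\<And>k z. \<bar>nker2 a k k z\<bar> \<le> C k / (1 + norm z)"
        by metis
      have "\<bar>- (\<Sum>k\<in>UNIV. nker2 a k k z)\<bar> \<le> (\<Sum>k\<in>UNIV. C k) / (1 + norm z)" for z
        unfolding abs_minus_cancel sum_divide_distrib
        using C(2) by (intro order_trans[OF sum_abs] sum_mono)
      ultimately show ?thesis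
        unfolding decaying_def using C(1)
        by (auto intro!: continuous_intros continuous_nker exI[of _ "\<Sum>k\<in>UNIV. C k"] sum_nonneg)
    qed
    note i1 = integrable_convo[OF dec v, of x] and i2 = mollifier_integral[OF a, of x]
    have i3: "integrable lborel (\<lambda>y. mollifier a (x - y) *\<^sub>R v x)" using i2(1) by simp
    have "convo (mollifier a) v x - (4 * pi) *\<^sub>R v x = (LBINT y. mollifier a (x - y) *\<^sub>R (v y - v x))"
      using i1 i3 i2 by (simp add: convo_def scaleR_diff_right)
    also have "norm \<dots> \<le> (LBINT y. norm (mollifier a (x - y) *\<^sub>R (v y - v x)))"
      by (rule integral_norm_bound)
    also have "\<dots> \<le> (LBINT y. mollifier a (x - y) * e')"
    proof (rule integral_mono)
      show "integrable lborel (\<lambda>y. norm (mollifier a (x - y) *\<^sub>R (v y - v x)))"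
        using i1 i3 by (intro integrable_norm) (simp add: scaleR_diff_right)
      show "integrable lborel (\<lambda>y. mollifier a (x - y) * e')" using i2(1) by simp
      show "norm (mollifier a (x - y) *\<^sub>R (v y - v x)) \<le> mollifier a (x - y) * e'" for y
      proof (cases "1 / a < norm (x - y)")
        case True
        then show ?thesis using mollifier_zero[OF a] by simp
      next
        case False
        then have "norm (v y - v x) \<le> e'"
          using d(2)[of y] ad by (simp add: norm_minus_commute)
        then show ?thesis using mollifier_nonneg[OF a] by (simp add: mult_left_mono)
      qed
    qed
    also have "\<dots> = e / 2" using i2(2) by (simp add: e'_def)
    also have "\<dots> < e" using e by simp
    finally show "norm (convo (mollifier (2 ^ n)) v x - (4 * pi) *\<^sub>R v x) < e" by (simp add: a_def)
  qed
qed

text \<open>Beyond radius \<open>1 / a\<close> both kernels are 1/|z|. Hence their difference has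
  compact support, although neither of them does. The minus signs come from differentiating in
  \<open>y\<close> a function of \<open>x - y\<close>.\<close>

lemma test_fun_nker_diff:
  assumes "a > 0"
  shows "test_fun (\<lambda>y. nker (2 * a) (x - y) - nker a (x - y))
      (\<lambda>k y. - (nker1 (2 * a) k (x - y) - nker1 a k (x - y))) x (1 / a)" (is "test_fun ?u ?u' _ _")
    and "test_fun (\<lambda>y. nker1 (2 * a) i (x - y) - nker1 a i (x - y))
      (\<lambda>k y. - (nker2 (2 * a) k i (x - y) - nker2 a k i (x - y))) x (1 / a)" (is "test_fun ?w ?w' _ _")
proof -
  have c: "continuous_on UNIV (\<lambda>y. g (x - y))" if "continuous_on UNIV g" for g :: "real^3 \<Rightarrow> real"
    by (rule continuous_on_compose2[OF that]) (auto intro!: continuous_intros)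
  note cs = continuous_nker[THEN c]
  show 0: "test_fun ?u ?u' x (1 / a)"
    unfolding test_fun_def
  proof (intro conjI allI impI)
    show "has_partials ?u (\<lambda>k. ?u' k y) y" for y
      using has_partials_reflect[OF has_partials_diff[OF has_partials_nker has_partials_nker]] .
    show "continuous_on UNIV (?u' k)" for k
      by (intro continuous_intros cs)
    show "nker (2 * a) (x - y) - nker a (x - y) = 0" if "1 / a < norm (y - x)" for y
    proof -
      have "1 / (2 * a) < 1 / a" using assms by (simp add: field_simps)
      then show ?thesis using that assms nker_far[of a "x - y"] nker_far[of "2 * a" "x - y"]
        by (simp add: norm_minus_commute)
    qed
  qed
  show "test_fun ?w ?w' x (1 / a)"
    unfolding test_fun_def
  proof (intro conjI allI impI)
    show "has_partials ?w (\<lambda>k. ?w' k y) y" for y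
      using has_partials_reflect[OF has_partials_diff[OF has_partials_nker1 has_partials_nker1]] .
    show "continuous_on UNIV (?w' k)" for k
      by (intro continuous_intros cs)
    show "nker1 (2 * a) i (x - y) - nker1 a i (x - y) = 0" if "1 / a < norm (y - x)" for y
      using test_fun_partial_zero[OF 0 that, of i] by simp
  qed
qed

section \<open>The Newtonian potential\<close>

text \<open>Successive regularizations differ only on a ball of radius \<open>1 / a\<close>, whose volume beats the
  size \<open>a\<^sup>2\<close> of the kernel; the second derivative is reduced to the first by integrating by parts.\<close>

lemma convo_increments:
  fixes V :: "real^3 \<Rightarrow> 'b::euclidean_space"
  assumes S: "open S" "cball x (1 / a) \<subseteq> S" and a: "a > 0" and V: "C1_on S V"
    and v_def: "v = (\<lambda>y. indicator S y *\<^sub>R V y)" and v: "admissible v"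
    and M: "\<And>y. y \<in> cball x (1 / a) \<Longrightarrow> norm (V y) \<le> M" "\<And>y k. y \<in> cball x (1 / a) \<Longrightarrow> norm (pdiff k V y) \<le> M"
  shows "norm (convo (nker1 (2 * a) i) v x - convo (nker1 a i) v x)
      \<le> 25 * M * measure lborel (ball (0::real^3) 1) * (1 / a)"
    and "norm (convo (nker2 (2 * a) j i) v x - convo (nker2 a j i) v x)
      \<le> 25 * M * measure lborel (ball (0::real^3) 1) * (1 / a)"
proof -
  let ?B = "25 * M * measure lborel (ball (0::real^3) 1) * (1 / a)"
  let ?d1 = "\<lambda>i z. nker1 (2 * a) i z - nker1 a i z" and ?d2 = "\<lambda>j i z. nker2 (2 * a) j i z - nker2 a j i z"
  note t1 = test_fun_nker_diff(2)[OF a, where x = x]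
  note ibp = integral_by_parts_test_fun[OF S t1 V]
  have S': "y \<in> S" if "norm (y - x) \<le> 1 / a" for y
    using S(2) that by (auto simp: subset_iff dist_norm norm_minus_commute)
  \<comment> \<open>The two kernels contribute \<open>5 a\<^sup>2\<close> and
    \<open>5 (2 a)\<^sup>2\<close>, together \<open>25 a\<^sup>2\<close>.\<close>
  have d1: "\<bar>?d1 i z\<bar> \<le> 25 * a\<^sup>2" for i z
  proof -
    have *: "\<bar>nker1 b i z\<bar> \<le> 5 * b\<^sup>2" if "b > 0" for b
    proof -
      have "5 * b\<^sup>2 / (1 + b * norm z) \<le> 5 * b\<^sup>2 / 1"
        using that by (intro divide_left_mono) (auto intro: add_pos_nonneg)
      then show ?thesis using nker_bounds(2)[OF that, of i z] by simp
    qed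
    show ?thesis using *[of a] *[of "2 * a"] a by (simp add: power2_eq_square)
  qed
  have est: "norm (LBINT y. ?d1 i (x - y) *\<^sub>R w y) \<le> ?B"
    if "\<And>y. y \<in> cball x (1 / a) \<Longrightarrow> norm (w y) \<le> M" "integrable lborel (\<lambda>y. ?d1 i (x - y) *\<^sub>R w y)"
    for i and w :: "real^3 \<Rightarrow> 'b"
  proof -
    have "norm (LBINT y. ?d1 i (x - y) *\<^sub>R w y) \<le> (25 * a\<^sup>2 * M) * ((1 / a)^3 * measure lborel (ball (0::real^3) 1))"
    proof (rule norm_integral_le_ball[OF that(2), where x = x])
      show "norm (?d1 i (x - y) *\<^sub>R w y) \<le> 25 * a\<^sup>2 * M" if "norm (y - x) \<le> 1 / a" for y
        unfolding norm_scaleR real_norm_def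
        using d1[of i "x - y"] \<open>\<And>y. y \<in> cball x (1 / a) \<Longrightarrow> norm (w y) \<le> M\<close>[of y] that
        by (intro mult_mono) (auto simp: dist_norm norm_minus_commute)
      show "?d1 i (x - y) *\<^sub>R w y = 0" if "1 / a < norm (y - x)" for y
        using test_fun_zero[OF t1 that, of i] by simp
    qed (use a in auto)
    also have "\<dots> = ?B"
      using a by (simp add: power2_eq_square power3_eq_cube)
    finally show ?thesis .
  qed
  have "convo (nker1 (2 * a) i) v x - convo (nker1 a i) v x = (LBINT y. ?d1 i (x - y) *\<^sub>R v y)"
    unfolding convo_def scaleR_diff_left
    using a integrable_convo[OF decaying_nker(2) v] by (subst Bochner_Integration.integral_diff) auto
  also have "norm \<dots> \<le> ?B"
  proof (rule est)
    have "integrable lborel (\<lambda>y. nker1 (2 * a) i (x - y) *\<^sub>R v y - nker1 a i (x - y) *\<^sub>R v y)"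
      using a integrable_convo[OF decaying_nker(2) v] by (intro Bochner_Integration.integrable_diff) auto
    then show "integrable lborel (\<lambda>y. ?d1 i (x - y) *\<^sub>R v y)" unfolding scaleR_diff_left .
    show "norm (v y) \<le> M" if "y \<in> cball x (1 / a)" for y
      using M(1)[OF that] by (auto simp: v_def indicator_def intro: order_trans[OF norm_ge_zero])
  qed
  finally show "norm (convo (nker1 (2 * a) i) v x - convo (nker1 a i) v x)
      \<le> ?B" .
  have "convo (nker2 (2 * a) j i) v x - convo (nker2 a j i) v x = (LBINT y. ?d2 j i (x - y) *\<^sub>R v y)"
    unfolding convo_def scaleR_diff_left
    using a integrable_convo[OF decaying_nker(3) v] by (subst Bochner_Integration.integral_diff) auto
  \<comment> \<open>On the support of the kernel difference, which lies in \<open>S\<close>, the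
    field \<open>v\<close> equals \<open>V\<close>. Only \<open>V\<close> can be integrated by
    parts, as \<open>v\<close> may jump at the boundary of \<open>S\<close>.\<close>
  also have "\<dots> = - (LBINT y. (- ?d2 j i (x - y)) *\<^sub>R V y)"
  proof -
    have "?d2 j i (x - y) *\<^sub>R v y = - ((- ?d2 j i (x - y)) *\<^sub>R V y)" for y
    proof (cases "norm (y - x) \<le> 1 / a")
      case True
      then show ?thesis using S' by (simp add: v_def scaleR_diff_left)
    next
      case False
      then have "- ?d2 j i (x - y) = 0" using test_fun_partial_zero[OF t1] by (simp add: not_le)
      then show ?thesis by (simp only:) simp
    qed
    then show ?thesis by simp
  qed
  also have "\<dots> = (LBINT y. ?d1 i (x - y) *\<^sub>R pdiff j V y)"
    by (rule ibp(3)[symmetric])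
  also have "norm \<dots> \<le> ?B"
    by (rule est[OF M(2) ibp(1)])
  finally show "norm (convo (nker2 (2 * a) j i) v x - convo (nker2 a j i) v x)
      \<le> ?B" .
qed


text \<open>For fixed \<open>y\<close> other than \<open>x\<close> the regularized kernel is
  eventually equal to the singular one, and \<open>4 a / (1 + a |z|) \<le> 4 / |z|\<close> supplies
  the dominating function.\<close>

lemma convo_nker_tendsto:
  fixes v :: "real^3 \<Rightarrow> 'b::{banach,second_countable_topology}"
  assumes v: "admissible v" and int: "integrable lborel (\<lambda>y. (1 / norm (x - y)) *\<^sub>R v y)"
  shows "(\<lambda>m. convo (nker (2^m)) v x) \<longlonglongrightarrow> (LBINT y. (1 / norm (x - y)) *\<^sub>R v y)"
  unfolding convo_def
proof (rule integral_dominated_convergence)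
  show "integrable lborel (\<lambda>y. 4 * norm ((1 / norm (x - y)) *\<^sub>R v y))"
    by (intro integrable_mult_right integrable_norm int)
  show "AE y in lborel. (\<lambda>m. nker (2 ^ m) (x - y) *\<^sub>R v y) \<longlonglongrightarrow> (1 / norm (x - y)) *\<^sub>R v y"
    using AE_lborel_singleton[of x]
  proof eventually_elim
    case (elim y)
    then have "norm (x - y) > 0" by simp
    then obtain N :: nat where N: "(1/2)^N < norm (x - y)"
      using real_arch_pow_inv[of "norm (x - y)" "1/2"] by auto
    have "nker (2 ^ m) (x - y) = 1 / norm (x - y)" if "m \<ge> N" for m
    proof (rule nker_far)
      have "1 / 2 ^ m \<le> (1/2 :: real)^N"
        using that by (simp add: power_one_over[symmetric] power_decreasing)
      then show "1 / 2 ^ m < norm (x - y)" using N by simp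
    qed simp
    then show ?case
      by (intro tendsto_scaleR tendsto_const tendsto_eventually) (auto simp: eventually_sequentially)
  qed
  show "AE y in lborel. norm (nker (2 ^ m) (x - y) *\<^sub>R v y) \<le> 4 * norm ((1 / norm (x - y)) *\<^sub>R v y)" for m
    using AE_lborel_singleton[of x]
  proof eventually_elim
    case (elim y)
    then have n: "norm (x - y) > 0" by simp
    define a :: real where "a = 2 ^ m"
    have a: "a > 0" by (simp add: a_def)
    have "4 * a / (1 + a * norm (x - y)) \<le> 4 * a / (a * norm (x - y))"
      using a n by (intro divide_left_mono) (auto intro!: mult_pos_pos add_pos_pos)
    then have "\<bar>nker a (x - y)\<bar> \<le> 4 * (1 / norm (x - y))"
      using nker_bounds(1)[OF a, of "x - y"] a by simp
    then have "\<bar>nker a (x - y)\<bar> * norm (v y) \<le> 4 * (1 / norm (x - y)) * norm (v y)"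
      by (intro mult_right_mono) auto
    then show ?case by (simp add: a_def)
  qed
qed (use measurable_convo_integrand[OF continuous_nker(1) v] int in auto)

text \<open>The last conclusion exposes the second partials as limits of the regularized ones, so
  that linear identities among the latter, such as vanishing divergence, pass to the potential
  itself.\<close>

lemma newton_potential_C2:
  fixes V :: "real^3 \<Rightarrow> 'b::euclidean_space"
  assumes S: "open S" and V: "C1_on S V" and v_def: "v = (\<lambda>y. indicator S y *\<^sub>R V y)" and v: "admissible v"
    and int: "\<And>x. x \<in> S \<Longrightarrow> integrable lborel (\<lambda>y. (1 / norm (x - y)) *\<^sub>R v y)"
  obtains D DD where
    "\<And>x. x \<in> S \<Longrightarrow> has_partials (\<lambda>x. LBINT y. (1 / norm (x - y)) *\<^sub>R v y) (\<lambda>k. D k x) x"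
    "\<And>x j. x \<in> S \<Longrightarrow> has_partials (D j) (\<lambda>k. DD k j x) x"
    "\<And>k j. continuous_on S (DD k j)"
    "\<And>k j. DD k j = DD j k"
    "\<And>x. x \<in> S \<Longrightarrow> (\<Sum>k\<in>UNIV. DD k k x) = - ((4 * pi) *\<^sub>R V x)"
    "\<And>x k j. x \<in> S \<Longrightarrow> (\<lambda>m. convo (nker2 (2^m) k j) v x) \<longlonglongrightarrow> DD k j x"
proof -
  define P where "P x = (LBINT y. (1 / norm (x - y)) *\<^sub>R v y)" for x
  define D where "D k x = lim (\<lambda>m. convo (nker1 (2^m) k) v x)" for k x
  define DD where "DD k j x = lim (\<lambda>m. convo (nker2 (2^m) k j) v x)" for k j x
  have pos: "(2::real)^m > 0" for m :: nat by simp
  let ?u1 = "\<lambda>A k. uniform_limit A (\<lambda>m. convo (nker1 (2^m) k) v) (D k) sequentially"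
  let ?u2 = "\<lambda>A k j. uniform_limit A (\<lambda>m. convo (nker2 (2^m) k j) v) (DD k j) sequentially"
  \<comment> \<open>The increments become geometric only once \<open>2\<^sup>-\<^sup>m\<close> is
    small compared with the distance to the boundary, so uniform convergence is claimed
    locally.\<close>
  have loc: "\<exists>r>0. ball x0 r \<subseteq> S \<and> (\<forall>k. ?u1 (ball x0 r) k) \<and>
      (\<forall>k j. ?u2 (ball x0 r) k j)"
    if x0: "x0 \<in> S" for x0
  proof -
    obtain r' where r': "r' > 0" "cball x0 r' \<subseteq> S" using S x0 open_contains_cball by blast
    \<comment> \<open>Half the radius leaves room: for \<open>2\<^sup>-\<^sup>m < r\<close> the ball
      of radius \<open>2\<^sup>-\<^sup>m\<close> around any point of \<open>ball x0 r\<close> stays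
      inside \<open>cball x0 (2 * r)\<close>, where the bounds on \<open>V\<close> hold.\<close>
    define r where "r = r' / 2"
    have r: "r > 0" "cball x0 (2 * r) \<subseteq> S" using r' by (auto simp: r_def)
    let ?K = "cball x0 (2 * r)"
    have "\<exists>M. \<forall>y\<in>?K. norm (V y) \<le> M"
      using compact_imp_bounded[OF compact_continuous_image[OF continuous_on_subset[OF C1_on_continuous_on[OF V] r(2)] compact_cball]]
      by (auto simp: bounded_iff)
    then obtain M0 where M0: "\<And>y. y \<in> ?K \<Longrightarrow> norm (V y) \<le> M0" by blast
    have "\<exists>M. \<forall>y\<in>?K. norm (pdiff k V y) \<le> M" for k
      using compact_imp_bounded[OF compact_continuous_image[OF continuous_on_subset[OF C1_on_continuous_pdiff[OF V] r(2)] compact_cball]]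
      by (auto simp: bounded_iff)
    then obtain M1 where M1: "\<And>y k. y \<in> ?K \<Longrightarrow> norm (pdiff k V y) \<le> M1 k" by metis
    define M where "M = \<bar>M0\<bar> + (\<Sum>k\<in>UNIV. \<bar>M1 k\<bar>)"
    have M1s: "M1 k \<le> (\<Sum>k\<in>UNIV. \<bar>M1 k\<bar>)" for k
      using member_le_sum[of k UNIV "\<lambda>k. \<bar>M1 k\<bar>"] by auto
    have M: "norm (V y) \<le> M" "norm (pdiff k V y) \<le> M" if "y \<in> ?K" for y k
      using M0[OF that] M1[OF that, of k] M1s[of k] sum_nonneg[of UNIV "\<lambda>k. \<bar>M1 k\<bar>", OF abs_ge_zero]
      unfolding M_def by linarith+
    obtain N :: nat where N: "(1/2)^N < r" using r(1) real_arch_pow_inv[of r "1/2"] by auto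
    have sub: "cball x (1 / 2^m) \<subseteq> ?K" if "x \<in> ball x0 r" "N \<le> m" for x m
    proof -
      have "1 / 2 ^ m \<le> (1/2 :: real)^N"
        using that(2) by (simp add: power_one_over[symmetric] power_decreasing)
      then have "1 / 2 ^ m < r" using N by linarith
      moreover have "dist x0 z \<le> dist x0 x + dist x z" for z by (rule dist_triangle)
      ultimately show ?thesis using that(1) unfolding subset_iff mem_cball mem_ball by (smt (verit))
    qed
    let ?C = "25 * M * measure lborel (ball (0::real^3) 1)"
    have inc: "norm (convo (nker1 (2^Suc m) k) v x - convo (nker1 (2^m) k) v x) \<le> ?C * (1/2)^m"
      "norm (convo (nker2 (2^Suc m) k j) v x - convo (nker2 (2^m) k j) v x) \<le> ?C * (1/2)^m"
      if "x \<in> ball x0 r" "N \<le> m" for x m k j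
      using convo_increments[OF S subset_trans[OF sub[OF that] r(2)] pos V v_def v M[OF subsetD[OF sub[OF that]]]]
      unfolding power_Suc power_one_over by auto
    have "?u1 (ball x0 r) k" for k
      unfolding D_def[abs_def] by (rule uniform_limit_geometric[OF inc(1)])
    moreover have "?u2 (ball x0 r) k j" for k j
      unfolding DD_def[abs_def] by (rule uniform_limit_geometric[OF inc(2)])
    moreover have "ball x0 r \<subseteq> S" using r by (auto simp: subset_iff)
    ultimately show ?thesis using r(1) by blast
  qed
  show ?thesis
  proof (rule that[of D DD])
    show "has_partials (\<lambda>x. LBINT y. (1 / norm (x - y)) *\<^sub>R v y) (\<lambda>k. D k x) x" if x: "x \<in> S" for x
    proof -
      obtain r where r: "r > 0" "ball x r \<subseteq> S" "\<And>k. ?u1 (ball x r) k"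
        using loc[OF x] by blast
      show ?thesis
      proof (rule has_partials_uniform_limit[OF _ _ _ r(3)])
        show "has_partials (convo (nker (2^m)) v) (\<lambda>k. convo (nker1 (2^m) k) v y) y" for m y
          by (rule has_partials_convo[OF has_partials_nker decaying_nker(1)[OF pos] decaying_nker(2)[OF pos] v])
        show "(\<lambda>m. convo (nker (2^m)) v y) \<longlonglongrightarrow> (LBINT z. (1 / norm (y - z)) *\<^sub>R v z)" if "y \<in> ball x r" for y
          using r(2) that by (intro convo_nker_tendsto[OF v] int) auto
      qed (use r(1) in auto)
    qed
    show "has_partials (D j) (\<lambda>k. DD k j x) x" if x: "x \<in> S" for x j
    proof -
      obtain r where r: "r > 0" "\<And>k. ?u1 (ball x r) k"
        "\<And>k j. ?u2 (ball x r) k j"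
        using loc[OF x] by blast
      show ?thesis
      proof (rule has_partials_uniform_limit[OF _ _ _ r(3)])
        show "has_partials (convo (nker1 (2^m) j) v) (\<lambda>k. convo (nker2 (2^m) k j) v y) y" for m y
          by (rule has_partials_convo[OF has_partials_nker1 decaying_nker(2)[OF pos] decaying_nker(3)[OF pos] v])
        show "(\<lambda>m. convo (nker1 (2^m) j) v y) \<longlonglongrightarrow> D j y" if "y \<in> ball x r" for y
          by (rule tendsto_uniform_limitI[OF r(2) that])
      qed (use r(1) in auto)
    qed
    show "continuous_on S (DD k j)" for k j
    proof (intro continuous_at_imp_continuous_on ballI)
      fix x assume "x \<in> S"
      then obtain r where r: "r > 0" "?u2 (ball x r) k j"
        using loc by blast
      have "continuous_on (ball x r) (DD k j)"
      proof (rule uniform_limit_theorem[OF _ r(2)])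
        show "\<forall>\<^sub>F m in sequentially. continuous_on (ball x r) (convo (nker2 (2 ^ m) k j) v)"
          by (intro always_eventually allI continuous_at_imp_continuous_on ballI
              isCont_convo[OF decaying_nker(3)[OF pos] v])
      qed simp
      then show "isCont (DD k j) x" using r(1) by (simp add: continuous_on_eq_continuous_at)
    qed
    show "DD k j = DD j k" for k j
      unfolding DD_def[abs_def] nker2_commute[of _ k j] ..
    show lim: "(\<lambda>m. convo (nker2 (2^m) k j) v x) \<longlonglongrightarrow> DD k j x" if x: "x \<in> S" for x k j
    proof -
      obtain r where r: "r > 0" "?u2 (ball x r) k j"
        using loc[OF x] by blast
      then show ?thesis using tendsto_uniform_limitI[OF r(2), of x] by simp
    qed
    \<comment> \<open>The trace of the regularized second partials is minus the convolution with the
      mollifier, which tends to 4 pi times \<open>V x\<close>.\<close>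
    show "(\<Sum>k\<in>UNIV. DD k k x) = - ((4 * pi) *\<^sub>R V x)" if x: "x \<in> S" for x
    proof -
      have "convo (mollifier (2^m)) v x = - (\<Sum>k\<in>UNIV. convo (nker2 (2^m) k k) v x)" for m
        unfolding convo_def mollifier_eq
        by (subst Bochner_Integration.integral_sum[symmetric])
          (auto simp: scaleR_sum_left intro!: integrable_convo[OF decaying_nker(3)[OF pos] v])
      moreover have "(\<lambda>m. - (\<Sum>k\<in>UNIV. convo (nker2 (2^m) k k) v x)) \<longlonglongrightarrow> - (\<Sum>k\<in>UNIV. DD k k x)"
        by (intro tendsto_intros lim x)
      moreover have "(\<lambda>m. convo (mollifier (2^m)) v x) \<longlonglongrightarrow> (4 * pi) *\<^sub>R v x"
      proof (rule convo_mollifier_tendsto[OF v])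
        have "isCont V x" using C1_on_continuous_on[OF V] S x by (simp add: continuous_on_eq_continuous_at)
        moreover have "\<forall>\<^sub>F y in nhds x. v y = V y"
          using eventually_nhds_in_open[OF S x] by eventually_elim (simp add: v_def)
        ultimately show "isCont v x" using isCont_cong by blast
      qed
      ultimately have "- (\<Sum>k\<in>UNIV. DD k k x) = (4 * pi) *\<^sub>R v x"
        using LIMSEQ_unique by simp
      then show ?thesis using x by (simp add: v_def) (metis add.inverse_inverse)
    qed
  qed
qed

text \<open>The kernel \<open>nker a - nker b\<close> is a test function; letting \<open>b\<close> tend to \<open>0\<close> removes the second
  term.\<close>

lemma convo_divergence_free:
  fixes V :: "real^3 \<Rightarrow> complex^3"
  assumes S: "open S" and v_def: "v = (\<lambda>y. indicator S y *\<^sub>R V y)" and v: "admissible v" and z: "zero_ext_div_free S V" and a: "a > 0"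
  shows "(\<Sum>k\<in>UNIV. convo (nker1 a k) v x $ k) = 0"
proof -
  define W where "W = (LBINT y. norm (v y) / (1 + norm y))"
  let ?G = "\<lambda>b. \<Sum>k\<in>UNIV. convo (nker1 b k) v x $ k"
  have int: "integrable lborel (\<lambda>y. nker1 b k (x - y) *\<^sub>R v y $ k)" if "b > 0" for b k
    using integrable_bounded_linear[OF bounded_linear_vec_nth integrable_convo[OF decaying_nker(2)[OF that] v]]
    by simp
  have nth: "convo (nker1 b k) v x $ k = (LBINT y. nker1 b k (x - y) *\<^sub>R v y $ k)" if "b > 0" for b k
    unfolding convo_def
    using integral_bounded_linear[OF bounded_linear_vec_nth integrable_convo[OF decaying_nker(2)[OF that] v], of k]
    by simp
  have eq: "?G a = ?G b" if b: "b > 0" for b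
  proof -
    define \<phi> where "\<phi> y = nker a (x - y) - nker b (x - y)" for y
    have \<phi>: "has_partials \<phi> (\<lambda>k. - (nker1 a k (x - y) - nker1 b k (x - y))) y" for y
      unfolding \<phi>_def using has_partials_reflect[OF has_partials_diff[OF has_partials_nker has_partials_nker]] .
    have "C1_on UNIV \<phi>"
    proof (rule C1_onI[OF \<phi>])
      have "continuous_on UNIV (\<lambda>y. nker1 c k (x - y))" for c k
        by (rule continuous_on_compose2[OF continuous_nker(2)]) (auto intro!: continuous_intros)
      then show "continuous_on UNIV (\<lambda>y. - (nker1 a k (x - y) - nker1 b k (x - y)))" for k
        by (intro continuous_intros)
    qed
    moreover have "\<exists>R. \<forall>y. norm y > R \<longrightarrow> \<phi> y = 0"
    proof (intro exI allI impI)
      fix y :: "real^3" assume y: "norm x + 1 / a + 1 / b < norm y"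
      have "norm y \<le> norm x + norm (x - y)" using norm_triangle_ineq4[of x "x - y"] by simp
      moreover have "1 / a > 0" "1 / b > 0" using a b by auto
      ultimately have "1 / a < norm (x - y)" "1 / b < norm (x - y)" using y by linarith+
      then show "\<phi> y = 0" using a b by (simp add: \<phi>_def nker_far)
    qed
    ultimately have "(LINT y:S|lborel. (\<Sum>k\<in>UNIV. pdiff k \<phi> y *\<^sub>R (V y $ k))) = 0"
      using z unfolding zero_ext_div_free_def by blast
    then have "(LBINT y. (\<Sum>k\<in>UNIV. nker1 b k (x - y) *\<^sub>R v y $ k - nker1 a k (x - y) *\<^sub>R v y $ k)) = 0"
      unfolding set_lebesgue_integral_def has_partials_pdiff[OF \<phi>]
      by (simp add: v_def scaleR_sum_right algebra_simps)
    then show ?thesis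
      using int[OF a] int[OF b] nth[OF a] nth[OF b]
      by (simp add: Bochner_Integration.integral_sum sum_subtractf)
  qed
  have le: "norm (?G a) \<le> b * (15 * (1 + norm x) * W)" if b: "0 < b" "b \<le> 1" for b
  proof -
    have k: "norm (convo (nker1 b k) v x $ k) \<le> 5 * b * (1 + norm x) * W" for k
    proof -
      have nb: "\<bar>nker1 b k z\<bar> \<le> 5 * b / (1 + norm z)" for z
      proof -
        \<comment> \<open>Replacing the scaled weight by \<open>1 + norm z\<close> costs
          \<open>1 / b\<close>; the remaining power of \<open>b\<close> forces the divergence to
          0.\<close>
        have "5 * b\<^sup>2 * max 1 (1 / b) = 5 * b" using b by (simp add: max_def power2_eq_square)
        then have "5 * b\<^sup>2 / (1 + b * norm z) \<le> 5 * b / (1 + norm z)"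
          using decay_rescale[OF b(1), of "5 * b\<^sup>2" z] by (metis zero_le_power2 zero_le_mult_iff zero_le_numeral)
        then show ?thesis using nker_bounds(2)[OF b(1), of k z] by linarith
      qed
      have "norm (convo (nker1 b k) v x) \<le> (LBINT y. norm (nker1 b k (x - y) *\<^sub>R v y))"
        unfolding convo_def by (rule integral_norm_bound)
      also have "\<dots> \<le> (LBINT y. 5 * b * (1 + norm x) * (norm (v y) / (1 + norm y)))"
      proof (rule integral_mono)
        show "integrable lborel (\<lambda>y. norm (nker1 b k (x - y) *\<^sub>R v y))"
          by (intro integrable_norm integrable_convo[OF decaying_nker(2)[OF b(1)] v])
        show "integrable lborel (\<lambda>y. 5 * b * (1 + norm x) * (norm (v y) / (1 + norm y)))"
          using v by (intro integrable_mult_right) (auto simp: admissible_def)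
        show "norm (nker1 b k (x - y) *\<^sub>R v y) \<le> 5 * b * (1 + norm x) * (norm (v y) / (1 + norm y))" for y
          using decaying_shift[of "nker1 b k" "5 * b" x "norm x" y v] nb b by auto
      qed
      also have "\<dots> = 5 * b * (1 + norm x) * W" unfolding W_def by (rule integral_mult_right_zero)
      finally show ?thesis using Finite_Cartesian_Product.norm_nth_le[of "convo (nker1 b k) v x" k] by linarith
    qed
    have "norm (?G b) \<le> (\<Sum>k\<in>(UNIV::3 set). 5 * b * (1 + norm x) * W)"
      by (intro order_trans[OF norm_sum] sum_mono k)
    then show ?thesis using eq[OF b(1)] by (simp add: mult_ac)
  qed
  have "norm (?G a) \<le> 0"
  proof (rule tendsto_lowerbound)
    show "((\<lambda>b. b * (15 * (1 + norm x) * W)) \<longlongrightarrow> 0) (at_right 0)"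
      by (rule tendsto_eq_intros tendsto_mult_left_zero | simp)+
    show "\<forall>\<^sub>F b in at_right 0. norm (?G a) \<le> b * (15 * (1 + norm x) * W)"
      unfolding eventually_at_right_field using le by (intro exI[of _ 1]) auto
  qed simp
  then show ?thesis by simp
qed

section \<open>Potentials of curl free fields\<close>

lemma scalar_potential_iff: "scalar_potential S \<Psi> \<phi> \<longleftrightarrow> (\<forall>x\<in>S. has_partials \<phi> (\<lambda>k. \<Psi> x $ k) x)"
proof -
  have "has_partials \<phi> (\<lambda>k. \<Psi> x $ k) x \<longleftrightarrow> \<phi> differentiable (at x) \<and> grad \<phi> x = \<Psi> x" for x
  proof
    assume "has_partials \<phi> (\<lambda>k. \<Psi> x $ k) x"
    then show "\<phi> differentiable (at x) \<and> grad \<phi> x = \<Psi> x"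
      using has_partials_pdiff[of \<phi> "\<lambda>k. \<Psi> x $ k" x] has_partials_differentiable
      by (auto simp: grad_def vec_eq_iff)
  next
    assume *: "\<phi> differentiable (at x) \<and> grad \<phi> x = \<Psi> x"
    then have "has_partials \<phi> (\<lambda>k. pdiff k \<phi> x) x" using differentiable_has_partials by blast
    moreover have "pdiff k \<phi> x = \<Psi> x $ k" for k using * by (auto simp: grad_def vec_eq_iff)
    ultimately show "has_partials \<phi> (\<lambda>k. \<Psi> x $ k) x" by simp
  qed
  then show ?thesis by (simp add: scalar_potential_def)
qed

lemma scalar_potential_along_line:
  assumes "scalar_potential S \<Psi> \<phi>" "a + s *\<^sub>R d \<in> S"
  shows "((\<lambda>s. \<phi> (a + s *\<^sub>R d)) has_vector_derivative (\<Sum>k\<in>UNIV. d $ k *\<^sub>R \<Psi> (a + s *\<^sub>R d) $ k)) (at s)"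
proof -
  have "((\<lambda>s. a + s *\<^sub>R d) has_derivative (\<lambda>h. h *\<^sub>R d)) (at s)"
    by (auto intro!: derivative_eq_intros)
  moreover have "(\<phi> has_derivative (\<lambda>h. \<Sum>k\<in>UNIV. h $ k *\<^sub>R \<Psi> (a + s *\<^sub>R d) $ k)) (at (a + s *\<^sub>R d))"
    using assms by (simp add: scalar_potential_iff has_partials_def)
  ultimately have "((\<lambda>s. \<phi> (a + s *\<^sub>R d)) has_derivative
      (\<lambda>h. \<Sum>k\<in>UNIV. (h *\<^sub>R d) $ k *\<^sub>R \<Psi> (a + s *\<^sub>R d) $ k)) (at s)"
    by (rule has_derivative_compose)
  then show ?thesis
    by (simp add: has_vector_derivative_def scaleR_sum_right)
qed

lemma rot_eq_0_imp_symmetric: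
  assumes "rot \<Psi> x = 0"
  shows "pdiff j (\<lambda>y. \<Psi> y $ k) x = pdiff k (\<lambda>y. \<Psi> y $ j) x"
proof -
  have "rot \<Psi> x $ 1 = 0" "rot \<Psi> x $ 2 = 0" "rot \<Psi> x $ 3 = 0" using assms by auto
  then have "\<forall>j k. pdiff j (\<lambda>y. \<Psi> y $ k) x = pdiff k (\<lambda>y. \<Psi> y $ j) x"
    by (simp add: forall_3 rot_def)
  then show ?thesis by blast
qed

text \<open>The potential is the integral over \<open>s\<close> in [0, 1] of the inner product of
  \<open>x - x0\<close> with \<Psi> at \<open>x0 + s (x - x0)\<close>, differentiated under the
  integral.\<close>

lemma Poincare_convex:
  assumes U: "open U" "convex U" and \<Psi>: "C1_on U \<Psi>" and rot: "\<And>x. x \<in> U \<Longrightarrow> rot \<Psi> x = 0"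
  obtains \<phi> where "scalar_potential U \<Psi> \<phi>"
proof (cases "U = {}")
  case True
  then show ?thesis using that by (auto simp: scalar_potential_def)
next
  case False
  then obtain x0 where x0: "x0 \<in> U" by auto
  define z where "z x s = x0 + s *\<^sub>R (x - x0)" for x and s :: real
  define g where "g x s = (\<Sum>k\<in>UNIV. (x - x0) $ k *\<^sub>R \<Psi> (z x s) $ k)" for x s
  \<comment> \<open>Differentiating \<open>g\<close> in direction \<open>j\<close> produces the
    partials of \<Psi> with transposed indices; vanishing curl transposes them back. In this form
    \<open>H j x s\<close> is the derivative of \<open>s *\<^sub>R \<Psi> (z x s) $ j\<close> in
    \<open>s\<close>, so its integral is \<open>\<Psi> x $ j\<close>.\<close>
  define H where "H j x s = s *\<^sub>R (\<Sum>k\<in>UNIV. (x - x0) $ k *\<^sub>R pdiff k (\<lambda>y. \<Psi> y $ j) (z x s)) + \<Psi> (z x s) $ j" for j x s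
  let ?I = "indicator {0..1} :: real \<Rightarrow> real"
  have zU: "z x s \<in> U" if "x \<in> U" "s \<in> {0..1}" for x s
  proof -
    have "z x s = (1 - s) *\<^sub>R x0 + s *\<^sub>R x" by (simp add: z_def algebra_simps)
    then show ?thesis using convexD[OF U(2) x0 that(1), of "1 - s" s] that(2) by simp
  qed
  have contz: "continuous_on (A \<times> B) (\<lambda>(x, s). z x s)" for A B
    unfolding z_def case_prod_beta' by (intro continuous_intros)
  have img: "(\<lambda>(x, s). z x s) ` (U \<times> {0..1}) \<subseteq> U" using zU by force
  have c1: "continuous_on (U \<times> {0..1}) (\<lambda>(x, s). \<Psi> (z x s))"
    using continuous_on_compose2[OF C1_on_continuous_on[OF \<Psi>] contz img]
    by (simp add: case_prod_beta')
  have c2: "continuous_on (U \<times> {0..1}) (\<lambda>(x, s). pdiff k (\<lambda>y. \<Psi> y $ j) (z x s))" for j k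
    using continuous_on_compose2[OF C1_on_continuous_pdiff[OF C1_on_nth[OF \<Psi>]] contz img]
    by (simp add: case_prod_beta')
  have contH: "continuous_on (U \<times> {0..1}) (\<lambda>(x, s). H j x s)" for j
    using c1 c2 unfolding H_def case_prod_beta' by (intro continuous_intros) auto
  have contg: "continuous_on (U \<times> {0..1}) (\<lambda>(x, s). g x s)"
    using c1 unfolding g_def case_prod_beta' by (intro continuous_intros) auto
  have slice: "continuous_on {0..1} (F x)" if "continuous_on (U \<times> {0..1}) (\<lambda>(x, s). F x s)" "x \<in> U"
    for F :: "real^3 \<Rightarrow> real \<Rightarrow> complex" and x
  proof -
    have "continuous_on {0..1} (Pair x)" by (intro continuous_intros)
    from continuous_on_compose2[OF that(1) this] that(2) show ?thesis by auto
  qed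
  have intI: "integrable lborel (\<lambda>s. ?I s *\<^sub>R F x s)" if "continuous_on (U \<times> {0..1}) (\<lambda>(x, s). F x s)" "x \<in> U"
    for F :: "real^3 \<Rightarrow> real \<Rightarrow> complex" and x
    by (rule borel_integrable_compact[OF compact_Icc slice[OF that]])
  have dz: "has_partials (\<lambda>x. z x s $ j) (\<lambda>k. if k = j then s else 0) x" for s j x
    unfolding z_def has_partials_def
    by (rule has_derivative_eq_rhs[OF bounded_linear.has_derivative[OF bounded_linear_vec_nth]],
        (rule derivative_intros)+)
      (simp add: fun_eq_iff if_distrib cong: if_cong)
  have dg: "has_partials (\<lambda>x. g x s) (\<lambda>j. H j x s) x" if x: "x \<in> U" and s: "s \<in> {0..1}" for x s
  proof -
    have D\<Psi>: "has_partials (\<lambda>x. \<Psi> (z x s) $ k) (\<lambda>j. s *\<^sub>R pdiff j (\<lambda>y. \<Psi> y $ k) (z x s)) x" for k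
    proof -
      have "((\<lambda>x. z x s) has_derivative (\<lambda>h. s *\<^sub>R h)) (at x)"
        unfolding z_def by (auto intro!: derivative_eq_intros)
      from has_derivative_compose[OF this C1_on_has_partials[OF C1_on_nth[OF \<Psi>] zU[OF x s], unfolded has_partials_def]]
      show ?thesis by (simp add: has_partials_def mult.commute)
    qed
    let ?T = "\<lambda>k j. (x - x0) $ k *\<^sub>R (s *\<^sub>R pdiff j (\<lambda>y. \<Psi> y $ k) (z x s)) + (if j = k then 1 else 0) *\<^sub>R \<Psi> (z x s) $ k"
    have "has_partials (\<lambda>x. (x - x0) $ k *\<^sub>R \<Psi> (z x s) $ k)
       (?T k) x" for k
      by (rule has_partials_scaleR[OF has_partials_coord D\<Psi>])
    then have "has_partials (\<lambda>x. g x s)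
       (\<lambda>j. \<Sum>k\<in>UNIV. ?T k j) x"
      unfolding g_def sum_3 by (intro has_partials_add)
    moreover have "(\<Sum>k\<in>UNIV. ?T k j)
        = H j x s" for j
    proof -
      have "(\<Sum>k\<in>UNIV. (if j = k then 1 else 0) *\<^sub>R \<Psi> (z x s) $ k) = (\<Sum>k\<in>UNIV. if k = j then \<Psi> (z x s) $ k else 0)"
        by (intro sum.cong) auto
      then show ?thesis
        unfolding sum.distrib H_def rot_eq_0_imp_symmetric[OF rot[OF zU[OF x s]], of j]
        by (simp add: scaleR_sum_right mult.commute)
    qed
    ultimately show ?thesis by simp
  qed
  define \<phi> where "\<phi> x = (LBINT s. ?I s *\<^sub>R g x s)" for x
  have "has_partials \<phi> (\<lambda>j. \<Psi> x $ j) x" if x: "x \<in> U" for x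
  proof -
    obtain r where r: "r > 0" "cball x r \<subseteq> U" using U(1) x open_contains_cball by blast
    have "\<exists>B. \<forall>p\<in>cball x r \<times> {0..1}. norm (case p of (x, s) \<Rightarrow> H j x s) \<le> B" for j
    proof -
      have "continuous_on (cball x r \<times> {0..1}) (\<lambda>(x, s). H j x s)"
        by (rule continuous_on_subset[OF contH]) (use r in auto)
      then have "bounded ((\<lambda>(x, s). H j x s) ` (cball x r \<times> {0..1}))"
        by (intro compact_imp_bounded compact_continuous_image compact_Times) auto
      then show ?thesis by (auto simp: bounded_iff)
    qed
    then obtain B where B: "\<And>j p. p \<in> cball x r \<times> {0..1} \<Longrightarrow> norm (case p of (x, s) \<Rightarrow> H j x s) \<le> B j" by metis
    have "((\<lambda>x. LBINT s. ?I s *\<^sub>R g x s) has_derivative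
        (\<lambda>h. LBINT s. ?I s *\<^sub>R (\<Sum>j\<in>UNIV. h $ j *\<^sub>R H j x s))) (at x)"
    proof (rule has_derivative_integral[where U = "ball x r" and w = "\<lambda>s. (\<Sum>j\<in>UNIV. B j) * ?I s"
          and f' = "\<lambda>x s h. ?I s *\<^sub>R (\<Sum>j\<in>UNIV. h $ j *\<^sub>R H j x s)"])
      have bU: "y \<in> U" if "y \<in> ball x r" for y using that r(2) by auto
      show "integrable lborel (\<lambda>s. ?I s *\<^sub>R g y s)" if "y \<in> ball x r" for y
        by (rule intI[OF contg bU[OF that]])
      show "((\<lambda>x. ?I s *\<^sub>R g x s) has_derivative (\<lambda>h. ?I s *\<^sub>R (\<Sum>j\<in>UNIV. h $ j *\<^sub>R H j y s))) (at y)"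
        if "y \<in> ball x r" for y s
        using dg[OF bU[OF that], of s]
        by (cases "s \<in> {0..1}") (auto simp: has_partials_def)
      show "norm (?I s *\<^sub>R (\<Sum>j\<in>UNIV. h $ j *\<^sub>R H j y s)) \<le> (\<Sum>j\<in>UNIV. B j) * ?I s * norm h"
        if y: "y \<in> ball x r" for y s and h :: "real^3"
      proof (cases "s \<in> {0..1}")
        case True
        have "norm (\<Sum>j\<in>UNIV. h $ j *\<^sub>R H j y s) \<le> (\<Sum>j\<in>UNIV. norm h * B j)"
        proof (intro order_trans[OF norm_sum] sum_mono)
          fix j
          have "norm (H j y s) \<le> B j" using B[of "(y, s)" j] y True by simp
          then show "norm (h $ j *\<^sub>R H j y s) \<le> norm h * B j"
            unfolding norm_scaleR by (intro mult_mono) (auto simp: component_le_norm_cart)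
        qed
        then show ?thesis using True by (simp add: sum_distrib_left mult.commute)
      qed simp
      show "integrable lborel (\<lambda>s. (\<Sum>j\<in>UNIV. B j) * ?I s)"
        by (intro integrable_mult_right integrable_real_indicator) auto
      show "(\<lambda>s. ?I s *\<^sub>R (\<Sum>j\<in>UNIV. h $ j *\<^sub>R H j x s)) \<in> borel_measurable lborel" for h :: "real^3"
      proof -
        have "continuous_on {0..1} (\<lambda>s. \<Sum>j\<in>UNIV. h $ j *\<^sub>R H j x s)"
          by (intro continuous_intros slice[OF contH x])
        from borel_integrable_compact[OF compact_Icc this] show ?thesis by simp
      qed
    qed (use r in auto)
    moreover have "(LBINT s. ?I s *\<^sub>R (\<Sum>j\<in>UNIV. h $ j *\<^sub>R H j x s)) = (\<Sum>j\<in>UNIV. h $ j *\<^sub>R \<Psi> x $ j)" for h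
    proof -
      have FTC: "(LBINT s. ?I s *\<^sub>R H j x s) = \<Psi> x $ j" for j
      proof -
        have "(LBINT s. ?I s *\<^sub>R H j x s) = 1 *\<^sub>R \<Psi> (z x 1) $ j - 0 *\<^sub>R \<Psi> (z x 0) $ j"
        proof (rule integral_FTC_atLeastAtMost)
          show "continuous_on {0..1} (H j x)" by (rule slice[OF contH x])
          show "((\<lambda>s. s *\<^sub>R \<Psi> (z x s) $ j) has_vector_derivative H j x s) (at s within {0..1})"
            if "0 \<le> s" "s \<le> 1" for s
          proof -
            have "((\<lambda>s. z x s) has_derivative (\<lambda>h. h *\<^sub>R (x - x0))) (at s)"
              unfolding z_def by (auto intro!: derivative_eq_intros)
            from has_derivative_compose[OF this C1_on_has_partials[OF C1_on_nth[OF \<Psi>] zU[OF x], unfolded has_partials_def]]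
            have "((\<lambda>s. \<Psi> (z x s) $ j) has_vector_derivative
                (\<Sum>k\<in>UNIV. (x - x0) $ k *\<^sub>R pdiff k (\<lambda>y. \<Psi> y $ j) (z x s))) (at s)"
              using that by (simp add: has_vector_derivative_def scaleR_sum_right)
            then have "((\<lambda>s. s *\<^sub>R \<Psi> (z x s) $ j) has_vector_derivative
                s *\<^sub>R (\<Sum>k\<in>UNIV. (x - x0) $ k *\<^sub>R pdiff k (\<lambda>y. \<Psi> y $ j) (z x s)) + 1 *\<^sub>R \<Psi> (z x s) $ j) (at s)"
              by (intro has_vector_derivative_scaleR) auto
            then show ?thesis unfolding H_def by (simp add: has_vector_derivative_at_within)
          qed
        qed simp
        then show ?thesis by (simp add: z_def)
      qed
      have "(LBINT s. ?I s *\<^sub>R (\<Sum>j\<in>UNIV. h $ j *\<^sub>R H j x s)) = (LBINT s. (\<Sum>j\<in>UNIV. h $ j *\<^sub>R (?I s *\<^sub>R H j x s)))"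
        by (simp add: scaleR_sum_right mult.commute)
      also have "\<dots> = (\<Sum>j\<in>UNIV. LBINT s. h $ j *\<^sub>R (?I s *\<^sub>R H j x s))"
        by (intro Bochner_Integration.integral_sum integrable_scaleR_right intI[OF contH x])
      also have "\<dots> = (\<Sum>j\<in>UNIV. h $ j *\<^sub>R \<Psi> x $ j)"
        using FTC by (simp del: scaleR_scaleR)
      finally show ?thesis .
    qed
    ultimately show ?thesis by (simp add: has_partials_def \<phi>_def[abs_def])
  qed
  then show ?thesis using that[of \<phi>] by (simp add: scalar_potential_iff)
qed

section \<open>Chord sums along continuous paths\<close>

definition segint :: "(real^3 \<Rightarrow> complex^3) \<Rightarrow> real^3 \<Rightarrow> real^3 \<Rightarrow> complex" where
  "segint \<Psi> a b = integral {0..1} (\<lambda>s. \<Sum>k\<in>UNIV. (b - a) $ k *\<^sub>R \<Psi> (a + s *\<^sub>R (b - a)) $ k)"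

lemma segint_eq:
  assumes "scalar_potential U \<Psi> \<phi>" "convex U" "a \<in> U" "b \<in> U"
  shows "segint \<Psi> a b = \<phi> b - \<phi> a"
proof -
  have "((\<lambda>s. \<Sum>k\<in>UNIV. (b - a) $ k *\<^sub>R \<Psi> (a + s *\<^sub>R (b - a)) $ k) has_integral
      \<phi> (a + 1 *\<^sub>R (b - a)) - \<phi> (a + 0 *\<^sub>R (b - a))) {0..1}"
  proof (rule fundamental_theorem_of_calculus)
    fix s :: real assume s: "s \<in> {0..1}"
    have "a + s *\<^sub>R (b - a) = (1 - s) *\<^sub>R a + s *\<^sub>R b" by (simp add: algebra_simps)
    then have "a + s *\<^sub>R (b - a) \<in> U"
      using convexD[OF assms(2-4), of "1 - s" s] s by simp
    then show "((\<lambda>s. \<phi> (a + s *\<^sub>R (b - a))) has_vector_derivative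
        (\<Sum>k\<in>UNIV. (b - a) $ k *\<^sub>R \<Psi> (a + s *\<^sub>R (b - a)) $ k)) (at s within {0..1})"
      by (rule has_vector_derivative_at_within[OF scalar_potential_along_line[OF assms(1)]])
  qed simp
  then show ?thesis by (simp add: segint_def integral_unique)
qed

lemma segint_same: "segint \<Psi> a a = 0"
  by (simp add: segint_def)

text \<open>The paths are merely continuous, so a line integral along them need not make sense; the
  inscribed polygon replaces it. For small \<open>N\<close> its chords may leave the domain and the
  value means nothing, which is why only eventual values are used.\<close>

definition psum :: "(real^3 \<Rightarrow> complex^3) \<Rightarrow> (real \<Rightarrow> real^3) \<Rightarrow> nat \<Rightarrow> complex" where
  "psum \<Psi> g N = (\<Sum>i<N. segint \<Psi> (g (i / N)) (g (Suc i / N)))"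

lemma psum_potential:
  assumes "scalar_potential U \<Psi> \<phi>" "convex U" "\<And>t. t \<in> {0..1} \<Longrightarrow> g t \<in> U" "N > 0"
  shows "psum \<Psi> g N = \<phi> (g 1) - \<phi> (g 0)"
proof -
  have "psum \<Psi> g N = (\<Sum>i<N. \<phi> (g (Suc i / N)) - \<phi> (g (i / N)))"
    unfolding psum_def using assms
    by (intro sum.cong segint_eq) auto
  also have "\<dots> = \<phi> (g 1) - \<phi> (g 0)"
    using assms(4) sum_lessThan_telescope[of "\<lambda>i. \<phi> (g (real i / real N))" N] by simp
  finally show ?thesis .
qed

text \<open>With \<open>2 * N\<close> chords the junction at parameter 1/2 is a grid point.\<close>

lemma psum_join:
  assumes "pathfinish g = pathstart h" "N > 0"
  shows "psum \<Psi> (g +++ h) (2 * N) = psum \<Psi> g N + psum \<Psi> h N"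
proof -
  let ?c = "\<lambda>i. segint \<Psi> ((g +++ h) (i / real (2 * N))) ((g +++ h) (Suc i / real (2 * N)))"
  have "psum \<Psi> (g +++ h) (2 * N) = (\<Sum>i<N. ?c i) + (\<Sum>i=N..<2 * N. ?c i)"
    unfolding psum_def lessThan_atLeast0 by (rule sum.atLeastLessThan_concat[symmetric]) auto
  also have "(\<Sum>i<N. ?c i) = psum \<Psi> g N"
    unfolding psum_def
  proof (intro sum.cong refl)
    fix i assume "i \<in> {..<N}"
    then have i: "Suc i \<le> N" by simp
    have "(g +++ h) (j / real (2 * N)) = g (j / N)" if "j \<le> N" for j :: nat
    proof -
      have "j / real (2 * N) \<le> 1/2" "2 * (j / real (2 * N)) = j / N"
        using that assms(2) by (auto simp: field_simps)
      then show ?thesis by (simp add: joinpaths_def)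
    qed
    from this[of i] this[of "Suc i"] show "?c i = segint \<Psi> (g (i / N)) (g (Suc i / N))"
      using i by (simp del: of_nat_Suc)
  qed
  also have "(\<Sum>i=N..<2 * N. ?c i) = (\<Sum>i<N. ?c (i + N))"
  proof -
    have "{N..<2 * N} = {0 + N..<N + N}" by auto
    then show ?thesis unfolding lessThan_atLeast0 by (simp only: sum.shift_bounds_nat_ivl)
  qed
  also have "\<dots> = psum \<Psi> h N"
    unfolding psum_def
  proof (intro sum.cong refl)
    fix i assume "i \<in> {..<N}"
    have "(g +++ h) ((j + N) / real (2 * N)) = h (j / N)" for j :: nat
    \<comment> \<open>At the junction \<open>+++\<close> takes its value from \<open>g\<close>, so
      agreement of the endpoints is needed here.\<close>
    proof (cases "j = 0")
      case True
      have "N / real (2 * N) = 1/2" using assms(2) by simp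
      then show ?thesis
        using True assms by (simp add: joinpaths_def pathfinish_def pathstart_def)
    next
      case False
      then have "\<not> (j + N) / real (2 * N) \<le> 1/2" "2 * ((j + N) / real (2 * N)) - 1 = j / N"
        using assms(2) by (auto simp: field_simps)
      then show ?thesis by (simp add: joinpaths_def)
    qed
    from this[of i] this[of "Suc i"]
    show "?c (i + N) = segint \<Psi> (h (i / N)) (h (Suc i / N))" by simp
  qed
  finally show ?thesis .
qed

text \<open>A field with local potentials: the sums \<open>psum\<close> along a path are eventually constant, and
  invariant under homotopy, because on every cell of a fine grid one local potential suffices.\<close>

locale locally_potential =
  fixes S :: "(real^3) set" and \<Psi> :: "real^3 \<Rightarrow> complex^3"
  assumes open_S: "open S"
    and ball_potential: "\<And>x r. ball x r \<subseteq> S \<Longrightarrow> \<exists>\<phi>. scalar_potential (ball x r) \<Psi> \<phi>"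
begin

text \<open>Compactness of the image gives one radius \<epsilon> for all balls, and uniform
  continuity the mesh. The bound \<open>2 / N\<close> instead of \<open>1 / N\<close> covers the
  diagonals of grid cells in a homotopy.\<close>

lemma eventually_fine:
  fixes g :: "'a::metric_space \<Rightarrow> real^3"
  assumes "compact K" "continuous_on K g" "g ` K \<subseteq> S"
  obtains \<epsilon> where "\<And>s. s \<in> K \<Longrightarrow> ball (g s) \<epsilon> \<subseteq> S"
    "\<forall>\<^sub>F N in sequentially. \<forall>s\<in>K. \<forall>t\<in>K. dist s t \<le> 2 / real N \<longrightarrow> g t \<in> ball (g s) \<epsilon>"
proof -
  have "compact (g ` K)" using assms(1,2) by (rule compact_continuous_image[rotated])
  then obtain \<epsilon> where e: "\<epsilon> > 0" "(\<Union>x\<in>g ` K. ball x \<epsilon>) \<subseteq> S"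
    using compact_subset_open_imp_ball_epsilon_subset[OF _ open_S assms(3)] by metis
  obtain d where d: "d > 0" "\<And>s t. s \<in> K \<Longrightarrow> t \<in> K \<Longrightarrow> dist t s < d \<Longrightarrow> dist (g t) (g s) < \<epsilon>"
    using compact_uniformly_continuous[OF assms(2,1)] e(1) unfolding uniformly_continuous_on_def by metis
  have "(\<lambda>N. 2 / real N) \<longlonglongrightarrow> 0" by real_asymp
  then have "\<forall>\<^sub>F N in sequentially. 2 / real N < d" using d(1) by (rule order_tendstoD)
  then have "\<forall>\<^sub>F N in sequentially. \<forall>s\<in>K. \<forall>t\<in>K. dist s t \<le> 2 / real N \<longrightarrow> g t \<in> ball (g s) \<epsilon>"
    by eventually_elim (use d(2) in \<open>force simp: dist_commute\<close>)
  then show ?thesis using that e(2) by blast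
qed

lemma psum_eventually_const:
  assumes "path g" "path_image g \<subseteq> S"
  obtains v where "\<forall>\<^sub>F N in sequentially. psum \<Psi> g N = v"
proof -
  obtain \<epsilon> where e: "\<And>s. s \<in> {0..1} \<Longrightarrow> ball (g s) \<epsilon> \<subseteq> S"
    "\<forall>\<^sub>F N in sequentially. \<forall>s\<in>{0..1}. \<forall>t\<in>{0..1}. dist s t \<le> 2 / real N \<longrightarrow> g t \<in> ball (g s) \<epsilon>"
    using eventually_fine[of "{0..1}" g] assms unfolding path_def path_image_def by auto
  then obtain N0 where N0: "\<And>N s t. N \<ge> N0 \<Longrightarrow> s \<in> {0..1} \<Longrightarrow> t \<in> {0..1} \<Longrightarrow> dist s t \<le> 2 / real N \<Longrightarrow> g t \<in> ball (g s) \<epsilon>"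
    unfolding eventually_sequentially by blast
  \<comment> \<open>The points that subdivide one chord lie in a ball with a potential, where the
    small chords telescope to the large one.\<close>
  have ref: "psum \<Psi> g (N * M) = psum \<Psi> g N" if N: "N \<ge> N0" "N > 0" and M: "M > 0" for N M
  proof -
    let ?p = "\<lambda>j. g (real j / real (N * M))"
    have "psum \<Psi> g (N * M) = (\<Sum>i<N. \<Sum>j\<in>{i * M..<i * M + M}. segint \<Psi> (?p j) (?p (Suc j)))"
      unfolding psum_def by (rule sum.nat_group[symmetric])
    also have "\<dots> = psum \<Psi> g N"
      unfolding psum_def
    proof (intro sum.cong refl)
      fix i assume i: "i \<in> {..<N}"
      have i1: "real i / real N \<in> {0..1}" using i by auto
      obtain \<phi> where \<phi>: "scalar_potential (ball (g (i / N)) \<epsilon>) \<Psi> \<phi>"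
        using ball_potential[OF e(1)[OF i1]] by blast
      have p: "?p j \<in> ball (g (i / N)) \<epsilon>" if "i * M \<le> j" "j \<le> i * M + M" for j
      proof (rule N0[OF N(1) i1])
        have le: "i / N \<le> j / real (N * M)" "j / real (N * M) \<le> (i + 1) / N"
        proof -
          have "real (i * M) \<le> real j" "real j \<le> real (i * M + M)" using that by (auto simp only: of_nat_le_iff)
          then show "i / N \<le> j / real (N * M)" "j / real (N * M) \<le> (i + 1) / N"
            using N M by (simp_all add: field_simps)
        qed
        have "(i + 1) / N \<le> 1" using i N by (simp add: field_simps)
        then show "j / real (N * M) \<in> {0..1}" using le i1 by auto
        have "j / real (N * M) - i / real N \<le> (i + 1) / N - i / real N" using le by simp
        also have "\<dots> = 1 / real N" by (simp add: diff_divide_distrib[symmetric])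
        also have "\<dots> \<le> 2 / N" by (simp add: divide_right_mono)
        finally show "dist (i / real N) (j / real (N * M)) \<le> 2 / N"
          using le(1) by (simp add: dist_real_def)
      qed
      have "(\<Sum>j\<in>{i * M..<i * M + M}. segint \<Psi> (?p j) (?p (Suc j))) = (\<Sum>j\<in>{i * M..<i * M + M}. \<phi> (?p (Suc j)) - \<phi> (?p j))"
        by (intro sum.cong refl segint_eq[OF \<phi>] convex_ball p) auto
      also have "\<dots> = \<phi> (?p (i * M + M)) - \<phi> (?p (i * M))"
        by (rule sum_Suc_diff') simp
      also have "\<dots> = segint \<Psi> (?p (i * M)) (?p (i * M + M))"
        by (rule segint_eq[OF \<phi> convex_ball p p, symmetric]) auto
      also have "real (i * M) / real (N * M) = i / N" using M by simp
      also have "real (i * M + M) / real (N * M) = Suc i / N"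
      proof -
        have "real (i * M + M) = real (Suc i) * real M" by (simp add: algebra_simps)
        then show ?thesis using M by simp
      qed
      finally show "(\<Sum>j\<in>{i * M..<i * M + M}. segint \<Psi> (?p j) (?p (Suc j))) = segint \<Psi> (g (i / N)) (g (Suc i / N))" .
    qed
    finally show ?thesis .
  qed
  \<comment> \<open>Both sums equal the sum over the common refinement with
    \<open>N * Suc N0\<close> chords; \<open>Suc\<close> keeps the reference number
    positive.\<close>
  have "psum \<Psi> g N = psum \<Psi> g (Suc N0)" if "N \<ge> Suc N0" for N
    using ref[of N "Suc N0"] ref[of "Suc N0" N] that by (simp add: mult.commute)
  then have "\<forall>\<^sub>F N in sequentially. psum \<Psi> g N = psum \<Psi> g (Suc N0)"
    unfolding eventually_sequentially by blast
  then show ?thesis using that by blast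
qed

lemma psum_homotopic:
  assumes "homotopic_paths S p q"
  shows "\<forall>\<^sub>F N in sequentially. psum \<Psi> p N = psum \<Psi> q N"
proof -
  obtain h where h: "continuous_on ({0..1} \<times> {0..1}) h" "h \<in> ({0..1} \<times> {0..1}) \<rightarrow> S"
    "\<And>t. t \<in> {0..1} \<Longrightarrow> h (0, t) = p t" "\<And>t. t \<in> {0..1} \<Longrightarrow> h (1, t) = q t"
    "\<And>s. s \<in> {0..1::real} \<Longrightarrow> h (s, 0) = p 0" "\<And>s. s \<in> {0..1} \<Longrightarrow> h (s, 1::real) = p 1"
    using assms unfolding homotopic_paths by (auto simp: pathstart_def pathfinish_def)
  have "compact ({0..1::real} \<times> {0..1::real})" by (intro compact_Times) auto
  then obtain \<epsilon> where e: "\<And>s. s \<in> {0..1} \<times> {0..1} \<Longrightarrow> ball (h s) \<epsilon> \<subseteq> S"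
    "\<forall>\<^sub>F N in sequentially. \<forall>s\<in>{0..1} \<times> {0..1}. \<forall>t\<in>{0..1} \<times> {0..1}. dist s t \<le> 2 / real N \<longrightarrow> h t \<in> ball (h s) \<epsilon>"
    using eventually_fine[OF _ h(1) funcset_image[OF h(2)]] by blast
  from e(2) eventually_gt_at_top[of 0] show ?thesis
  proof eventually_elim
    case (elim N)
    let ?pt = "\<lambda>i j. h (real i / real N, real j / real N)"
    define row where "row i = (\<Sum>j<N. segint \<Psi> (?pt i j) (?pt i (Suc j)))" for i
    have sq: "(real i / real N, real j / real N) \<in> {0..1} \<times> {0..1}" if "i \<le> N" "j \<le> N" for i j
      using that by (auto simp: divide_le_eq)
    have step: "row (Suc i) = row i" if i: "i < N" for i
    proof -
      \<comment> \<open>The four edges of a cell lie in one ball with a potential, so the sum around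
        the cell vanishes; it is written as horizontal edges against vertical ones.\<close>
      have cell: "segint \<Psi> (?pt (Suc i) j) (?pt (Suc i) (Suc j)) - segint \<Psi> (?pt i j) (?pt i (Suc j))
          = segint \<Psi> (?pt i (Suc j)) (?pt (Suc i) (Suc j)) - segint \<Psi> (?pt i j) (?pt (Suc i) j)"
        if j: "j < N" for j
      proof -
        obtain \<phi> where \<phi>: "scalar_potential (ball (?pt i j) \<epsilon>) \<Psi> \<phi>"
          using ball_potential[OF e(1)[OF sq]] i j by (metis less_imp_le)
        have mem: "?pt i' j' \<in> ball (?pt i j) \<epsilon>" if "i' = i \<or> i' = Suc i" "j' = j \<or> j' = Suc j" for i' j'
        proof -
          have 1: "\<bar>i / N - i' / N\<bar> \<le> 1 / N" "\<bar>j / N - j' / N\<bar> \<le> 1 / N"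
            using that by (auto simp: add_divide_distrib)
          have "dist (real i / real N, real j / real N) (real i' / real N, real j' / real N)
             \<le> \<bar>i / N - i' / N\<bar> + \<bar>j / N - j' / N\<bar>"
            unfolding dist_Pair_Pair dist_real_def
            by (rule order_trans[OF sqrt_sum_squares_le_sum_abs]) simp
          also have "\<dots> \<le> 2 / N" using 1 by simp
          finally show ?thesis using elim(1) sq[of i j] sq[of i' j'] i j that by (metis Suc_leI less_imp_le)
        qed
        show ?thesis
          using segint_eq[OF \<phi> convex_ball mem[of i j] mem[of i "Suc j"]]
            segint_eq[OF \<phi> convex_ball mem[of "Suc i" j] mem[of "Suc i" "Suc j"]]
            segint_eq[OF \<phi> convex_ball mem[of i j] mem[of "Suc i" j]]
            segint_eq[OF \<phi> convex_ball mem[of i "Suc j"] mem[of "Suc i" "Suc j"]]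
          by simp
      qed
      have "row (Suc i) - row i = (\<Sum>j<N. segint \<Psi> (?pt i (Suc j)) (?pt (Suc i) (Suc j)) - segint \<Psi> (?pt i j) (?pt (Suc i) j))"
        unfolding row_def sum_subtractf[symmetric] by (intro sum.cong refl cell) simp
      also have "\<dots> = segint \<Psi> (?pt i N) (?pt (Suc i) N) - segint \<Psi> (?pt i 0) (?pt (Suc i) 0)"
        by (rule sum_lessThan_telescope)
      \<comment> \<open>The vertical edges telescope to the two outermost ones, which are degenerate
        since the homotopy fixes the endpoints.\<close>
      also have "\<dots> = 0"
        using i elim(2) h(5,6)[of "real i / real N"] h(5,6)[of "real (Suc i) / real N"]
        by (simp add: segint_same)
      finally show ?thesis by simp
    qed
    have "row i = row 0" if "i \<le> N" for i
      using that by (induction i) (auto simp: step)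
    from this[of N] have "row N = row 0" by blast
    moreover have "row 0 = psum \<Psi> p N"
      unfolding row_def psum_def using h(3) by (intro sum.cong) auto
    moreover have "row N = psum \<Psi> q N"
      unfolding row_def psum_def using h(4) elim(2) by (intro sum.cong) auto
    ultimately show ?case by simp
  qed
qed

text \<open>The value at \<open>x\<close> is the eventual chord sum along a chosen path. For
  \<open>y\<close> near \<open>x\<close>, the chosen path to \<open>y\<close> is homotopic to the
  one to \<open>x\<close> followed by a segment, so the function differs from a local potential by a
  constant.\<close>

lemma potential_simply_connected:
  assumes "simply_connected S"
  obtains \<phi> where "scalar_potential S \<Psi> \<phi>"
proof (cases "S = {}")
  case True
  then show ?thesis using that by (auto simp: scalar_potential_def)
next
  case False
  then obtain p where p: "p \<in> S" by auto
  have pc: "path_connected S" and hom: "\<And>g h. path g \<Longrightarrow> path_image g \<subseteq> S \<Longrightarrow> path h \<Longrightarrow> path_image h \<subseteq> S \<Longrightarrow>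
      pathstart h = pathstart g \<Longrightarrow> pathfinish h = pathfinish g \<Longrightarrow> homotopic_paths S g h"
    using assms unfolding simply_connected_eq_homotopic_paths by blast+
  have "\<exists>g. path g \<and> path_image g \<subseteq> S \<and> pathstart g = p \<and> pathfinish g = x" if "x \<in> S" for x
    using pc p that unfolding path_connected_def by blast
  then obtain \<gamma> where \<gamma>: "\<And>x. x \<in> S \<Longrightarrow> path (\<gamma> x) \<and> path_image (\<gamma> x) \<subseteq> S \<and> pathstart (\<gamma> x) = p \<and> pathfinish (\<gamma> x) = x"
    by metis
  have "\<exists>v. \<forall>\<^sub>F N in sequentially. psum \<Psi> (\<gamma> x) N = v" if "x \<in> S" for x
    using psum_eventually_const \<gamma>[OF that] by metis
  then obtain \<phi> where \<phi>: "\<And>x. x \<in> S \<Longrightarrow> \<forall>\<^sub>F N in sequentially. psum \<Psi> (\<gamma> x) N = \<phi> x" by metis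
  have "has_partials \<phi> (\<lambda>k. \<Psi> x $ k) x" if x: "x \<in> S" for x
  proof -
    obtain r where r: "r > 0" "ball x r \<subseteq> S" using open_S x open_contains_ball by blast
    obtain \<phi>0 where \<phi>0: "scalar_potential (ball x r) \<Psi> \<phi>0" using ball_potential[OF r(2)] by blast
    have eq: "\<phi> y = \<phi>0 y + (\<phi> x - \<phi>0 x)" if y: "y \<in> ball x r" for y
    proof -
      have yS: "y \<in> S" using y r by auto
      have lp: "linepath x y t \<in> ball x r" if "t \<in> {0..1}" for t
      proof -
        have "closed_segment x y \<subseteq> ball x r"
          using y r(1) by (intro closed_segment_subset convex_ball) auto
        then show ?thesis using that linepath_in_path[of t x y] by auto
      qed
      have j: "path (\<gamma> x +++ linepath x y)" "path_image (\<gamma> x +++ linepath x y) \<subseteq> S"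
        "pathstart (\<gamma> x +++ linepath x y) = p" "pathfinish (\<gamma> x +++ linepath x y) = y"
      proof -
        show "path_image (\<gamma> x +++ linepath x y) \<subseteq> S"
          using \<gamma>[OF x] lp r(2) by (intro subset_path_image_join) (auto simp: path_image_def)
      qed (use \<gamma>[OF x] in auto)
      have "\<forall>\<^sub>F N in sequentially. psum \<Psi> (\<gamma> x +++ linepath x y) N = psum \<Psi> (\<gamma> y) N"
        by (intro psum_homotopic hom) (use j \<gamma>[OF yS] in auto)
      then have "\<forall>\<^sub>F N in sequentially. psum \<Psi> (\<gamma> x +++ linepath x y) N = \<phi> y"
        using \<phi>[OF yS] by eventually_elim simp
      \<comment> \<open>Passing to even numbers of chords lets \<open>psum_join\<close> split the
        sum.\<close>
      then have "\<forall>\<^sub>F N in sequentially. psum \<Psi> (\<gamma> x +++ linepath x y) (2 * N) = \<phi> y"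
        by (rule eventually_compose_filterlim) real_asymp
      with \<phi>[OF x] eventually_gt_at_top[of 0]
      have "\<forall>\<^sub>F N::nat in sequentially. \<phi> y = \<phi> x + (\<phi>0 y - \<phi>0 x)"
      proof eventually_elim
        case (elim N)
        have "psum \<Psi> (\<gamma> x +++ linepath x y) (2 * N) = psum \<Psi> (\<gamma> x) N + psum \<Psi> (linepath x y) N"
          by (rule psum_join) (use \<gamma>[OF x] elim in auto)
        moreover have "psum \<Psi> (linepath x y) N = \<phi>0 (linepath x y 1) - \<phi>0 (linepath x y 0)"
          by (rule psum_potential[OF \<phi>0 convex_ball lp]) (use elim in auto)
        ultimately show ?case using elim by (simp add: linepath_def)
      qed
      then show ?thesis by simp
    qed
    have "has_partials \<phi>0 (\<lambda>k. \<Psi> x $ k) x" using \<phi>0 r(1) by (simp add: scalar_potential_iff)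
    then have "has_partials (\<lambda>y. \<phi>0 y + (\<phi> x - \<phi>0 x)) (\<lambda>k. \<Psi> x $ k) x"
      using has_partials_add[of \<phi>0 _ x "\<lambda>_. \<phi> x - \<phi>0 x" "\<lambda>_. 0"] by (simp add: has_partials_def)
    then show ?thesis
    proof (rule has_partials_cong[OF _ open_ball[of x r]])
      show "\<phi>0 y + (\<phi> x - \<phi>0 x) = \<phi> y" if "y \<in> ball x r" for y
        using eq[OF that] by simp
    qed (use r(1) in auto)
  qed
  then show ?thesis using that[of \<phi>] by (simp add: scalar_potential_iff)
qed

end

lemma Poincare_simply_connected:
  assumes S: "open S" "simply_connected S" and \<Psi>: "C1_on S \<Psi>" and rot: "\<And>x. x \<in> S \<Longrightarrow> rot \<Psi> x = 0"
  obtains \<phi> where "scalar_potential S \<Psi> \<phi>"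
proof -
  interpret locally_potential S \<Psi>
  proof
    show "\<exists>\<phi>. scalar_potential (ball x r) \<Psi> \<phi>" if "ball x r \<subseteq> S" for x r
      using Poincare_convex[OF open_ball convex_ball C1_on_subset[OF \<Psi> that]] rot that by blast
  qed (rule S)
  show ?thesis using potential_simply_connected[OF S(2)] that by blast
qed


section \<open>Integration along staircase paths\<close>

lemma convex_open_tube:
  fixes a b :: "'a::euclidean_space"
  assumes "open S" "closed_segment a b \<subseteq> S"
  obtains U where "open U" "convex U" "closed_segment a b \<subseteq> U" "U \<subseteq> S"
proof -
  obtain \<epsilon> where e: "\<epsilon> > 0" "(\<Union>x\<in>closed_segment a b. ball x \<epsilon>) \<subseteq> S"
    using compact_subset_open_imp_ball_epsilon_subset[OF compact_segment assms] by metis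
  \<comment> \<open>The Minkowski sum of the segment and a ball: convex as a sum of convex sets, and
    equal to the \<epsilon>-neighbourhood of the segment.\<close>
  let ?U = "\<Union>x\<in>closed_segment a b. \<Union>y\<in>ball 0 \<epsilon>. {x + y}"
  have "open ?U" by (intro open_sums) auto
  moreover have "convex ?U" by (intro convex_sums) auto
  moreover have "closed_segment a b \<subseteq> ?U" using e(1) by force
  moreover have "?U \<subseteq> S"
  proof
    fix z assume "z \<in> ?U"
    then obtain x y where "x \<in> closed_segment a b" "norm y < \<epsilon>" "z = x + y" by auto
    then have "z \<in> (\<Union>x\<in>closed_segment a b. ball x \<epsilon>)" by (auto intro!: bexI[of _ x] simp: dist_norm)
    then show "z \<in> S" using e(2) by blast
  qed
  ultimately show ?thesis using that by blast
qed

lemma potential_on_tube: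
  assumes S: "open S" and \<Psi>: "C1_on S \<Psi>" and rot: "\<And>x. x \<in> S \<Longrightarrow> rot \<Psi> x = 0"
    and "closed_segment a b \<subseteq> S"
  obtains U \<phi> where "open U" "convex U" "closed_segment a b \<subseteq> U" "U \<subseteq> S" "scalar_potential U \<Psi> \<phi>"
proof -
  obtain U where U: "open U" "convex U" "closed_segment a b \<subseteq> U" "U \<subseteq> S"
    using convex_open_tube[OF S assms(4)] by metis
  obtain \<phi> where "scalar_potential U \<Psi> \<phi>"
    using Poincare_convex[OF U(1,2) C1_on_subset[OF \<Psi> U(4)]] rot U(4) by blast
  then show ?thesis using that U by blast
qed

text \<open>The interval integral is signed, so nothing is assumed about the order of
  \<open>a\<close> and \<open>b\<close>.\<close>

lemma axis_integral_potential:
  fixes \<phi> :: "real^3 \<Rightarrow> complex" and a b :: real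
  assumes \<phi>: "scalar_potential U \<Psi> \<phi>" and cont: "continuous_on U \<Psi>"
    and c: "\<And>t. c t = base + t *\<^sub>R axis k 1" and seg: "closed_segment (c a) (c b) \<subseteq> U"
  shows "interval_lebesgue_integral lborel (ereal a) (ereal b) (\<lambda>t. \<Psi> (c t) $ k) = \<phi> (c b) - \<phi> (c a)"
proof (rule interval_integral_FTC_finite)
  have cU: "c t \<in> U" if "t \<in> {min a b..max a b}" for t
  proof -
    have "t \<in> closed_segment a b" using that by (auto simp: closed_segment_eq_real_ivl)
    then obtain u where u: "0 \<le> u" "u \<le> 1" "t = (1 - u) * a + u * b" by (auto simp: in_segment)
    have "c t = (1 - u) *\<^sub>R c a + u *\<^sub>R c b"
      by (simp add: c u(3) algebra_simps)
    then have "c t \<in> closed_segment (c a) (c b)" using u(1,2) unfolding in_segment by blast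
    then show ?thesis using seg by blast
  qed
  have contc: "continuous_on A c" for A
    unfolding c[abs_def] by (intro continuous_intros)
  have "continuous_on {min a b..max a b} (\<lambda>t. \<Psi> (c t))"
    by (rule continuous_on_compose2[OF cont contc]) (use cU in auto)
  then show "continuous_on {min a b..max a b} (\<lambda>t. \<Psi> (c t) $ k)"
    by (intro continuous_intros)
  show "((\<lambda>t. \<phi> (c t)) has_vector_derivative \<Psi> (c t) $ k) (at t within {min a b..max a b})"
    if "min a b \<le> t" "t \<le> max a b" for t
  proof -
    have "((\<lambda>t. \<phi> (c t)) has_vector_derivative (\<Sum>j\<in>UNIV. (axis k 1 :: real^3) $ j *\<^sub>R \<Psi> (c t) $ j)) (at t)"
      unfolding c by (rule scalar_potential_along_line[OF \<phi>]) (use cU that in \<open>simp add: c\<close>)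
    moreover have "(\<Sum>j\<in>UNIV. (axis k 1 :: real^3) $ j *\<^sub>R \<Psi> (c t) $ j) = (\<Sum>j\<in>UNIV. if j = k then \<Psi> (c t) $ j else 0)"
      by (intro sum.cong) (auto simp: axis_def)
    ultimately show ?thesis by (simp add: has_vector_derivative_at_within)
  qed
qed

text \<open>The vertices of the staircase, indexed by the set of coordinates already moved from
  \<open>p\<close> to \<open>x\<close>, so that one chain rule serves all of them.\<close>

definition corner :: "3 set \<Rightarrow> real^3 \<Rightarrow> real^3 \<Rightarrow> real^3" where
  "corner I p x = (\<chi> i. if i \<in> I then x $ i else p $ i)"

lemma corner_vector:
  "corner {} p x = p" "corner {1} p x = vector [x $ 1, p $ 2, p $ 3]"
  "corner {1, 2} p x = vector [x $ 1, x $ 2, p $ 3]" "corner UNIV p x = x"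
  by (simp_all add: corner_def vec_eq_iff forall_3)

lemma has_partials_corner:
  assumes "has_partials \<phi> (\<lambda>k. D $ k) (corner I p x)"
  shows "has_partials (\<lambda>x. \<phi> (corner I p x)) (\<lambda>k. if k \<in> I then D $ k else 0) x"
proof -
  have "bounded_linear (\<lambda>h. corner I 0 h)"
    unfolding linear_conv_bounded_linear[symmetric]
    by (rule linearI) (auto simp: corner_def vec_eq_iff)
  then have "((\<lambda>x. corner I p 0 + corner I 0 x) has_derivative (\<lambda>h. corner I 0 h)) (at x)"
    by (auto intro!: derivative_eq_intros bounded_linear_imp_has_derivative)
  moreover have "(\<lambda>x. corner I p 0 + corner I 0 x) = corner I p"
    by (auto simp: corner_def vec_eq_iff)
  ultimately have "(corner I p has_derivative (\<lambda>h. corner I 0 h)) (at x)" by simp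
  from has_derivative_compose[OF this assms[unfolded has_partials_def]]
  have "((\<lambda>x. \<phi> (corner I p x)) has_derivative (\<lambda>h. \<Sum>k\<in>UNIV. corner I 0 h $ k *\<^sub>R D $ k)) (at x)" .
  moreover have "(\<lambda>h. \<Sum>k\<in>UNIV. corner I 0 h $ k *\<^sub>R D $ k) = (\<lambda>h. \<Sum>k\<in>UNIV. h $ k *\<^sub>R (if k \<in> I then D $ k else 0))"
    by (intro ext sum.cong) (auto simp: corner_def)
  ultimately show ?thesis by (simp add: has_partials_def)
qed

lemma continuous_on_corner: "continuous_on A (corner I p)"
  unfolding corner_def
proof -
  have "continuous_on A (\<lambda>x. if i \<in> I then x $ i else p $ i)" for i
    by (cases "i \<in> I") (auto intro!: continuous_intros)
  then show "continuous_on A (\<lambda>x. \<chi> i. if i \<in> I then x $ i else p $ i)"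
    by (intro continuous_on_vec_lambda)
qed

text \<open>Only differences of each potential occur, so the three legs may use unrelated potentials
  on different sets.\<close>

lemma staircase_pot_eq:
  assumes 1: "scalar_potential U1 \<Psi> \<phi>1" "continuous_on U1 \<Psi>" "closed_segment p (corner {1} p x) \<subseteq> U1"
    and 2: "scalar_potential U2 \<Psi> \<phi>2" "continuous_on U2 \<Psi>" "closed_segment (corner {1} p x) (corner {1, 2} p x) \<subseteq> U2"
    and 3: "scalar_potential U3 \<Psi> \<phi>3" "continuous_on U3 \<Psi>" "closed_segment (corner {1, 2} p x) x \<subseteq> U3"
  shows "staircase_pot p c \<Psi> x = (\<phi>1 (corner {1} p x) - \<phi>1 p) + (\<phi>2 (corner {1, 2} p x) - \<phi>2 (corner {1} p x))
    + (\<phi>3 x - \<phi>3 (corner {1, 2} p x)) + c"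
proof -
  have v: "vector [p $ 1, p $ 2, p $ 3] = p" "vector [x $ 1, x $ 2, x $ 3] = x"
    by (simp_all add: vec_eq_iff forall_3)
  have "interval_lebesgue_integral lborel (ereal (p $ 1)) (ereal (x $ 1)) (\<lambda>t. \<Psi> (vector [t, p $ 2, p $ 3]) $ 1)
      = \<phi>1 (vector [x $ 1, p $ 2, p $ 3]) - \<phi>1 (vector [p $ 1, p $ 2, p $ 3])"
    by (rule axis_integral_potential[OF 1(1,2), where base = "vector [0, p $ 2, p $ 3]"])
      (use 1(3) in \<open>simp_all add: corner_vector v vec_eq_iff forall_3 axis_def\<close>)
  moreover have "interval_lebesgue_integral lborel (ereal (p $ 2)) (ereal (x $ 2)) (\<lambda>t. \<Psi> (vector [x $ 1, t, p $ 3]) $ 2)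
      = \<phi>2 (vector [x $ 1, x $ 2, p $ 3]) - \<phi>2 (vector [x $ 1, p $ 2, p $ 3])"
    by (rule axis_integral_potential[OF 2(1,2), where base = "vector [x $ 1, 0, p $ 3]"])
      (use 2(3) in \<open>simp_all add: corner_vector v vec_eq_iff forall_3 axis_def\<close>)
  moreover have "interval_lebesgue_integral lborel (ereal (p $ 3)) (ereal (x $ 3)) (\<lambda>t. \<Psi> (vector [x $ 1, x $ 2, t]) $ 3)
      = \<phi>3 (vector [x $ 1, x $ 2, x $ 3]) - \<phi>3 (vector [x $ 1, x $ 2, p $ 3])"
    by (rule axis_integral_potential[OF 3(1,2), where base = "vector [x $ 1, x $ 2, 0]"])
      (use 3(3) in \<open>simp_all add: corner_vector v vec_eq_iff forall_3 axis_def\<close>)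
  ultimately show ?thesis
    unfolding staircase_pot_def corner_vector v by simp
qed

text \<open>One direction is the fundamental theorem on the three legs. For the other, local
  potentials on tubes around the legs describe the staircase integral near \<open>x\<close>, and
  their gradients cancel at the two inner corners.\<close>

lemma scalar_potential_staircase_iff:
  assumes S: "open S" and \<Psi>: "C1_on S \<Psi>" and rot: "\<And>x. x \<in> S \<Longrightarrow> rot \<Psi> x = 0"
    and dom: "staircase_domain S p"
  shows "scalar_potential S \<Psi> \<phi> \<longleftrightarrow> (\<exists>c. \<forall>x\<in>S. \<phi> x = staircase_pot p c \<Psi> x)"
proof
  have seg: "closed_segment p (corner {1} p x) \<subseteq> S" "closed_segment (corner {1} p x) (corner {1, 2} p x) \<subseteq> S"
    "closed_segment (corner {1, 2} p x) x \<subseteq> S" if "x \<in> S" for x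
    using dom that unfolding staircase_domain_def corner_vector by blast+
  note cont = C1_on_continuous_on[OF \<Psi>]
  {
    assume \<phi>: "scalar_potential S \<Psi> \<phi>"
    have "\<phi> x = staircase_pot p (\<phi> p) \<Psi> x" if "x \<in> S" for x
      using staircase_pot_eq[OF \<phi> cont seg(1)[OF that] \<phi> cont seg(2)[OF that] \<phi> cont seg(3)[OF that]] by simp
    then show "\<exists>c. \<forall>x\<in>S. \<phi> x = staircase_pot p c \<Psi> x" by blast
  }
  assume "\<exists>c. \<forall>x\<in>S. \<phi> x = staircase_pot p c \<Psi> x"
  then obtain c where c: "\<And>x. x \<in> S \<Longrightarrow> \<phi> x = staircase_pot p c \<Psi> x" by blast
  have "has_partials \<phi> (\<lambda>k. \<Psi> x $ k) x" if x: "x \<in> S" for x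
  proof -
    let ?a = "corner {1} p" and ?b = "corner {1, 2} p"
    obtain U1 \<phi>1 where U1: "open U1" "convex U1" "closed_segment p (?a x) \<subseteq> U1" "U1 \<subseteq> S" "scalar_potential U1 \<Psi> \<phi>1"
      using potential_on_tube[OF S \<Psi> rot seg(1)[OF x]] by metis
    obtain U2 \<phi>2 where U2: "open U2" "convex U2" "closed_segment (?a x) (?b x) \<subseteq> U2" "U2 \<subseteq> S" "scalar_potential U2 \<Psi> \<phi>2"
      using potential_on_tube[OF S \<Psi> rot seg(2)[OF x]] by metis
    obtain U3 \<phi>3 where U3: "open U3" "convex U3" "closed_segment (?b x) x \<subseteq> U3" "U3 \<subseteq> S" "scalar_potential U3 \<Psi> \<phi>3"
      using potential_on_tube[OF S \<Psi> rot seg(3)[OF x]] by metis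
    \<comment> \<open>For \<open>y\<close> in this set the vertices of its staircase lie in the
      tubes chosen for \<open>x\<close>, and by convexity so do the legs.\<close>
    define N where "N = ?a -` (U1 \<inter> U2) \<inter> ?b -` (U2 \<inter> U3) \<inter> U3"
    have N: "open N"
      unfolding N_def using U1(1) U2(1) U3(1)
      by (intro open_Int open_vimage continuous_on_corner)
    have ends: "p \<in> U1" "?a x \<in> U1" "?a x \<in> U2" "?b x \<in> U2" "?b x \<in> U3" "x \<in> U3"
      using U1(3) U2(3) U3(3) by (meson ends_in_segment subsetD)+
    then have xN: "x \<in> N" by (simp add: N_def)
    let ?s = "\<lambda>y. (\<phi>1 (?a y) - \<phi>1 p) + (\<phi>2 (?b y) - \<phi>2 (?a y)) + (\<phi>3 y - \<phi>3 (?b y)) + c"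
    have eq: "?s y = \<phi> y" if y: "y \<in> N" for y
    proof -
      have "closed_segment p (?a y) \<subseteq> U1" "closed_segment (?a y) (?b y) \<subseteq> U2" "closed_segment (?b y) y \<subseteq> U3"
        by (rule closed_segment_subset; use y ends U1(2) U2(2) U3(2) in \<open>simp add: N_def\<close>)+
      then have "staircase_pot p c \<Psi> y = ?s y"
        using U1 U2 U3 by (intro staircase_pot_eq) (auto intro: continuous_on_subset[OF cont])
      moreover have "y \<in> S" using y U3(4) by (auto simp: N_def)
      ultimately show ?thesis using c by simp
    qed
    have hp: "has_partials \<phi>' (\<lambda>k. \<Psi> y $ k) y" if "scalar_potential U \<Psi> \<phi>'" "y \<in> U" for \<phi>' U y
      using that by (simp add: scalar_potential_iff)
    have const: "has_partials (\<lambda>_. d) (\<lambda>_. 0) x" for d :: complex by (simp add: has_partials_def)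
    \<comment> \<open>At each inner corner the two adjacent potentials have the same gradient,
      namely \<Psi> there, so the sum telescopes to the gradient at \<open>x\<close>.\<close>
    have "has_partials ?s (\<lambda>k. ((if k \<in> {1} then \<Psi> (?a x) $ k else 0) - 0)
       + ((if k \<in> {1, 2} then \<Psi> (?b x) $ k else 0) - (if k \<in> {1} then \<Psi> (?a x) $ k else 0))
       + (\<Psi> x $ k - (if k \<in> {1, 2} then \<Psi> (?b x) $ k else 0)) + 0) x"
      by (intro has_partials_add has_partials_diff has_partials_corner hp[OF U1(5)] hp[OF U2(5)] hp[OF U3(5)] const ends)
    then have "has_partials ?s (\<lambda>k. \<Psi> x $ k) x" by simp
    then show ?thesis by (rule has_partials_cong[OF _ N xN eq])
  qed
  then show "scalar_potential S \<Psi> \<phi>" by (simp add: scalar_potential_iff)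
qed

section \<open>The Vekua equation\<close>

lemma rot_nth:
  "rot V x $ 1 = pdiff 2 (\<lambda>y. V y $ 3) x - pdiff 3 (\<lambda>y. V y $ 2) x"
  "rot V x $ 2 = pdiff 3 (\<lambda>y. V y $ 1) x - pdiff 1 (\<lambda>y. V y $ 3) x"
  "rot V x $ 3 = pdiff 1 (\<lambda>y. V y $ 2) x - pdiff 2 (\<lambda>y. V y $ 1) x"
  by (simp_all add: rot_def)

lemma C1_on_differentiable: "C1_on S u \<Longrightarrow> x \<in> S \<Longrightarrow> u differentiable (at x)"
  by (simp add: C1_on_def)

lemma C1_on_smult:
  fixes c :: "real^3 \<Rightarrow> complex" and V :: "real^3 \<Rightarrow> complex^3"
  shows "C1_on S c \<Longrightarrow> C1_on S V \<Longrightarrow> C1_on S (\<lambda>y. c y *s V y)"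
  by (rule C1_on_vec) (simp add: C1_on_mult C1_on_nth)

lemma C1_on_inverse_square:
  fixes f :: "real^3 \<Rightarrow> 'a::real_normed_field"
  assumes "C1_on S f" "\<And>x. x \<in> S \<Longrightarrow> f x \<noteq> 0"
  shows "C1_on S (\<lambda>y. 1 / (f y)\<^sup>2)"
proof -
  have "C1_on S (\<lambda>y. (1 / f y) * (1 / f y))"
    using C1_on_inverse[OF assms] by (intro C1_on_mult)
  then show ?thesis by (simp add: power2_eq_square)
qed

lemma rot_add:
  "C1_on S U \<Longrightarrow> C1_on S V \<Longrightarrow> x \<in> S \<Longrightarrow> rot (\<lambda>y. U y + V y) x = rot U x + rot V x"
  by (simp add: vec_eq_iff forall_3 rot_nth pdiff_add C1_on_differentiable[OF C1_on_nth])

lemma rot_minus: "C1_on S U \<Longrightarrow> x \<in> S \<Longrightarrow> rot (\<lambda>y. - U y) x = - rot U x"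
  by (simp add: vec_eq_iff forall_3 rot_nth pdiff_minus C1_on_differentiable[OF C1_on_nth])

lemma divg_add:
  "C1_on S U \<Longrightarrow> C1_on S V \<Longrightarrow> x \<in> S \<Longrightarrow> divg (\<lambda>y. U y + V y) x = divg U x + divg V x"
  by (simp add: divg_def sum_3 pdiff_add C1_on_differentiable[OF C1_on_nth])

lemma divg_minus: "C1_on S U \<Longrightarrow> x \<in> S \<Longrightarrow> divg (\<lambda>y. - U y) x = - divg U x"
  by (simp add: divg_def sum_3 pdiff_minus C1_on_differentiable[OF C1_on_nth])

lemma C1_on_grad: "C2_on S u \<Longrightarrow> C1_on S (grad u)"
  by (rule C1_on_vec) (simp add: grad_def C2_on_def)

lemma rot_grad:
  assumes "open S" "C2_on S u" "x \<in> S"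
  shows "rot (grad u) x = 0"
  using pdiff_commute[OF assms] by (simp add: vec_eq_iff forall_3 rot_nth grad_def)

lemma divg_grad: "divg (grad u) x = laplacian u x"
  by (simp add: divg_def grad_def laplacian_def)

lemma scalar_potential_C2:
  assumes "open S" "scalar_potential S \<Psi> \<phi>" "C1_on S \<Psi>"
  shows "C2_on S \<phi>" "\<And>x. x \<in> S \<Longrightarrow> grad \<phi> x = \<Psi> x" "\<And>x. x \<in> S \<Longrightarrow> laplacian \<phi> x = divg \<Psi> x"
proof -
  show "C2_on S \<phi>"
    by (rule C2_onI[OF assms(1), where D = "\<lambda>k x. \<Psi> x $ k"])
      (use assms(2,3) in \<open>auto simp: scalar_potential_iff C1_on_nth\<close>)
  show g: "grad \<phi> x = \<Psi> x" if "x \<in> S" for x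
    using assms(2) that by (simp add: scalar_potential_def)
  show "laplacian \<phi> x = divg \<Psi> x" if "x \<in> S" for x
    using divg_cong[OF assms(1) that, of "grad \<phi>" \<Psi>] g by (simp add: divg_grad)
qed

lemma C2_on_mult:
  fixes u v :: "real^3 \<Rightarrow> 'a::real_normed_algebra"
  assumes "open S" "C2_on S u" "C2_on S v"
  shows "C2_on S (\<lambda>y. u y * v y)"
  by (rule C2_onI[OF assms(1), where D = "\<lambda>k x. u x * pdiff k v x + pdiff k u x * v x"])
    (use assms(2,3) in \<open>auto simp: C2_on_def intro!: has_partials_mult C1_on_has_partials C1_on_add C1_on_mult\<close>)

lemma C2_on_minus:
  assumes "open S" "C2_on S u"
  shows "C2_on S (\<lambda>y. - u y)"
  by (rule C2_onI[OF assms(1), where D = "\<lambda>k x. - pdiff k u x"])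
    (use assms(2) in \<open>auto simp: C2_on_def intro!: has_partials_minus C1_on_has_partials C1_on_minus\<close>)

lemma has_partials_quotient:
  fixes u f :: "real^3 \<Rightarrow> 'a::real_normed_field"
  assumes "has_partials u D x" "has_partials f E x" "f x \<noteq> 0"
  shows "has_partials (\<lambda>z. u z / f z) (\<lambda>k. (f x * D k - u x * E k) / (f x)\<^sup>2) x"
proof -
  have "has_partials (\<lambda>z. u z * (1 / f z)) (\<lambda>k. u x * (- E k / (f x)\<^sup>2) + D k * (1 / f x)) x"
    by (intro has_partials_mult has_partials_inverse assms)
  moreover have "(\<lambda>k. u x * (- E k / (f x)\<^sup>2) + D k * (1 / f x)) = (\<lambda>k. (f x * D k - u x * E k) / (f x)\<^sup>2)"
    using assms(3) by (auto simp: fun_eq_iff field_simps power2_eq_square)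
  ultimately show ?thesis by simp
qed

lemma C2_on_quotient:
  fixes u f :: "real^3 \<Rightarrow> 'a::real_normed_field"
  assumes "open S" "C2_on S u" "C2_on S f" "\<And>x. x \<in> S \<Longrightarrow> f x \<noteq> 0"
  shows "C2_on S (\<lambda>z. u z / f z)"
proof (rule C2_onI[OF assms(1)])
  have u: "C1_on S u" "\<And>k. C1_on S (pdiff k u)" and f: "C1_on S f" "\<And>k. C1_on S (pdiff k f)"
    using assms(2,3) by (auto simp: C2_on_def)
  show "has_partials (\<lambda>z. u z / f z) (\<lambda>k. (f x * pdiff k u x - u x * pdiff k f x) / (f x)\<^sup>2) x"
    if "x \<in> S" for x
    by (intro has_partials_quotient C1_on_has_partials[OF _ that] u f assms(4) that)
  have "C1_on S (\<lambda>x. (f x * pdiff k u x - u x * pdiff k f x) * (1 / (f x)\<^sup>2))" for k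
    by (intro C1_on_mult C1_on_diff C1_on_inverse_square u f assms(4))
  then show "C1_on S (\<lambda>x. (f x * pdiff k u x - u x * pdiff k f x) / (f x)\<^sup>2)" for k
    by simp
qed

lemma grad_quotient:
  assumes "u differentiable (at x)" "f differentiable (at x)" "f x \<noteq> 0"
  shows "(f x)\<^sup>2 *s grad (\<lambda>z. u z / f z) x = f x *s grad u x - u x *s grad f x"
proof -
  have "pdiff k (\<lambda>z. u z / f z) x = (f x * pdiff k u x - u x * pdiff k f x) / (f x)\<^sup>2" for k
    using has_partials_pdiff[OF has_partials_quotient[OF differentiable_has_partials[OF assms(1)]
        differentiable_has_partials[OF assms(2)] assms(3)]] .
  then show ?thesis using assms(3) by (simp add: grad_def vec_eq_iff)
qed

text \<open>In the form \<open>f grad u - u grad f\<close> the products of first partials cancel in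
  the divergence. This identifies the Schroedinger equation with vanishing divergence of the
  weighted gradient.\<close>

lemma divg_weighted_grad:
  assumes S: "open S" and u: "C2_on S u" and f: "C2_on S f" "\<And>x. x \<in> S \<Longrightarrow> f x \<noteq> 0" and x: "x \<in> S"
  shows "divg (\<lambda>y. (f y)\<^sup>2 *s grad (\<lambda>z. u z / f z) y) x = f x * laplacian u x - u x * laplacian f x"
proof -
  have d: "u differentiable (at y)" "f differentiable (at y)" "pdiff k u differentiable (at y)"
    "pdiff k f differentiable (at y)" if "y \<in> S" for y k
    using u f(1) that by (auto simp: C2_on_def C1_on_def)
  have "divg (\<lambda>y. (f y)\<^sup>2 *s grad (\<lambda>z. u z / f z) y) x = divg (\<lambda>y. f y *s grad u y - u y *s grad f y) x"
    by (rule divg_cong[OF S x]) (rule grad_quotient[OF d(1,2) f(2)])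
  also have "\<dots> = f x * laplacian u x - u x * laplacian f x"
    using d[OF x]
    by (simp add: divg_def laplacian_def grad_def sum_3 pdiff_diff pdiff_mult algebra_simps)
  finally show ?thesis .
qed

text \<open>Conjugation gives the terms in which \<open>grad f\<close> meets \<open>W\<close> the
  signs that complete the product rules for \<open>div (f W)\<close> and \<open>rot (f W)\<close>
  once the equation is multiplied by the nonvanishing \<open>f\<close>.\<close>

lemma vekua_equation_iff:
  assumes W0: "W0 differentiable (at x)" and W: "W differentiable (at x)"
    and f: "f differentiable (at x)" "f x \<noteq> 0"
  shows "dirac (\<lambda>y. CQuat (W0 y) (W y)) x
        - (CQuat (1 / f x) 0 * dirac (\<lambda>y. CQuat (f y) 0) x) * cconj (CQuat (W0 x) (W x)) = 0 \<longleftrightarrow>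
      divg (\<lambda>y. f y *s W y) x = 0 \<and> rot (\<lambda>y. f y *s W y) x = - ((f x)\<^sup>2 *s grad (\<lambda>z. W0 z / f z) x)"
proof -
  let ?L = "dirac (\<lambda>y. CQuat (W0 y) (W y)) x
        - (CQuat (1 / f x) 0 * dirac (\<lambda>y. CQuat (f y) 0) x) * cconj (CQuat (W0 x) (W x))"
  have Wi: "(\<lambda>y. W y $ i) differentiable (at x)" for i
    using has_partials_differentiable[OF has_partials_nth[OF differentiable_has_partials[OF W]]] .
  have p: "pdiff k (\<lambda>y. f y * W y $ i) x = f x * pdiff k W x $ i + pdiff k f x * W x $ i" for k i
    by (simp add: pdiff_mult[OF f(1) Wi] pdiff_nth[OF W])
  have sc: "f x * Sc ?L = - divg (\<lambda>y. f y *s W y) x"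
    using f(2) unfolding dirac_scalar
    by (simp add: dirac_def divg_def p sum_3 plus_cquat_def minus_cquat_def times_cquat_def cdot_def ccross_def
        e_unit_def cconj_def axis_def grad_def field_simps)
  have vc: "f x *s Vc ?L = rot (\<lambda>y. f y *s W y) x + (f x)\<^sup>2 *s grad (\<lambda>z. W0 z / f z) x"
    using f(2) unfolding dirac_scalar grad_quotient[OF W0 f]
    by (simp add: dirac_def rot_nth p sum_3 plus_cquat_def minus_cquat_def times_cquat_def cdot_def ccross_def
        e_unit_def cconj_def axis_def grad_def vec_eq_iff forall_3 field_simps)
  have "?L = 0 \<longleftrightarrow> f x * Sc ?L = 0 \<and> f x *s Vc ?L = 0"
    using f(2) by (simp add: cquat_eq_iff zero_cquat_def)
  also have "\<dots> \<longleftrightarrow> divg (\<lambda>y. f y *s W y) x = 0 \<and> rot (\<lambda>y. f y *s W y) x = - ((f x)\<^sup>2 *s grad (\<lambda>z. W0 z / f z) x)"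
    unfolding sc vc by (simp add: add_eq_0_iff2)
  finally show ?thesis .
qed

lemma vekua_sol_iff:
  assumes "C1_on S f" "\<And>x. x \<in> S \<Longrightarrow> f x \<noteq> 0"
  shows "vekua_sol S f W0 W \<longleftrightarrow> C1_on S W0 \<and> C1_on S W \<and>
      (\<forall>x\<in>S. divg (\<lambda>y. f y *s W y) x = 0 \<and>
        rot (\<lambda>y. f y *s W y) x = - ((f x)\<^sup>2 *s grad (\<lambda>z. W0 z / f z) x))"
  unfolding vekua_sol_def
  using vekua_equation_iff C1_on_differentiable assms by (metis (no_types, lifting))

section \<open>The curl of the volume potential\<close>

lemma rot_vol_pot:
  assumes S: "open S" and V: "C1_on S V"
    and conv: "vol_pot_converges S V" and z: "zero_ext_div_free S V"
  shows "C1_on S (rot (vol_pot S V))" "\<And>x. x \<in> S \<Longrightarrow> rot (rot (vol_pot S V)) x = V x"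
    "\<And>x. x \<in> S \<Longrightarrow> divg (rot (vol_pot S V)) x = 0"
proof -
  define v where "v = (\<lambda>y. indicator S y *\<^sub>R V y)"
  have int: "integrable lborel (\<lambda>y. (1 / norm (x - y)) *\<^sub>R v y)" if "x \<in> S" for x
    using conv that unfolding vol_pot_converges_def set_integrable_def v_def by (simp add: mult.commute)
  have meas: "v \<in> borel_measurable borel"
    unfolding v_def using C1_on_continuous_on[OF V] S
    by (intro borel_measurable_continuous_on_indicator) auto
  have B: "vol_pot S V = (\<lambda>x. (1 / (4 * pi)) *\<^sub>R (LBINT y. (1 / norm (x - y)) *\<^sub>R v y))"
    unfolding vol_pot_def set_lebesgue_integral_def v_def by (simp add: mult.commute)
  have "C1_on S (rot (vol_pot S V)) \<and> (\<forall>x\<in>S. rot (rot (vol_pot S V)) x = V x) \<and>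
    (\<forall>x\<in>S. divg (rot (vol_pot S V)) x = 0)"
  proof (cases "S = {}")
    case True
    then show ?thesis by (simp add: C1_on_def)
  next
    case False
    then obtain x0 where x0: "x0 \<in> S" by auto
    have adm: "admissible v"
      unfolding admissible_def
    proof
      \<comment> \<open>Convergence at the one point \<open>x0\<close> suffices, because
        \<open>|x0 - y| \<le> (1 + |x0|) (1 + |y|)\<close>.\<close>
      show "integrable lborel (\<lambda>y. norm (v y) / (1 + norm y))"
      proof (rule Bochner_Integration.integrable_bound)
        show "integrable lborel (\<lambda>y. (1 + norm x0) * norm ((1 / norm (x0 - y)) *\<^sub>R v y))"
          by (intro integrable_mult_right integrable_norm int x0)
        show "AE y in lborel. norm (norm (v y) / (1 + norm y)) \<le> norm ((1 + norm x0) * norm ((1 / norm (x0 - y)) *\<^sub>R v y))"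
          using AE_lborel_singleton[of x0]
        proof eventually_elim
          case (elim y)
          then have n: "norm (x0 - y) > 0" by simp
          have "norm (x0 - y) \<le> (1 + norm x0) * (1 + norm y)"
          proof -
            have "norm (x0 - y) \<le> norm x0 + norm y" by (rule norm_triangle_ineq4)
            moreover have "norm x0 * norm y \<ge> 0" by simp
            ultimately show ?thesis unfolding distrib_left distrib_right by linarith
          qed
          then have "1 / (1 + norm y) \<le> (1 + norm x0) * (1 / norm (x0 - y))"
            using n by (simp add: field_simps add_pos_nonneg)
          then have "1 / (1 + norm y) * norm (v y) \<le> (1 + norm x0) * (1 / norm (x0 - y)) * norm (v y)"
            by (intro mult_right_mono) auto
          then show ?case by simp
        qed
        show "(\<lambda>y. norm (v y) / (1 + norm y)) \<in> borel_measurable lborel"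
          using meas by simp
      qed
    qed (rule meas)
    obtain D DD where
      D: "\<And>x. x \<in> S \<Longrightarrow> has_partials (\<lambda>x. LBINT y. (1 / norm (x - y)) *\<^sub>R v y) (\<lambda>k. D k x) x"
      and DD: "\<And>x j. x \<in> S \<Longrightarrow> has_partials (D j) (\<lambda>k. DD k j x) x"
      and cont: "\<And>k j. continuous_on S (DD k j)" and sym: "\<And>k j. DD k j = DD j k"
      and lap: "\<And>x. x \<in> S \<Longrightarrow> (\<Sum>k\<in>UNIV. DD k k x) = - ((4 * pi) *\<^sub>R V x)"
      and lim: "\<And>x k j. x \<in> S \<Longrightarrow> (\<lambda>m. convo (nker2 (2^m) k j) v x) \<longlonglongrightarrow> DD k j x"
      by (rule newton_potential_C2[OF S V v_def adm int], assumption) (rule that)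
    \<comment> \<open>The gradient of the divergence: the regularized divergence is identically 0,
      so its partials vanish, and these converge to the sum in question.\<close>
    have div0: "(\<Sum>j\<in>UNIV. DD k j x $ j) = 0" if x: "x \<in> S" for k x
    proof -
      have pos: "(2::real)^m > 0" for m :: nat by simp
      have zero: "(\<Sum>j\<in>UNIV. convo (nker2 (2^m) k j) v x $ j) = 0" for m
      proof -
        have "has_partials (\<lambda>x. convo (nker1 (2^m) j) v x $ j) (\<lambda>k. convo (nker2 (2^m) k j) v x $ j) x" for j
          by (rule has_partials_nth[OF has_partials_convo[OF has_partials_nker1 decaying_nker(2)[OF pos] decaying_nker(3)[OF pos] adm]])
        then have "has_partials (\<lambda>x. \<Sum>j\<in>UNIV. convo (nker1 (2^m) j) v x $ j) (\<lambda>k. \<Sum>j\<in>UNIV. convo (nker2 (2^m) k j) v x $ j) x"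
          unfolding sum_3 by (intro has_partials_add)
        then have h: "has_partials (\<lambda>x. 0) (\<lambda>k. \<Sum>j\<in>UNIV. convo (nker2 (2^m) k j) v x $ j) x"
          using convo_divergence_free[OF S v_def adm z pos] by simp
        have "has_partials (\<lambda>x. 0::complex) (\<lambda>_. 0) x" by (simp add: has_partials_def)
        from has_partials_pdiff[OF this, of k] show ?thesis
          unfolding has_partials_pdiff[OF h, of k] .
      qed
      have "(\<lambda>m. \<Sum>j\<in>UNIV. convo (nker2 (2^m) k j) v x $ j) \<longlonglongrightarrow> (\<Sum>j\<in>UNIV. DD k j x $ j)"
        by (intro tendsto_intros lim x)
      then show ?thesis unfolding zero using LIMSEQ_unique tendsto_const by blast
    qed
    define c where "c = 1 / (4 * pi)"
    define R :: "real^3 \<Rightarrow> complex^3" where "R y = vector [c *\<^sub>R (D 2 y $ 3 - D 3 y $ 2), c *\<^sub>R (D 3 y $ 1 - D 1 y $ 3),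
        c *\<^sub>R (D 1 y $ 2 - D 2 y $ 1)]" for y
    have pB: "pdiff k (\<lambda>y. vol_pot S V y $ i) x = c *\<^sub>R (D k x $ i)" if "x \<in> S" for k i x
      unfolding B c_def[symmetric]
      using has_partials_pdiff[OF has_partials_nth[OF has_partials_bounded_linear[OF bounded_linear_scaleR_right D[OF that]]]] by simp
    have rB: "rot (vol_pot S V) x = R x" if "x \<in> S" for x
      unfolding rot_def R_def pB[OF that] by (simp add: scaleR_diff_right)
    have C1D: "C1_on S (D j)" for j using DD cont by (rule C1_onI)
    have C1B: "C1_on S (vol_pot S V)"
      unfolding B
      by (intro C1_on_bounded_linear[OF bounded_linear_scaleR_right] C1_onI[OF D] C1_on_continuous_on C1D)
    have "C1_on S (\<lambda>y. c *\<^sub>R (D i y $ j - D j y $ i))" for i j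
      by (intro C1_on_bounded_linear[OF bounded_linear_scaleR_right] C1_on_diff C1_on_nth C1D)
    then have "C1_on S (\<lambda>y. R y $ 1)" "C1_on S (\<lambda>y. R y $ 2)" "C1_on S (\<lambda>y. R y $ 3)"
      unfolding R_def vector_3 by blast+
    then have "C1_on S (\<lambda>y. R y $ i)" for i
      using exhaust_3[of i] by auto
    then have C1R: "C1_on S R" by (rule C1_on_vec)
    have C1rB: "C1_on S (rot (vol_pot S V))"
      by (rule C1_on_cong[OF C1R S]) (simp add: rB)
    have pR: "pdiff k (\<lambda>y. c *\<^sub>R (D i y $ j - D j y $ i)) x = c *\<^sub>R (DD k i x $ j - DD k j x $ i)"
      if "x \<in> S" for x k i j
      using has_partials_pdiff[OF has_partials_bounded_linear[OF bounded_linear_scaleR_right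
          has_partials_diff[OF has_partials_nth[OF DD[OF that]] has_partials_nth[OF DD[OF that]]]]] .
    have "rot (rot (vol_pot S V)) x = V x" if x: "x \<in> S" for x
    proof -
      have "rot (rot (vol_pot S V)) x = rot R x" by (rule rot_cong[OF S x rB])
      moreover have "rot R x $ i = V x $ i" for i
      proof -
        have l: "DD 1 1 x $ i + DD 2 2 x $ i + DD 3 3 x $ i = - ((4 * pi) *\<^sub>R V x $ i)" for i
          using arg_cong[OF lap[OF x], of "\<lambda>v. v $ i"] by (simp add: sum_3)
        have d: "DD k 1 x $ 1 + DD k 2 x $ 2 + DD k 3 x $ 3 = 0" for k
          using div0[OF x, of k] by (simp add: sum_3)
        have s: "DD 2 1 = DD 1 2" "DD 3 1 = DD 1 3" "DD 3 2 = DD 2 3" by (rule sym)+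
        \<comment> \<open>One component of rot rot = grad div - Laplacian. The pure second partial
          \<open>p\<close> occurs in both hypotheses and drops out of their difference.\<close>
        have g: "c *\<^sub>R (a - q) - c *\<^sub>R (r - b) = w"
          if "p + q + r = - ((4 * pi) *\<^sub>R w)" "p + a + b = 0" for a b p q r w :: complex
        proof -
          have "(a - q) - (r - b) = (4 * pi) *\<^sub>R w" using that by algebra
          then show ?thesis by (simp add: scaleR_diff_right[symmetric] c_def)
        qed
        have 1: "rot R x $ 1 = V x $ 1"
          unfolding rot_nth R_def vector_3 pR[OF x] s
          by (rule g[of "DD 1 1 x $ 1"]) (use l[of 1] d[of 1] in \<open>simp_all add: ac_simps\<close>)
        have 2: "rot R x $ 2 = V x $ 2"
          unfolding rot_nth R_def vector_3 pR[OF x] s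
          by (rule g[of "DD 2 2 x $ 2"]) (use l[of 2] d[of 2] in \<open>simp_all add: s ac_simps\<close>)
        have 3: "rot R x $ 3 = V x $ 3"
          unfolding rot_nth R_def vector_3 pR[OF x] s
          by (rule g[of "DD 3 3 x $ 3"]) (use l[of 3] d[of 3] in \<open>simp_all add: s ac_simps\<close>)
        show ?thesis using 1 2 3 exhaust_3[of i] by auto
      qed
      ultimately show ?thesis by (simp add: vec_eq_iff)
    qed
    moreover have "divg (rot (vol_pot S V)) x = 0" if "x \<in> S" for x
      by (rule divg_rot[OF S C1B C1rB that])
    ultimately show ?thesis using C1rB by blast
  qed
  then show "C1_on S (rot (vol_pot S V))" "\<And>x. x \<in> S \<Longrightarrow> rot (rot (vol_pot S V)) x = V x"
    "\<And>x. x \<in> S \<Longrightarrow> divg (rot (vol_pot S V)) x = 0" by blast+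
qed

text \<open>\<open>zero_ext_div_free\<close> is what makes the curl of the volume potential solve
  \<open>rot Y = V\<close>. Simple connectedness is asked for only where a potential of a curl free
  field has to be produced; in the first half this gives completeness of the formula. The second
  half describes all admissible \<open>W0\<close> at once, and then all potentials by the staircase
  formula.\<close>

theorem theorem11:
  fixes \<Omega> :: "(real^3) set" and f q :: "real^3 \<Rightarrow> complex"
  assumes "open \<Omega>" and "connected \<Omega>" and "\<Omega> \<noteq> {}"
    and "C2_on \<Omega> f" and "\<forall>x\<in>\<Omega>. f x \<noteq> 0"
    and "\<forall>x\<in>\<Omega>. q x = laplacian f x / f x"
  shows
    "(\<forall>W0 V F.
        schroedinger_sol \<Omega> q W0 \<and>
        V = (\<lambda>y. (f y)\<^sup>2 *s grad (\<lambda>z. W0 z / f z) y) \<and>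
        vol_pot_converges \<Omega> V \<and> zero_ext_div_free \<Omega> V \<and>
        F = (\<lambda>h x. - ((1 / f x) *s (rot (vol_pot \<Omega> V) x + grad h x))) \<longrightarrow>
        (\<forall>h. harmonic_on \<Omega> h \<longrightarrow>
           double_rot_sol \<Omega> f (\<lambda>x. f x *s F h x) \<and> vekua_sol \<Omega> f W0 (F h)) \<and>
        (simply_connected \<Omega> \<longrightarrow>
           (\<forall>W. double_rot_sol \<Omega> f (\<lambda>x. f x *s W x) \<and> vekua_sol \<Omega> f W0 W \<longrightarrow>
              (\<exists>h. harmonic_on \<Omega> h \<and> (\<forall>x\<in>\<Omega>. W x = F h x)))))
     \<and>
     (\<forall>\<Phi> W \<Psi>.
        double_rot_sol \<Omega> f \<Phi> \<and>
        W = (\<lambda>x. (1 / f x) *s \<Phi> x) \<and>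
        \<Psi> = (\<lambda>x. (1 / (f x)\<^sup>2) *s rot (\<lambda>y. f y *s W y) x) \<longrightarrow>
        (\<forall>W0. schroedinger_sol \<Omega> q W0 \<and> vekua_sol \<Omega> f W0 W \<longleftrightarrow>
              (\<exists>\<phi>. scalar_potential \<Omega> \<Psi> \<phi> \<and> (\<forall>x\<in>\<Omega>. W0 x = - f x * \<phi> x))) \<and>
        (simply_connected \<Omega> \<longrightarrow> (\<exists>\<phi>. scalar_potential \<Omega> \<Psi> \<phi>)) \<and>
        (\<forall>p. staircase_domain \<Omega> p \<longrightarrow>
           (\<forall>\<phi>. scalar_potential \<Omega> \<Psi> \<phi> \<longleftrightarrow>
                 (\<exists>c. \<forall>x\<in>\<Omega>. \<phi> x = staircase_pot p c \<Psi> x))))"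
proof -
  note S = assms(1) and f2 = assms(4)
  have fne: "f x \<noteq> 0" if "x \<in> \<Omega>" for x using assms(5) that by blast
  have f1: "C1_on \<Omega> f" using f2 by (simp add: C2_on_def)
  have vk_iff: "vekua_sol \<Omega> f W0 W \<longleftrightarrow> C1_on \<Omega> W0 \<and> C1_on \<Omega> W \<and>
      (\<forall>x\<in>\<Omega>. divg (\<lambda>y. f y *s W y) x = 0 \<and>
        rot (\<lambda>y. f y *s W y) x = - ((f x)\<^sup>2 *s grad (\<lambda>z. W0 z / f z) x))" for W0 W
    by (rule vekua_sol_iff[OF f1]) (rule fne)
  have inv_f: "C1_on \<Omega> (\<lambda>y. 1 / f y)" by (rule C1_on_inverse[OF f1 fne])
  show ?thesis
  proof (rule conjI, goal_cases)
  case 1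
  show ?case
  proof (intro allI impI, elim conjE, goal_cases)
    case (1 W0 V F)
    note W0 = 1(1) and V_def = 1(2) and conv = 1(3,4) and F_def = 1(5)
    have W02: "C2_on \<Omega> W0" using W0 by (simp add: schroedinger_sol_def)
    then have W01: "C1_on \<Omega> W0" by (simp add: C2_on_def)
    have g2: "C2_on \<Omega> (\<lambda>z. W0 z / f z)" by (rule C2_on_quotient[OF S W02 f2 fne])
    have V1: "C1_on \<Omega> V"
      unfolding V_def power2_eq_square by (intro C1_on_smult C1_on_mult f1 C1_on_grad[OF g2])
    note R = rot_vol_pot[OF S V1 conv]
    let ?R = "rot (vol_pot \<Omega> V)"
    have fF: "f x *s F h x = - (?R x + grad h x)" if "x \<in> \<Omega>" for h x
      using fne[OF that] by (simp add: F_def vec_eq_iff field_simps)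
    show ?case
    proof (intro conjI allI impI)
      fix h assume h: "harmonic_on \<Omega> h"
      then have h2: "C2_on \<Omega> h" and lap: "\<And>x. x \<in> \<Omega> \<Longrightarrow> laplacian h x = 0"
        by (auto simp: harmonic_on_def)
      note gh = C1_on_grad[OF h2]
      have P1: "C1_on \<Omega> (\<lambda>x. - (?R x + grad h x))"
        by (intro C1_on_minus C1_on_add R(1) gh)
      have Phi1: "C1_on \<Omega> (\<lambda>x. f x *s F h x)"
        by (rule C1_on_cong[OF P1 S]) (simp add: fF)
      have rotPhi: "rot (\<lambda>x. f x *s F h x) x = - V x" if x: "x \<in> \<Omega>" for x
      proof -
        have "rot (\<lambda>x. f x *s F h x) x = rot (\<lambda>x. - (?R x + grad h x)) x"
          by (rule rot_cong[OF S x fF])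
        also have "\<dots> = - (rot ?R x + rot (grad h) x)"
          by (simp only: rot_minus[OF C1_on_add[OF R(1) gh] x] rot_add[OF R(1) gh x])
        finally show ?thesis by (simp add: R(2)[OF x] rot_grad[OF S h2 x])
      qed
      have divPhi: "divg (\<lambda>x. f x *s F h x) x = 0" if x: "x \<in> \<Omega>" for x
      proof -
        have "divg (\<lambda>x. f x *s F h x) x = divg (\<lambda>x. - (?R x + grad h x)) x"
          by (rule divg_cong[OF S x fF])
        also have "\<dots> = - (divg ?R x + divg (grad h) x)"
          by (simp only: divg_minus[OF C1_on_add[OF R(1) gh] x] divg_add[OF R(1) gh x])
        finally show ?thesis by (simp add: R(3)[OF x] divg_grad lap[OF x])
      qed
      \<comment> \<open>The weighted curl is minus the gradient of the C2 function
        \<open>W0 / f\<close>, which supplies both its regularity and its vanishing curl.\<close>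
      have weighted: "(1 / (f x)\<^sup>2) *s rot (\<lambda>x. f x *s F h x) x = - grad (\<lambda>z. W0 z / f z) x"
        if x: "x \<in> \<Omega>" for x
        using fne[OF x] by (simp add: rotPhi[OF x] V_def vec_eq_iff)
      note gg = C1_on_grad[OF g2]
      show "double_rot_sol \<Omega> f (\<lambda>x. f x *s F h x)"
        unfolding double_rot_sol_def
      proof (intro conjI ballI Phi1 divPhi)
        show "C1_on \<Omega> (\<lambda>y. (1 / (f y)\<^sup>2) *s rot (\<lambda>x. f x *s F h x) y)"
          by (rule C1_on_cong[OF C1_on_minus[OF gg] S]) (simp add: weighted)
        fix x assume x: "x \<in> \<Omega>"
        have "rot (\<lambda>y. (1 / (f y)\<^sup>2) *s rot (\<lambda>x. f x *s F h x) y) x = rot (\<lambda>y. - grad (\<lambda>z. W0 z / f z) y) x"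
          by (rule rot_cong[OF S x weighted])
        then show "rot (\<lambda>y. (1 / (f y)\<^sup>2) *s rot (\<lambda>x. f x *s F h x) y) x = 0"
          by (simp add: rot_minus[OF gg x] rot_grad[OF S g2 x])
      qed
      have F1: "C1_on \<Omega> (F h)"
        unfolding F_def by (intro C1_on_minus C1_on_smult inv_f C1_on_add R(1) gh)
      show "vekua_sol \<Omega> f W0 (F h)"
        unfolding vk_iff
        using W01 F1 divPhi rotPhi by (simp add: V_def)
    next
      fix W
      assume sc: "simply_connected \<Omega>" and "double_rot_sol \<Omega> f (\<lambda>x. f x *s W x) \<and> vekua_sol \<Omega> f W0 W"
      then have dr: "double_rot_sol \<Omega> f (\<lambda>x. f x *s W x)" and vk: "vekua_sol \<Omega> f W0 W" by auto
      have Phi1: "C1_on \<Omega> (\<lambda>x. f x *s W x)" using dr by (simp add: double_rot_sol_def)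
      have rotPhi: "rot (\<lambda>y. f y *s W y) x = - V x" and divPhi: "divg (\<lambda>y. f y *s W y) x = 0"
        if "x \<in> \<Omega>" for x
        using vk that unfolding vk_iff V_def by auto
      \<comment> \<open>Solving \<open>W = F h\<close> for \<open>grad h\<close> leaves exactly this
        field; it is curl free because both curls are known, and divergence free, which makes
        \<open>h\<close> harmonic.\<close>
      define U where "U = (\<lambda>x. - (f x *s W x + ?R x))"
      have U1: "C1_on \<Omega> U" unfolding U_def by (intro C1_on_minus C1_on_add Phi1 R(1))
      have "rot U x = 0" if x: "x \<in> \<Omega>" for x
        unfolding U_def
        unfolding rot_minus[OF C1_on_add[OF Phi1 R(1)] x] rot_add[OF Phi1 R(1) x]
        by (simp add: rotPhi[OF x] R(2)[OF x])
      then obtain h where h: "scalar_potential \<Omega> U h"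
        using Poincare_simply_connected[OF S sc U1] by blast
      note hh = scalar_potential_C2[OF S h U1]
      have "divg U x = 0" if x: "x \<in> \<Omega>" for x
        unfolding U_def
        unfolding divg_minus[OF C1_on_add[OF Phi1 R(1)] x] divg_add[OF Phi1 R(1) x]
        by (simp add: divPhi[OF x] R(3)[OF x])
      then have "harmonic_on \<Omega> h" using hh by (simp add: harmonic_on_def)
      moreover have "W x = F h x" if x: "x \<in> \<Omega>" for x
        using fne[OF x] by (simp add: F_def hh(2)[OF x] U_def vec_eq_iff)
      ultimately show "\<exists>h. harmonic_on \<Omega> h \<and> (\<forall>x\<in>\<Omega>. W x = F h x)" by blast
    qed
  qed
next
  case 2
  show ?case
  proof (intro allI impI, elim conjE, goal_cases)
    case (1 \<Phi> W \<Psi>)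
    note dr = 1(1) and W_def = 1(2) and Psi_def = 1(3)
    have Phi1: "C1_on \<Omega> \<Phi>" and w1: "C1_on \<Omega> (\<lambda>y. (1 / (f y)\<^sup>2) *s rot \<Phi> y)"
      and w0: "\<And>x. x \<in> \<Omega> \<Longrightarrow> rot (\<lambda>y. (1 / (f y)\<^sup>2) *s rot \<Phi> y) x = 0"
      and div0: "\<And>x. x \<in> \<Omega> \<Longrightarrow> divg \<Phi> x = 0"
      using dr by (auto simp: double_rot_sol_def)
    have fW: "f x *s W x = \<Phi> x" if "x \<in> \<Omega>" for x
      using fne[OF that] by (simp add: W_def vec_eq_iff)
    have rotfW: "rot (\<lambda>y. f y *s W y) x = rot \<Phi> x" and divfW: "divg (\<lambda>y. f y *s W y) x = 0"
      if x: "x \<in> \<Omega>" for x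
      using rot_cong[OF S x fW] divg_cong[OF S x fW] div0[OF x] by auto
    have Psi: "\<Psi> x = (1 / (f x)\<^sup>2) *s rot \<Phi> x" if "x \<in> \<Omega>" for x
      using rotfW[OF that] by (simp add: Psi_def)
    have Psi1: "C1_on \<Omega> \<Psi>" by (rule C1_on_cong[OF w1 S]) (simp add: Psi)
    have Psi0: "rot \<Psi> x = 0" if x: "x \<in> \<Omega>" for x
      using rot_cong[OF S x Psi] w0[OF x] by simp
    have rotPhi: "rot \<Phi> x = (f x)\<^sup>2 *s \<Psi> x" if "x \<in> \<Omega>" for x
      using fne[OF that] by (simp add: Psi[OF that] vec_eq_iff)
    \<comment> \<open>Only the weighted curl is assumed differentiable. Multiplying the weight back
      makes \<open>rot \<Phi>\<close> itself C1, as \<open>divg_rot\<close> requires.\<close>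
    have "C1_on \<Omega> (\<lambda>x. (f x)\<^sup>2 *s \<Psi> x)"
      unfolding power2_eq_square by (intro C1_on_smult C1_on_mult f1 Psi1)
    then have rotPhi1: "C1_on \<Omega> (rot \<Phi>)"
      by (rule C1_on_cong[OF _ S]) (simp add: rotPhi)
    have W1: "C1_on \<Omega> W"
      unfolding W_def by (intro C1_on_smult inv_f Phi1)
    show ?case
    proof (intro conjI allI impI)
      fix W0
      show "schroedinger_sol \<Omega> q W0 \<and> vekua_sol \<Omega> f W0 W \<longleftrightarrow>
              (\<exists>\<phi>. scalar_potential \<Omega> \<Psi> \<phi> \<and> (\<forall>x\<in>\<Omega>. W0 x = - f x * \<phi> x))"
      proof
        assume "schroedinger_sol \<Omega> q W0 \<and> vekua_sol \<Omega> f W0 W"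
        then have W02: "C2_on \<Omega> W0" and vk: "vekua_sol \<Omega> f W0 W" by (auto simp: schroedinger_sol_def)
        have g1: "C1_on \<Omega> (\<lambda>z. W0 z / f z)"
          using C2_on_quotient[OF S W02 f2 fne] by (simp add: C2_on_def)
        have "scalar_potential \<Omega> \<Psi> (\<lambda>x. - (W0 x / f x))"
          unfolding scalar_potential_iff
        proof
          fix x assume x: "x \<in> \<Omega>"
          have "rot \<Phi> x = - ((f x)\<^sup>2 *s grad (\<lambda>z. W0 z / f z) x)"
            using vk x rotfW[OF x] unfolding vk_iff by auto
          then have "\<Psi> x = - grad (\<lambda>z. W0 z / f z) x"
            using fne[OF x] by (simp add: Psi[OF x] vec_eq_iff)
          then show "has_partials (\<lambda>x. - (W0 x / f x)) (\<lambda>k. \<Psi> x $ k) x"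
            using has_partials_minus[OF C1_on_has_partials[OF g1 x]] by (simp add: grad_def)
        qed
        moreover have "\<forall>x\<in>\<Omega>. W0 x = - f x * - (W0 x / f x)" using fne by simp
        ultimately show "\<exists>\<phi>. scalar_potential \<Omega> \<Psi> \<phi> \<and> (\<forall>x\<in>\<Omega>. W0 x = - f x * \<phi> x)"
          by blast
      next
        assume "\<exists>\<phi>. scalar_potential \<Omega> \<Psi> \<phi> \<and> (\<forall>x\<in>\<Omega>. W0 x = - f x * \<phi> x)"
        then obtain \<phi> where phi: "scalar_potential \<Omega> \<Psi> \<phi>" and W0: "\<And>x. x \<in> \<Omega> \<Longrightarrow> W0 x = - f x * \<phi> x"
          by blast
        note phi2 = scalar_potential_C2[OF S phi Psi1]
        have W02: "C2_on \<Omega> W0"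
          by (rule C2_on_cong[OF C2_on_mult[OF S C2_on_minus[OF S f2] phi2(1)] S]) (simp add: W0)
        have g: "grad (\<lambda>z. W0 z / f z) x = - \<Psi> x" if x: "x \<in> \<Omega>" for x
        proof -
          have "has_partials (\<lambda>z. - \<phi> z) (\<lambda>k. - (\<Psi> x $ k)) x"
            using phi x by (intro has_partials_minus) (simp add: scalar_potential_iff)
          then have "has_partials (\<lambda>z. W0 z / f z) (\<lambda>k. - (\<Psi> x $ k)) x"
            by (rule has_partials_cong[OF _ S x]) (simp add: W0 fne)
          from has_partials_pdiff[OF this] show ?thesis by (simp add: grad_def vec_eq_iff)
        qed
        have rotPhi': "rot \<Phi> x = - ((f x)\<^sup>2 *s grad (\<lambda>z. W0 z / f z) x)" if "x \<in> \<Omega>" for x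
          by (simp add: rotPhi[OF that] g[OF that] vec_eq_iff)
        have "vekua_sol \<Omega> f W0 W"
          unfolding vk_iff
          using W02 W1 divfW rotfW rotPhi' by (simp add: C2_on_def)
        moreover have "schroedinger_sol \<Omega> q W0"
          unfolding schroedinger_sol_def
        proof (intro conjI W02 ballI)
          fix x assume x: "x \<in> \<Omega>"
          \<comment> \<open>The Schroedinger expression, up to the factor \<open>f\<close>, is the
            divergence of \<open>- rot \<Phi>\<close>.\<close>
          have "f x * laplacian W0 x - W0 x * laplacian f x = divg (\<lambda>y. (f y)\<^sup>2 *s grad (\<lambda>z. W0 z / f z) y) x"
            by (rule divg_weighted_grad[OF S W02 f2 fne x, symmetric])
          also have "\<dots> = divg (\<lambda>y. - rot \<Phi> y) x"
            by (rule divg_cong[OF S x]) (simp add: rotPhi')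
          also have "\<dots> = 0"
            by (simp add: divg_minus[OF rotPhi1 x] divg_rot[OF S Phi1 rotPhi1 x])
          finally show "- laplacian W0 x + q x * W0 x = 0"
            using fne[OF x] assms(6) x by (simp add: field_simps)
        qed
        ultimately show "schroedinger_sol \<Omega> q W0 \<and> vekua_sol \<Omega> f W0 W" by blast
      qed
    next
      assume "simply_connected \<Omega>"
      then show "\<exists>\<phi>. scalar_potential \<Omega> \<Psi> \<phi>"
        using Poincare_simply_connected[OF S _ Psi1 Psi0] by blast
    next
      fix p \<phi> assume "staircase_domain \<Omega> p"
      then show "scalar_potential \<Omega> \<Psi> \<phi> \<longleftrightarrow> (\<exists>c. \<forall>x\<in>\<Omega>. \<phi> x = staircase_pot p c \<Psi> x)"
        using scalar_potential_staircase_iff[OF S Psi1 Psi0] by blast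
    qed
  qed
  qed
qed

end
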